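(* Let $k$ be an algebraically closed field of characteristic zero, and let $m>n\geq 0$ be integers with $m+n\geq 2$. Let $X\subset\mathbb{P}^{m+n+1}$ be a variety projectively isomorphic to the rational normal scroll $S_{m,n}$. Let $\sigma\colon\mathfrak{sl}_2\to LSA(X)$ be an isomorphism of Lie algebras, and let $Rep\colon\mathfrak{sl}_2\to\mathfrak{gl}(k^{m+n+2})$ be the representation it induces on the space $k^{m+n+2}$ of linear forms on $\mathbb{P}^{m+n+1}$. Let $v,w\in k^{m+n+2}$ be such that $v$ is an eigenvector of $Rep(h)$ with largest eigenvalue and $w=Rep(y)\cdot v$. Then the function $X\to\mathbb{P}^1$ defined by $w/v$ has as its fibers the lines of the ruling of $X$.
   Context: Rational normal scroll: for integers $m\geq n\geq 0$ with $m+n\geq 2$, $S_{m,n}\subset\mathbb{P}^{m+n+1}$ is the Zariski closure of the image of $(s,t)\mapsto(1:s:s^2:\ldots:s^m:t:st:s^2t:\ldots:s^nt)$. It is ruled by the pencil of lines $s=\text{constant}$ (the closures in $S_{m,n}$ of the images of $\{s\}\times k$, together with the limit line for $s=\infty$); when $(m,n)\neq(1,1)$ this ruling is unique. The ruling of a variety $X$ projectively isomorphic to $S_{m,n}$ is the corresponding pencil of lines on $X$. Lie algebra of a projective variety: for $X\subset\mathbb{P}^N$, $L(X)\subset\mathfrak{sl}_{N+1}$ is the tangent space at the identity of the algebraic group $\mathrm{PGL}_{N+1}(X)$ of all projective transformations of $\mathbb{P}^N$ mapping $X$ to itself, with its natural Lie product. $LSA(X)$ denotes a Levi subalgebra of $L(X)$,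 i.e. a semisimple subalgebra complementing the solvable radical; it is unique up to conjugation. For $X$ projectively isomorphic to $S_{m,n}$ with $m\neq n$, it is known that $LSA(X)\cong\mathfrak{sl}_2$, and the induced $\mathfrak{sl}_2$-module of dimension $m+n+2$ decomposes as $\mathrm{Sym}^m(k^2)\oplus\mathrm{Sym}^n(k^2)$. The Chevalley basis of $\mathfrak{sl}_2$ is $h=\begin{pmatrix}1&0\\0&-1\end{pmatrix}$, $x=\begin{pmatrix}0&1\\0&0\end{pmatrix}$, $y=\begin{pmatrix}0&0\\1&0\end{pmatrix}$. The action on linear forms is the one induced by the inclusion $LSA(X)\subset\mathfrak{sl}_{m+n+2}$: a matrix $A$ acts on a linear form $\ell$ by $(A\cdot\ell)(p)=-\ell(Ap)$. The eigenvalues of $Rep(h)$ are integers, so "largest eigenvalue" makes sense. The function $w/v$ is the rational map $X\dashrightarrow\mathbb{P}^1$ which is $p\mapsto w(p)/v(p)$ where $v(p)\neq 0$, extended to its maximal domain of definition; its fibers are understood as closures in $X$ (relevant only when $n=0$, where $X$ is a cone and the map is undefined at the vertex). *)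

theory Defs
  imports "Jordan_Normal_Form.Char_Poly" "HOL-Library.Poly_Mapping"
    "HOL-Computational_Algebra.Polynomial"
begin

section \<open>Polynomials in finitely many variables\<close>

text \<open>
  A polynomial with variables taken from the type 'v is a finitely supported map from exponent
  vectors to coefficients, an exponent vector being a finitely supported map from 'v to nat.
\<close>

definition peval :: "(('v \<Rightarrow>\<^sub>0 nat) \<Rightarrow>\<^sub>0 'a::comm_ring_1) \<Rightarrow> ('v \<Rightarrow> 'a) \<Rightarrow> 'a" where
  "peval F x = (\<Sum>e\<in>Poly_Mapping.keys F. Poly_Mapping.lookup F e * (\<Prod>i\<in>Poly_Mapping.keys e. x i ^ Poly_Mapping.lookup e i))"

text \<open>The zero polynomial is homogeneous of every degree.\<close>

definition homogeneous :: "'v set \<Rightarrow> nat \<Rightarrow> (('v \<Rightarrow>\<^sub>0 nat) \<Rightarrow>\<^sub>0 'a::comm_ring_1) \<Rightarrow> bool" where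
  "homogeneous V d F \<longleftrightarrow> (\<forall>e\<in>Poly_Mapping.keys F. Poly_Mapping.keys e \<subseteq> V \<and> (\<Sum>i\<in>Poly_Mapping.keys e. Poly_Mapping.lookup e i) = d)"

text \<open>The formal differential of F at x, applied to a: the sum over i of a i times the
  partial derivative of F with respect to the variable i, evaluated at x.\<close>

definition pdifferential ::
  "(('v \<Rightarrow>\<^sub>0 nat) \<Rightarrow>\<^sub>0 'a::comm_ring_1) \<Rightarrow> ('v \<Rightarrow> 'a) \<Rightarrow> ('v \<Rightarrow> 'a) \<Rightarrow> 'a" where
  "pdifferential F x a =
     (\<Sum>e\<in>Poly_Mapping.keys F. Poly_Mapping.lookup F e *
        (\<Sum>i\<in>Poly_Mapping.keys e. of_nat (Poly_Mapping.lookup e i) * x i ^ (Poly_Mapping.lookup e i - 1) * a i *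
           (\<Prod>j\<in>Poly_Mapping.keys e - {i}. x j ^ Poly_Mapping.lookup e j)))"


section \<open>Projective space and the Zariski topology\<close>

text \<open>
  All dimensions below are dimensions of the underlying vector space: proj_space N is the
  projective space of dimension N - 1 with homogeneous coordinates indexed by 0, ..., N - 1.
  A point is the set of all its homogeneous coordinate vectors.
\<close>

definition proj_pt :: "'a::field vec \<Rightarrow> 'a vec set" where
  "proj_pt p = {c \<cdot>\<^sub>v p | c. c \<noteq> 0}"

definition proj_space :: "nat \<Rightarrow> 'a::field vec set set" where
  "proj_space N = proj_pt ` (carrier_vec N - {0\<^sub>v N})"

definition vanishes_at :: "((nat \<Rightarrow>\<^sub>0 nat) \<Rightarrow>\<^sub>0 'a::field) \<Rightarrow> 'a vec set \<Rightarrow> bool" where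
  "vanishes_at F P \<longleftrightarrow> (\<forall>p\<in>P. peval F (\<lambda>i. p $ i) = 0)"

definition zariski_closure :: "nat \<Rightarrow> 'a::field vec set set \<Rightarrow> 'a vec set set" where
  "zariski_closure N S =
     {P \<in> proj_space N. \<forall>d F. homogeneous {..<N} d F \<longrightarrow> (\<forall>Q\<in>S. vanishes_at F Q) \<longrightarrow> vanishes_at F P}"

definition closure_in :: "nat \<Rightarrow> 'a::field vec set set \<Rightarrow> 'a vec set set \<Rightarrow> 'a vec set set" where
  "closure_in N X S = X \<inter> zariski_closure N S"

definition proj_map :: "'a::field mat \<Rightarrow> 'a vec set \<Rightarrow> 'a vec set" where
  "proj_map g P = (\<lambda>p. g *\<^sub>v p) ` P"

definition GL :: "nat \<Rightarrow> 'a::field mat set" where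
  "GL N = {g \<in> carrier_mat N N. invertible_mat g}"

definition projectively_isomorphic :: "nat \<Rightarrow> 'a::field vec set set \<Rightarrow> 'a vec set set \<Rightarrow> bool" where
  "projectively_isomorphic N X Y \<longleftrightarrow> (\<exists>g\<in>GL N. X = proj_map g ` Y)"


section \<open>Rational normal scrolls and their ruling\<close>

definition scroll_param :: "nat \<Rightarrow> nat \<Rightarrow> 'a::field \<Rightarrow> 'a \<Rightarrow> 'a vec" where
  "scroll_param m n s t = vec (m + n + 2) (\<lambda>i. if i \<le> m then s ^ i else t * s ^ (i - (m + 1)))"

definition scroll :: "nat \<Rightarrow> nat \<Rightarrow> 'a::field vec set set" where
  "scroll m n = zariski_closure (m + n + 2) {proj_pt (scroll_param m n s t) | s t. True}"

definition scroll_line :: "nat \<Rightarrow> nat \<Rightarrow> 'a::field \<Rightarrow> 'a vec set set" where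
  "scroll_line m n s =
     closure_in (m + n + 2) (scroll m n) {proj_pt (scroll_param m n s t) | t. True}"

text \<open>
  The line over s is spanned by (1, s, ..., s^m, 0, ..., 0) and (0, ..., 0, 1, s, ..., s^n).
  Dividing by s^m and s^n, respectively, and letting s tend to infinity gives the limit line,
  spanned by the unit vectors with indices m and m + n + 1.
\<close>

definition scroll_line_at_infinity :: "nat \<Rightarrow> nat \<Rightarrow> 'a::field vec set set" where
  "scroll_line_at_infinity m n =
     {proj_pt p | p. p \<in> carrier_vec (m + n + 2) \<and> p \<noteq> 0\<^sub>v (m + n + 2) \<and>
        (\<forall>i<m + n + 2. i \<noteq> m \<longrightarrow> i \<noteq> m + n + 1 \<longrightarrow> p $ i = 0)}"

definition scroll_ruling :: "nat \<Rightarrow> nat \<Rightarrow> 'a::field vec set set set" where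
  "scroll_ruling m n = insert (scroll_line_at_infinity m n) (range (scroll_line m n))"

text \<open>R is the ruling of X, transported along some projective isomorphism from the scroll onto X.\<close>

definition is_ruling :: "nat \<Rightarrow> nat \<Rightarrow> 'a::field vec set set \<Rightarrow> 'a vec set set set \<Rightarrow> bool" where
  "is_ruling m n X R \<longleftrightarrow>
     (\<exists>g\<in>GL (m + n + 2). X = proj_map g ` scroll m n \<and>
        R = (\<lambda>l. proj_map g ` l) ` scroll_ruling m n)"


section \<open>Lie algebras of matrices\<close>

definition mat_trace :: "'a::comm_ring_1 mat \<Rightarrow> 'a" where
  "mat_trace A = (\<Sum>i<dim_row A. A $$ (i, i))"

definition sl :: "nat \<Rightarrow> 'a::field mat set" where
  "sl N = {A \<in> carrier_mat N N. mat_trace A = 0}"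

definition lie_bracket :: "'a::field mat \<Rightarrow> 'a mat \<Rightarrow> 'a mat" where
  "lie_bracket A B = A * B - B * A"

definition mat_subspace :: "nat \<Rightarrow> 'a::field mat set \<Rightarrow> bool" where
  "mat_subspace N V \<longleftrightarrow> V \<subseteq> carrier_mat N N \<and> 0\<^sub>m N N \<in> V \<and>
     (\<forall>A\<in>V. \<forall>B\<in>V. A + B \<in> V) \<and> (\<forall>c. \<forall>A\<in>V. c \<cdot>\<^sub>m A \<in> V)"

definition lie_subalgebra :: "nat \<Rightarrow> 'a::field mat set \<Rightarrow> 'a mat set \<Rightarrow> bool" where
  "lie_subalgebra N M L \<longleftrightarrow> mat_subspace N M \<and> M \<subseteq> L \<and> (\<forall>A\<in>M. \<forall>B\<in>M. lie_bracket A B \<in> M)"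

definition lie_ideal :: "nat \<Rightarrow> 'a::field mat set \<Rightarrow> 'a mat set \<Rightarrow> bool" where
  "lie_ideal N I L \<longleftrightarrow> mat_subspace N I \<and> I \<subseteq> L \<and> (\<forall>A\<in>L. \<forall>B\<in>I. lie_bracket A B \<in> I)"

definition derived_algebra :: "nat \<Rightarrow> 'a::field mat set \<Rightarrow> 'a mat set" where
  "derived_algebra N L = mat_subspace N hull {lie_bracket A B | A B. A \<in> L \<and> B \<in> L}"

definition solvable_lie :: "nat \<Rightarrow> 'a::field mat set \<Rightarrow> bool" where
  "solvable_lie N L \<longleftrightarrow> (\<exists>k. (derived_algebra N ^^ k) L = {0\<^sub>m N N})"

definition is_radical :: "nat \<Rightarrow> 'a::field mat set \<Rightarrow> 'a mat set \<Rightarrow> bool" where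
  "is_radical N R L \<longleftrightarrow> lie_ideal N R L \<and> solvable_lie N R \<and>
     (\<forall>I. lie_ideal N I L \<longrightarrow> solvable_lie N I \<longrightarrow> I \<subseteq> R)"

definition semisimple_lie :: "nat \<Rightarrow> 'a::field mat set \<Rightarrow> bool" where
  "semisimple_lie N L \<longleftrightarrow> is_radical N {0\<^sub>m N N} L"

definition levi_subalgebra :: "nat \<Rightarrow> 'a::field mat set \<Rightarrow> 'a mat set \<Rightarrow> bool" where
  "levi_subalgebra N M L \<longleftrightarrow> lie_subalgebra N M L \<and> semisimple_lie N M \<and>
     (\<exists>R. is_radical N R L \<and> M \<inter> R = {0\<^sub>m N N} \<and> L = {A + B | A B. A \<in> M \<and> B \<in> R})"

definition lie_isomorphism ::
  "('a::field mat \<Rightarrow> 'a mat) \<Rightarrow> 'a mat set \<Rightarrow> 'a mat set \<Rightarrow> bool" where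
  "lie_isomorphism f L M \<longleftrightarrow> bij_betw f L M \<and>
     (\<forall>A\<in>L. \<forall>B\<in>L. f (A + B) = f A + f B) \<and> (\<forall>c. \<forall>A\<in>L. f (c \<cdot>\<^sub>m A) = c \<cdot>\<^sub>m f A) \<and>
     (\<forall>A\<in>L. \<forall>B\<in>L. f (lie_bracket A B) = lie_bracket (f A) (f B))"

definition chev_h :: "'a::field mat" where
  "chev_h = mat_of_rows_list 2 [[1, 0], [0, - 1]]"

definition chev_x :: "'a::field mat" where
  "chev_x = mat_of_rows_list 2 [[0, 1], [0, 0]]"

definition chev_y :: "'a::field mat" where
  "chev_y = mat_of_rows_list 2 [[0, 0], [1, 0]]"


section \<open>The Lie algebra of a projective variety\<close>

text \<open>All matrices representing an element of the group of projective transformations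
  mapping X to itself.\<close>

definition PGL_stabilizer :: "nat \<Rightarrow> 'a::field vec set set \<Rightarrow> 'a mat set" where
  "PGL_stabilizer N X = {g \<in> GL N. proj_map g ` X = X}"

text \<open>
  PGL is open in the projective space of N x N matrices.  The tangent space of that projective
  space at the class of the identity 1 is the space of all matrices modulo scalar matrices, which
  in characteristic 0 is identified with sl N (the trace zero matrices being a complement of the
  scalar ones, compatible with the commutator).  The tangent space of the closed subgroup
  stabilizing X is cut out by the differentials at 1 of the homogeneous polynomials in the matrix
  entries vanishing on the subgroup; by Euler's formula, these differentials vanish on the scalar
  matrices.
\<close>

definition lie_algebra_of :: "nat \<Rightarrow> 'a::field_char_0 vec set set \<Rightarrow> 'a mat set" where
  "lie_algebra_of N X =
     {A \<in> sl N. \<forall>d F. homogeneous ({..<N} \<times> {..<N}) d F \<longrightarrow>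
        (\<forall>g\<in>PGL_stabilizer N X. peval F (\<lambda>ij. g $$ ij) = 0) \<longrightarrow>
        pdifferential F (\<lambda>ij. 1\<^sub>m N $$ ij) (\<lambda>ij. A $$ ij) = 0}"

text \<open>
  A linear form is given by its coefficient vector l, its value at p being the scalar product of
  l and p.  On coefficient vectors, the action of A on linear forms is given by the negative
  transpose of A.
\<close>

definition dual_action :: "'a::field mat \<Rightarrow> 'a mat" where
  "dual_action A = - transpose_mat A"

lemma dual_action:
  fixes A :: "'a::field mat"
  assumes A: "A \<in> carrier_mat N N" and l: "l \<in> carrier_vec N" and p: "p \<in> carrier_vec N"
  shows "(dual_action A *\<^sub>v l) \<bullet> p = - (l \<bullet> (A *\<^sub>v p))"
proof -
  have "dual_action A *\<^sub>v l = - (transpose_mat A *\<^sub>v l)"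
    using A l by (intro eq_vecI) (auto simp: dual_action_def)
  then have "(dual_action A *\<^sub>v l) \<bullet> p = - ((transpose_mat A *\<^sub>v l) \<bullet> p)"
    using A l p by simp
  then show ?thesis
    using transpose_vec_mult_scalar[OF A p l] by simp
qed

text \<open>The representation of sl 2 on linear forms induced by an embedding of sl 2 into sl N.\<close>

definition Rep :: "('a::field mat \<Rightarrow> 'a mat) \<Rightarrow> 'a mat \<Rightarrow> 'a mat" where
  "Rep \<sigma> A = dual_action (\<sigma> A)"


section \<open>The rational map given by a quotient of linear forms\<close>

text \<open>
  The rational map w/v from X to the projective line, on its maximal domain of definition.  It is
  defined at P with value c if some pair F, G of homogeneous polynomials of the same degree
  without common zero at P satisfies F/G = w/v on the part of X where v is nonzero and F, G are
  not both zero (at common zeros of F and G the equation below holds trivially), and c is the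
  point (F(P) : G(P)).  In particular, F = w and G = v works wherever v is nonzero.
\<close>

definition quotient_map_value ::
  "'a::field vec set set \<Rightarrow> nat \<Rightarrow> 'a vec \<Rightarrow> 'a vec \<Rightarrow> 'a vec set \<Rightarrow> 'a vec set \<Rightarrow> bool" where
  "quotient_map_value X N w v P c \<longleftrightarrow> P \<in> X \<and>
     (\<exists>d F G. homogeneous {..<N} d F \<and> homogeneous {..<N} d G \<and>
        (\<forall>Q\<in>X. \<forall>q\<in>Q. v \<bullet> q \<noteq> 0 \<longrightarrow>
           peval F (\<lambda>i. q $ i) * (v \<bullet> q) = (w \<bullet> q) * peval G (\<lambda>i. q $ i)) \<and>
        (\<exists>p\<in>P. (peval F (\<lambda>i. p $ i), peval G (\<lambda>i. p $ i)) \<noteq> (0, 0) \<and>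
           c = proj_pt (vec_of_list [peval F (\<lambda>i. p $ i), peval G (\<lambda>i. p $ i)])))"

definition quotient_map_fiber ::
  "'a::field vec set set \<Rightarrow> nat \<Rightarrow> 'a vec \<Rightarrow> 'a vec \<Rightarrow> 'a vec set \<Rightarrow> 'a vec set set" where
  "quotient_map_fiber X N w v c = closure_in N X {P. quotient_map_value X N w v P c}"

end

theory Submission
  imports Defs
begin

text \<open>
  Let S be the scroll and X = g S.  On the parametrised part of S a linear form is f(s) + t g(s)
  with polynomials f, g of degrees at most m, n.  An element of the Lie algebra of X, pulled back
  along g, is tangent to S: it satisfies the linearised equations of the 2 x 2 minors that define
  S (\<open>tangent_of_lie_algebra\<close>).  Since n < m, counting degrees in these equations shows that
  it preserves the space of forms with g = 0 and that it acts on this space and on the quotient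
  as f \<mapsto> M f - K f' and g \<mapsto> M' g - K g' with the same polynomial K of degree at
  most 2, a vector field on the projective line (\<open>covers_vector_field_of_tangent\<close>).

  A copy of sl 2 in the Lie algebra of X is thereby mapped to the vector fields on the projective
  line, injectively, because the kernel cannot contain an image of sl 2 (\<open>Kx_nonzero\<close>).
  On brackets the multipliers are M = (m/2) K' and M' = (n/2) K', so the two pieces are the
  representations on forms of degree m and n in two variables.  As n < m, a form v of maximal
  weight lies in the first piece, where it is c \<ell>^m with a linear form \<ell> on the line.
  Then w = y v is d \<ell>^(m-1) \<ell>' with \<ell>' independent of \<ell>
  (\<open>highest_weight_form\<close>).

  So w/v is a multiple of \<ell>'/\<ell>, a coordinate on the projective line that indexes the
  lines of S.  Its value at a point is the index of a line through the point, and it is defined on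
  a dense part of each line; since the lines are closed, they are the closures of the level sets
  (\<open>quotient_map_fiber_eq_line\<close>).
\<close>

section \<open>Polynomial functions\<close>

definition monomial_eval :: "('v \<Rightarrow>\<^sub>0 nat) \<Rightarrow> ('v \<Rightarrow> 'a::comm_ring_1) \<Rightarrow> 'a" where
  "monomial_eval e x = (\<Prod>i\<in>Poly_Mapping.keys e. x i ^ Poly_Mapping.lookup e i)"

lemma peval_eq_sum_superset:
  assumes "finite S" "Poly_Mapping.keys F \<subseteq> S"
  shows "peval F x = (\<Sum>e\<in>S. Poly_Mapping.lookup F e * monomial_eval e x)"
  unfolding peval_def monomial_eval_def
  by (rule sum.mono_neutral_left) (use assms in \<open>auto simp: in_keys_iff\<close>)

lemma monomial_eval_eq_prod_superset:
  assumes "finite S" "Poly_Mapping.keys e \<subseteq> S"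
  shows "monomial_eval e x = (\<Prod>i\<in>S. x i ^ Poly_Mapping.lookup e i)"
  unfolding monomial_eval_def
  by (rule prod.mono_neutral_left) (use assms in \<open>auto simp: in_keys_iff\<close>)

lemma total_degree_eq_sum_superset:
  fixes e :: "'v \<Rightarrow>\<^sub>0 nat"
  assumes "finite S" "Poly_Mapping.keys e \<subseteq> S"
  shows "(\<Sum>i\<in>Poly_Mapping.keys e. Poly_Mapping.lookup e i) = (\<Sum>i\<in>S. Poly_Mapping.lookup e i)"
  by (rule sum.mono_neutral_left) (use assms in \<open>auto simp: in_keys_iff\<close>)

lemma keys_add_nat:
  fixes e e' :: "'v \<Rightarrow>\<^sub>0 nat"
  shows "Poly_Mapping.keys (e + e') = Poly_Mapping.keys e \<union> Poly_Mapping.keys e'"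
  by (auto simp: in_keys_iff lookup_add)

lemma monomial_eval_add: "monomial_eval (e + e') x = monomial_eval e x * monomial_eval e' x"
  by (simp add: monomial_eval_eq_prod_superset[of "Poly_Mapping.keys e \<union> Poly_Mapping.keys e'"]
      keys_add_nat lookup_add power_add prod.distrib)

lemma peval_add: "peval (F + G) x = peval F x + peval G x"
proof -
  let ?S = "Poly_Mapping.keys F \<union> Poly_Mapping.keys G"
  have "Poly_Mapping.keys (F + G) \<subseteq> ?S"
    by (rule keys_add)
  then show ?thesis
    by (simp add: peval_eq_sum_superset[of ?S] lookup_add sum.distrib algebra_simps)
qed

lemma peval_single: "peval (Poly_Mapping.single e c) x = c * monomial_eval e x"
  by (simp add: peval_eq_sum_superset[of "{e}"])

text \<open>
  Equations are written down as functions of the coordinates; the closure properties of this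
  predicate replace computations with finitely supported maps.
\<close>

definition form_fun :: "'v set \<Rightarrow> nat \<Rightarrow> (('v \<Rightarrow> 'a::comm_ring_1) \<Rightarrow> 'a) \<Rightarrow> bool" where
  "form_fun V d \<phi> \<longleftrightarrow> (\<exists>F. homogeneous V d F \<and> (\<forall>x. peval F x = \<phi> x))"

lemma form_funE:
  assumes "form_fun V d \<phi>"
  obtains F where "homogeneous V d F" "\<And>x. peval F x = \<phi> x"
  using assms unfolding form_fun_def by blast

lemma form_fun_zero: "form_fun V d (\<lambda>x. 0)"
  unfolding form_fun_def by (rule exI[of _ 0]) (simp add: homogeneous_def peval_def)

lemma form_fun_add:
  assumes "form_fun V d \<phi>" "form_fun V d \<psi>"
  shows "form_fun V d (\<lambda>x. \<phi> x + \<psi> x)"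
proof -
  obtain F where F: "homogeneous V d F" "\<And>x. peval F x = \<phi> x"
    using form_funE[OF assms(1)] by blast
  obtain G where G: "homogeneous V d G" "\<And>x. peval G x = \<psi> x"
    using form_funE[OF assms(2)] by blast
  have "homogeneous V d (F + G)"
    using F(1) G(1) keys_add[of F G] unfolding homogeneous_def by blast
  then show ?thesis
    unfolding form_fun_def using F(2) G(2) by (intro exI[of _ "F + G"]) (simp add: peval_add)
qed

lemma form_fun_sum:
  assumes "\<And>i. i \<in> I \<Longrightarrow> form_fun V d (\<phi> i)"
  shows "form_fun V d (\<lambda>x. \<Sum>i\<in>I. \<phi> i x)"
  using assms by (induction I rule: infinite_finite_induct)
    (auto intro: form_fun_zero form_fun_add)

lemma form_fun_monomial:
  assumes "Poly_Mapping.keys e \<subseteq> V" "(\<Sum>i\<in>Poly_Mapping.keys e. Poly_Mapping.lookup e i) = d"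
  shows "form_fun V d (\<lambda>x. c * monomial_eval e x)"
  unfolding form_fun_def using assms
  by (intro exI[of _ "Poly_Mapping.single e c"]) (simp add: homogeneous_def peval_single)

lemma form_fun_mult:
  assumes "form_fun V d \<phi>" "form_fun V d' \<psi>"
  shows "form_fun V (d + d') (\<lambda>x. \<phi> x * \<psi> x)"
proof -
  obtain F where F: "homogeneous V d F" "\<And>x. peval F x = \<phi> x"
    using form_funE[OF assms(1)] by blast
  obtain G where G: "homogeneous V d' G" "\<And>x. peval G x = \<psi> x"
    using form_funE[OF assms(2)] by blast
  have "form_fun V (d + d') (\<lambda>x. \<Sum>e\<in>Poly_Mapping.keys F. \<Sum>e'\<in>Poly_Mapping.keys G.
      (Poly_Mapping.lookup F e * Poly_Mapping.lookup G e') * monomial_eval (e + e') x)"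
  proof (intro form_fun_sum form_fun_monomial)
    fix e e' assume e: "e \<in> Poly_Mapping.keys F" "e' \<in> Poly_Mapping.keys G"
    show "Poly_Mapping.keys (e + e') \<subseteq> V"
      using e F(1) G(1) by (auto simp: keys_add_nat homogeneous_def)
    let ?S = "Poly_Mapping.keys e \<union> Poly_Mapping.keys e'"
    have "(\<Sum>i\<in>Poly_Mapping.keys e. Poly_Mapping.lookup e i) = d"
      "(\<Sum>i\<in>Poly_Mapping.keys e'. Poly_Mapping.lookup e' i) = d'"
      using e F(1) G(1) by (auto simp: homogeneous_def)
    then show "(\<Sum>i\<in>Poly_Mapping.keys (e + e'). Poly_Mapping.lookup (e + e') i) = d + d'"
      by (simp add: total_degree_eq_sum_superset[of ?S] keys_add_nat lookup_add sum.distrib)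
  qed
  moreover have "(\<Sum>e\<in>Poly_Mapping.keys F. \<Sum>e'\<in>Poly_Mapping.keys G.
      (Poly_Mapping.lookup F e * Poly_Mapping.lookup G e') * monomial_eval (e + e') x) = \<phi> x * \<psi> x" for x
    by (simp flip: F(2) G(2) add: peval_eq_sum_superset[OF finite_keys order_refl]
        monomial_eval_add sum_product mult_ac)
  ultimately show ?thesis by simp
qed

lemma form_fun_coord:
  assumes "i \<in> V"
  shows "form_fun V 1 (\<lambda>x. c * x i)"
  using form_fun_monomial[of "Poly_Mapping.single i 1" V 1 c] assms
  by (simp add: monomial_eval_def)

lemma form_fun_diff:
  assumes "form_fun V d \<phi>" "form_fun V d \<psi>"
  shows "form_fun V d (\<lambda>x. \<phi> x - \<psi> x)"
proof -
  have "form_fun V 0 (\<lambda>x. - 1 :: 'b)"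
    using form_fun_monomial[of 0 V 0 "- 1 :: 'b"] by (simp add: monomial_eval_def)
  from form_fun_mult[OF this assms(2)] have "form_fun V d (\<lambda>x. - \<psi> x)" by simp
  from form_fun_add[OF assms(1) this] show ?thesis by simp
qed

text \<open>
  Density arguments are made along lines in parameter space, on which every equation becomes a
  polynomial in one variable.
\<close>

definition poly_fun :: "('a::comm_ring_1 \<Rightarrow> 'a) \<Rightarrow> bool" where
  "poly_fun \<phi> \<longleftrightarrow> (\<exists>q. \<forall>\<tau>. \<phi> \<tau> = poly q \<tau>)"

lemma poly_funI: "(\<And>\<tau>. \<phi> \<tau> = poly q \<tau>) \<Longrightarrow> poly_fun \<phi>"
  by (auto simp: poly_fun_def)

lemma poly_fun_const: "poly_fun (\<lambda>\<tau>. c)"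
  by (rule poly_funI[of _ "[:c:]"]) simp

lemma poly_fun_id: "poly_fun (\<lambda>\<tau>. \<tau>)"
  by (rule poly_funI[of _ "[:0, 1:]"]) simp

lemma poly_fun_add: "poly_fun \<phi> \<Longrightarrow> poly_fun \<psi> \<Longrightarrow> poly_fun (\<lambda>\<tau>. \<phi> \<tau> + \<psi> \<tau>)"
  unfolding poly_fun_def by (metis poly_add)

lemma poly_fun_diff: "poly_fun \<phi> \<Longrightarrow> poly_fun \<psi> \<Longrightarrow> poly_fun (\<lambda>\<tau>. \<phi> \<tau> - \<psi> \<tau>)"
  unfolding poly_fun_def by (metis poly_diff)

lemma poly_fun_mult: "poly_fun \<phi> \<Longrightarrow> poly_fun \<psi> \<Longrightarrow> poly_fun (\<lambda>\<tau>. \<phi> \<tau> * \<psi> \<tau>)"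
  unfolding poly_fun_def by (metis poly_mult)

lemma poly_fun_power: "poly_fun \<phi> \<Longrightarrow> poly_fun (\<lambda>\<tau>. \<phi> \<tau> ^ k)"
  unfolding poly_fun_def by (metis poly_power)

lemma poly_fun_sum: "(\<And>i. i \<in> I \<Longrightarrow> poly_fun (\<phi> i)) \<Longrightarrow> poly_fun (\<lambda>\<tau>. \<Sum>i\<in>I. \<phi> i \<tau>)"
  by (induction I rule: infinite_finite_induct) (auto intro: poly_fun_const poly_fun_add)

lemma poly_fun_prod: "(\<And>i. i \<in> I \<Longrightarrow> poly_fun (\<phi> i)) \<Longrightarrow> poly_fun (\<lambda>\<tau>. \<Prod>i\<in>I. \<phi> i \<tau>)"
  by (induction I rule: infinite_finite_induct) (auto intro: poly_fun_const poly_fun_mult)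

lemmas poly_fun_intros = poly_fun_const poly_fun_id poly_fun_add poly_fun_diff poly_fun_mult
  poly_fun_power poly_fun_sum poly_fun_prod

lemma poly_fun_peval:
  assumes "\<And>i. poly_fun (\<lambda>\<tau>. x \<tau> i)"
  shows "poly_fun (\<lambda>\<tau>. peval F (x \<tau>))"
  unfolding peval_def by (intro poly_fun_intros assms)

text \<open>
  A density argument in one variable: the product D E vanishes identically and E does not.
\<close>

lemma poly_fun_zero_by_density:
  fixes D E :: "'a::field_char_0 \<Rightarrow> 'a"
  assumes "poly_fun D" "poly_fun E" and "E \<tau>0 \<noteq> 0" and "\<And>\<tau>. E \<tau> \<noteq> 0 \<Longrightarrow> D \<tau> = 0"
  shows "D \<tau> = 0"
proof -
  obtain p q where p: "\<And>\<tau>. D \<tau> = poly p \<tau>" and q: "\<And>\<tau>. E \<tau> = poly q \<tau>"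
    using assms(1,2) by (auto simp: poly_fun_def)
  have "poly (p * q) = poly 0"
    using assms(4) by (auto simp: p q fun_eq_iff)
  then have "p * q = 0" by (simp only: poly_eq_poly_eq_iff)
  moreover have "q \<noteq> 0" using assms(3) by (auto simp: q)
  ultimately show ?thesis by (simp add: p)
qed

lemma pdifferential_eq_derivative:
  "\<exists>q. (\<forall>\<tau>. peval F (\<lambda>i. x i + \<tau> * a i) = poly q \<tau>) \<and> poly (pderiv q) 0 = pdifferential F x a"
proof (intro exI conjI allI)
  let ?m = "\<lambda>e. \<Prod>i\<in>Poly_Mapping.keys e. [:x i, a i:] ^ Poly_Mapping.lookup e i"
  let ?q = "\<Sum>e\<in>Poly_Mapping.keys F. Polynomial.smult (Poly_Mapping.lookup F e) (?m e)"
  show "peval F (\<lambda>i. x i + \<tau> * a i) = poly ?q \<tau>" for \<tau>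
    by (simp add: peval_def poly_sum poly_prod)
  show "poly (pderiv ?q) 0 = pdifferential F x a"
    by (simp add: pderiv_sum pderiv_smult pderiv_prod pderiv_power pdifferential_def poly_sum
        poly_prod pderiv_pCons mult_ac del: pderiv_power_Suc)
qed

text \<open>
  The formal differential is the derivative along a line, so it depends only on the polynomial
  function and can be computed without expanding the polynomial into monomials.
\<close>

lemma pdifferential_eq_derivative_of_restriction:
  fixes F :: "('v \<Rightarrow>\<^sub>0 nat) \<Rightarrow>\<^sub>0 'a::field_char_0"
  assumes "\<And>\<tau>. peval F (\<lambda>i. x i + \<tau> * a i) = poly r \<tau>"
  shows "pdifferential F x a = poly (pderiv r) 0"
proof -
  obtain q where q: "\<And>\<tau>. peval F (\<lambda>i. x i + \<tau> * a i) = poly q \<tau>"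
      "poly (pderiv q) 0 = pdifferential F x a"
    using pdifferential_eq_derivative[of F x a] by auto
  have "poly q = poly r" by (auto simp: fun_eq_iff simp flip: q(1) assms)
  then show ?thesis using q(2) by (simp add: poly_eq_poly_eq_iff)
qed

lemma peval_scale:
  assumes "homogeneous V d F"
  shows "peval F (\<lambda>i. c * x i) = c ^ d * peval F x"
  unfolding peval_def sum_distrib_left
proof (rule sum.cong[OF refl])
  fix e assume "e \<in> Poly_Mapping.keys F"
  then have "(\<Sum>i\<in>Poly_Mapping.keys e. Poly_Mapping.lookup e i) = d"
    using assms by (auto simp: homogeneous_def)
  then show "Poly_Mapping.lookup F e * (\<Prod>i\<in>Poly_Mapping.keys e. (c * x i) ^ Poly_Mapping.lookup e i) =
      c ^ d * (Poly_Mapping.lookup F e * (\<Prod>i\<in>Poly_Mapping.keys e. x i ^ Poly_Mapping.lookup e i))"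
    by (simp add: power_mult_distrib prod.distrib power_sum mult_ac flip: power_sum)
qed

lemma peval_cong:
  assumes "homogeneous V d F" "\<And>i. i \<in> V \<Longrightarrow> x i = y i"
  shows "peval F x = peval F y"
  unfolding peval_def
proof (intro sum.cong refl arg_cong2[of _ _ _ _ "(*)"] prod.cong)
  fix e i assume "e \<in> Poly_Mapping.keys F" "i \<in> Poly_Mapping.keys e"
  then have "i \<in> V" using assms(1) by (auto simp: homogeneous_def)
  then show "x i ^ Poly_Mapping.lookup e i = y i ^ Poly_Mapping.lookup e i" using assms(2) by simp
qed

section \<open>Points, linear maps and closures in projective space\<close>

lemma mem_proj_pt_iff: "q \<in> proj_pt p \<longleftrightarrow> (\<exists>c. c \<noteq> 0 \<and> q = c \<cdot>\<^sub>v p)"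
  by (auto simp: proj_pt_def)

lemma proj_pt_self: "p \<in> proj_pt p"
  by (auto simp: proj_pt_def intro!: exI[of _ 1])

lemma proj_pt_smult:
  assumes "c \<noteq> 0"
  shows "proj_pt (c \<cdot>\<^sub>v p) = proj_pt p"
proof -
  have "d \<cdot>\<^sub>v p = (d / c) \<cdot>\<^sub>v (c \<cdot>\<^sub>v p)" for d
    using assms by (simp add: smult_smult_assoc)
  then show ?thesis
    using assms unfolding set_eq_iff mem_proj_pt_iff
    by (metis divide_eq_0_iff mult_eq_0_iff smult_smult_assoc)
qed

lemma proj_pt_in_proj_space: "p \<in> carrier_vec N \<Longrightarrow> p \<noteq> 0\<^sub>v N \<Longrightarrow> proj_pt p \<in> proj_space N"
  by (auto simp: proj_space_def)

lemma proj_space_memD: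
  assumes "P \<in> proj_space N" "p \<in> P"
  shows "p \<in> carrier_vec N" "p \<noteq> 0\<^sub>v N" "P = proj_pt p"
proof -
  obtain q where q': "q \<in> carrier_vec N" "q \<noteq> 0\<^sub>v N" "P = proj_pt q"
    using assms(1) unfolding proj_space_def by blast
  have "p \<in> proj_pt q" using assms(2) q'(3) by simp
  then obtain c where "c \<noteq> 0" "p = c \<cdot>\<^sub>v q" by (auto simp: mem_proj_pt_iff)
  note q = q' this
  show "p \<in> carrier_vec N" using q by simp
  show "P = proj_pt p" using q by (simp add: proj_pt_smult)
  show "p \<noteq> 0\<^sub>v N"
  proof
    assume "p = 0\<^sub>v N"
    then have "(1 / c) \<cdot>\<^sub>v (c \<cdot>\<^sub>v q) = 0\<^sub>v N" using q(5) by (intro eq_vecI) auto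
    then show False using q by (simp add: smult_smult_assoc)
  qed
qed

lemma proj_map_proj_pt:
  assumes "g \<in> carrier_mat N N" "p \<in> carrier_vec N"
  shows "proj_map g (proj_pt p) = proj_pt (g *\<^sub>v p)"
proof -
  have "g *\<^sub>v (c \<cdot>\<^sub>v p) = c \<cdot>\<^sub>v (g *\<^sub>v p)" for c
    using assms by (rule mult_mat_vec)
  then show ?thesis
    unfolding set_eq_iff proj_map_def image_iff Bex_def mem_proj_pt_iff by metis
qed

lemma GL_inverse:
  assumes "g \<in> GL N"
  obtains g' where "g' \<in> carrier_mat N N" "g * g' = 1\<^sub>m N" "g' * g = 1\<^sub>m N"
proof -
  have g: "g \<in> carrier_mat N N" and "invertible_mat g" using assms by (auto simp: GL_def)
  then obtain B where B: "inverts_mat g B" "inverts_mat B g" by (auto simp: invertible_mat_def)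
  have 1: "g * B = 1\<^sub>m N" using B(1) g by (simp add: inverts_mat_def)
  have 2: "B * g = 1\<^sub>m (dim_row B)" using B(2) by (simp add: inverts_mat_def)
  have "dim_col (g * B) = N" using 1 by simp
  moreover have "dim_col (B * g) = dim_row B" using 2 by simp
  ultimately have "B \<in> carrier_mat N N" using g by auto
  then show ?thesis using that 1 2 by auto
qed

lemma one_in_GL: "1\<^sub>m N \<in> GL N"
  by (auto simp: GL_def invertible_mat_def inverts_mat_def intro!: exI[of _ "1\<^sub>m N"])

lemma mat_vec_cancel:
  fixes g :: "'a::field mat"
  assumes "g' \<in> carrier_mat N N" "g \<in> carrier_mat N N" "g' * g = 1\<^sub>m N" "p \<in> carrier_vec N"
  shows "g' *\<^sub>v (g *\<^sub>v p) = p"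
  unfolding assoc_mult_mat_vec[OF assms(1,2,4), symmetric] assms(3)
  by (rule one_mult_mat_vec[OF assms(4)])

lemma mat_vec_eq_0_iff:
  fixes g :: "'a::field mat"
  assumes "g \<in> GL N" "p \<in> carrier_vec N"
  shows "g *\<^sub>v p = 0\<^sub>v N \<longleftrightarrow> p = 0\<^sub>v N"
proof -
  obtain g' where g': "g' \<in> carrier_mat N N" "g' * g = 1\<^sub>m N"
    using GL_inverse[OF assms(1)] by metis
  have g: "g \<in> carrier_mat N N" using assms(1) by (simp add: GL_def)
  have zero: "A *\<^sub>v 0\<^sub>v N = 0\<^sub>v N" if "A \<in> carrier_mat N N" for A :: "'a mat"
    using that by (intro eq_vecI) auto
  show ?thesis
    using mat_vec_cancel[OF g'(1) g g'(2) assms(2)] zero[OF g] zero[OF g'(1)] by auto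
qed

lemma scalar_prod_eq_sum: "q \<in> carrier_vec N \<Longrightarrow> l \<bullet> q = (\<Sum>i<N. l $ i * q $ i)"
  by (simp add: scalar_prod_def lessThan_atLeast0)

lemma mat_vec_eq_sum:
  assumes "A \<in> carrier_mat N N" "p \<in> carrier_vec N" "i < N"
  shows "(A *\<^sub>v p) $ i = (\<Sum>j<N. A $$ (i, j) * p $ j)"
  using assms by (simp add: scalar_prod_def lessThan_atLeast0)

lemma zariski_closure_form_fun:
  assumes P: "P \<in> zariski_closure N S" and \<phi>: "form_fun {..<N} d \<phi>"
    and S: "\<And>Q q. Q \<in> S \<Longrightarrow> q \<in> Q \<Longrightarrow> \<phi> (\<lambda>i. q $ i) = 0" and p: "p \<in> P"
  shows "\<phi> (\<lambda>i. p $ i) = 0"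
proof -
  obtain F where F: "homogeneous {..<N} d F" "\<And>x. peval F x = \<phi> x"
    using form_funE[OF \<phi>] by blast
  have "vanishes_at F P"
  proof -
    have "\<forall>Q\<in>S. vanishes_at F Q" using S by (simp add: vanishes_at_def F(2))
    then show ?thesis using P F(1) by (simp add: zariski_closure_def)
  qed
  then show ?thesis using p by (auto simp: vanishes_at_def F(2))
qed

lemma vanishes_at_proj_pt_iff:
  assumes F: "homogeneous {..<N} d F" and p: "p \<in> carrier_vec N"
  shows "vanishes_at F (proj_pt p) \<longleftrightarrow> peval F (\<lambda>i. p $ i) = 0"
proof -
  have "peval F (\<lambda>i. (c \<cdot>\<^sub>v p) $ i) = c ^ d * peval F (\<lambda>i. p $ i)" for c
    using p by (subst peval_scale[OF F, symmetric]) (auto intro!: peval_cong[OF F])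
  then have "peval F (\<lambda>i. q $ i) = 0" if "peval F (\<lambda>i. p $ i) = 0" "q \<in> proj_pt p" for q
    using that unfolding mem_proj_pt_iff by auto
  then show ?thesis
    unfolding vanishes_at_def using proj_pt_self[of p] by blast
qed

lemma zariski_closure_subset_proj_space: "zariski_closure N S \<subseteq> proj_space N"
  by (auto simp: zariski_closure_def)

section \<open>The scroll as the union of its lines\<close>

text \<open>
  The ruling is indexed by the projective line: the line over (s0 : s1) is spanned by the two
  vectors of monomials of degree m and n in s0, s1.  With homogeneous parameters the line over
  infinity, s0 = 0, is not special.  The coordinates are functions on all indices, so that
  polynomials can be evaluated at them without reference to a vector.
\<close>

definition scroll_coord :: "nat \<Rightarrow> nat \<Rightarrow> 'a::field \<Rightarrow> 'a \<Rightarrow> 'a \<Rightarrow> 'a \<Rightarrow> nat \<Rightarrow> 'a" where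
  "scroll_coord m n a b s0 s1 i =
    (if i \<le> m then a * (s0 ^ (m - i) * s1 ^ i)
     else b * (s0 ^ (n - (i - (m + 1))) * s1 ^ (i - (m + 1))))"

definition scroll_point :: "nat \<Rightarrow> nat \<Rightarrow> 'a::field \<Rightarrow> 'a \<Rightarrow> 'a \<Rightarrow> 'a \<Rightarrow> 'a vec" where
  "scroll_point m n a b s0 s1 = vec (m + n + 2) (scroll_coord m n a b s0 s1)"

definition line_over :: "nat \<Rightarrow> nat \<Rightarrow> 'a::field \<Rightarrow> 'a \<Rightarrow> 'a vec set set" where
  "line_over m n s0 s1 = {proj_pt (scroll_point m n a b s0 s1) | a b. (a, b) \<noteq> (0, 0)}"

lemma scroll_point_carrier [simp]: "scroll_point m n a b s0 s1 \<in> carrier_vec (m + n + 2)"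
  by (simp add: scroll_point_def)

lemma scroll_point_index:
  "i < m + n + 2 \<Longrightarrow> scroll_point m n a b s0 s1 $ i = scroll_coord m n a b s0 s1 i"
  by (simp add: scroll_point_def)

lemma poly_fun_scroll_coord:
  assumes "poly_fun a" "poly_fun b" "poly_fun s0" "poly_fun s1"
  shows "poly_fun (\<lambda>\<tau>. scroll_coord m n (a \<tau>) (b \<tau>) (s0 \<tau>) (s1 \<tau>) i)"
  by (cases "i \<le> m") (auto simp: scroll_coord_def intro!: poly_fun_intros assms)

lemma scroll_param_eq_scroll_point: "scroll_param m n s t = scroll_point m n 1 t 1 s"
  by (auto simp: scroll_param_def scroll_point_def scroll_coord_def)

lemma scroll_point_smult:
  "c \<cdot>\<^sub>v scroll_point m n a b s0 s1 = scroll_point m n (c * a) (c * b) s0 s1"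
  by (rule eq_vecI) (auto simp: scroll_point_def scroll_coord_def)

lemma scroll_point_scale_params:
  "scroll_point m n a b (c * s0) (c * s1) = scroll_point m n (c ^ m * a) (c ^ n * b) s0 s1"
proof (rule eq_vecI)
  fix i assume "i < dim_vec (scroll_point m n (c ^ m * a) (c ^ n * b) s0 s1)"
  then have i: "i < m + n + 2" by (simp add: scroll_point_def)
  show "scroll_point m n a b (c * s0) (c * s1) $ i
      = scroll_point m n (c ^ m * a) (c ^ n * b) s0 s1 $ i"
  proof (cases "i \<le> m")
    case True
    then have "c ^ m = c ^ (m - i) * c ^ i" by (simp flip: power_add)
    then show ?thesis using i True
      by (simp add: scroll_point_def scroll_coord_def power_mult_distrib)
  next
    case False
    define j where "j = i - (m + 1)"
    have "j \<le> n" and ij: "i = j + (m + 1)" using i False by (auto simp: j_def)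
    then have "c ^ n = c ^ (n - j) * c ^ j" by (simp flip: power_add)
    then show ?thesis using i False
      by (simp add: scroll_point_def scroll_coord_def power_mult_distrib ij)
  qed
qed (simp add: scroll_point_def)

lemma scroll_point_eq_smult_scroll_param:
  assumes "a \<noteq> 0" "s0 \<noteq> 0"
  shows "scroll_point m n a b s0 s1
    = (a * s0 ^ m) \<cdot>\<^sub>v scroll_param m n (s1 / s0) (b * s0 ^ n / (a * s0 ^ m))"
proof -
  have "scroll_point m n a b s0 s1 = scroll_point m n a b (s0 * 1) (s0 * (s1 / s0))"
    using assms by simp
  then show ?thesis
    unfolding scroll_point_scale_params scroll_param_eq_scroll_point scroll_point_smult
    using assms by (simp add: mult.commute)
qed

lemma scroll_point_nonzero:
  assumes "(s0, s1) \<noteq> (0, 0)" "(a, b) \<noteq> (0, 0)"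
  shows "scroll_point m n a b s0 s1 \<noteq> 0\<^sub>v (m + n + 2)"
proof
  assume eq: "scroll_point m n a b s0 s1 = 0\<^sub>v (m + n + 2)"
  have z: "scroll_coord m n a b s0 s1 i = 0" if "i < m + n + 2" for i
    using arg_cong[OF eq, of "\<lambda>v. v $ i"] that by (simp add: scroll_point_def)
  show False
  proof (cases "s0 = 0")
    case False
    then show ?thesis using z[of 0] z[of "m + 1"] assms(2) by (simp add: scroll_coord_def)
  next
    case True
    then show ?thesis using z[of m] z[of "m + n + 1"] assms by (simp add: scroll_coord_def)
  qed
qed

lemma scroll_point_on_line:
  assumes "(a, b) \<noteq> (0, 0)"
  shows "proj_pt (scroll_point m n a b s0 s1) \<in> line_over m n s0 s1"
  using assms unfolding line_over_def by blast

lemma line_over_scale_params: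
  assumes "c \<noteq> 0"
  shows "line_over m n (c * s0) (c * s1) = line_over m n s0 s1"
proof -
  have "line_over m n (c * s0) (c * s1) \<subseteq> line_over m n s0 s1" if "c \<noteq> 0" for c s0 s1 :: 'a
  proof
    fix P assume "P \<in> line_over m n (c * s0) (c * s1)"
    then obtain a b where "(a, b) \<noteq> (0, 0)"
      "P = proj_pt (scroll_point m n (c ^ m * a) (c ^ n * b) s0 s1)"
      unfolding line_over_def scroll_point_scale_params by blast
    then show "P \<in> line_over m n s0 s1"
      using that scroll_point_on_line[of "c ^ m * a" "c ^ n * b"] by auto
  qed
  from this[OF assms] this[of "1 / c" "c * s0" "c * s1"] show ?thesis
    using assms by auto
qed

text \<open>
  A form vanishing on the parametrised part vanishes on all points of all lines, because a
  point with a = 0 or s0 = 0 can be moved into that part along a line in parameter space.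
\<close>

lemma scroll_point_in_scroll:
  fixes a b s0 s1 :: "'a::field_char_0"
  assumes "(s0, s1) \<noteq> (0, 0)" "(a, b) \<noteq> (0, 0)"
  shows "proj_pt (scroll_point m n a b s0 s1) \<in> scroll m n"
  unfolding scroll_def zariski_closure_def
proof (intro CollectI conjI allI impI)
  show "proj_pt (scroll_point m n a b s0 s1) \<in> proj_space (m + n + 2)"
    by (intro proj_pt_in_proj_space scroll_point_nonzero assms scroll_point_carrier)
  fix d and F :: "(nat \<Rightarrow>\<^sub>0 nat) \<Rightarrow>\<^sub>0 'a"
  assume F: "homogeneous {..<m + n + 2} d F"
    and van: "\<forall>Q\<in>{proj_pt (scroll_param m n s t) | s t. True}. vanishes_at F Q"
  have param: "peval F (\<lambda>i. (c \<cdot>\<^sub>v scroll_param m n s t) $ i) = 0" if "c \<noteq> 0" for c s t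
  proof -
    have "vanishes_at F (proj_pt (scroll_param m n s t))" using van by blast
    moreover have "c \<cdot>\<^sub>v scroll_param m n s t \<in> proj_pt (scroll_param m n s t)"
      using that by (auto simp: mem_proj_pt_iff)
    ultimately show ?thesis unfolding vanishes_at_def by (rule bspec)
  qed
  have coord: "peval F (scroll_coord m n a b s0 s1) = peval F (\<lambda>i. scroll_point m n a b s0 s1 $ i)"
    for a b s0 s1 by (rule peval_cong[OF F]) (simp add: scroll_point_def)
  have "infinite (UNIV :: 'a set)" by (rule infinite_UNIV_char_0)
  then obtain \<tau>1 where "\<tau>1 \<notin> {- a, - s0}" using ex_new_if_finite[of "{- a, - s0}"] by auto
  then have \<tau>1: "(a + \<tau>1) * (s0 + \<tau>1) \<noteq> 0" by (auto simp: add_eq_0_iff)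
  have "peval F (scroll_coord m n (a + 0) b (s0 + 0) s1) = 0"
  proof (rule poly_fun_zero_by_density[where \<tau> = 0
        and D = "\<lambda>\<tau>. peval F (scroll_coord m n (a + \<tau>) b (s0 + \<tau>) s1)"
        and E = "\<lambda>\<tau>. (a + \<tau>) * (s0 + \<tau>)"])
    show "poly_fun (\<lambda>\<tau>. peval F (scroll_coord m n (a + \<tau>) b (s0 + \<tau>) s1))"
      by (intro poly_fun_peval poly_fun_scroll_coord poly_fun_intros)
    show "poly_fun (\<lambda>\<tau>. (a + \<tau>) * (s0 + \<tau>))" by (intro poly_fun_intros)
    show "(a + \<tau>1) * (s0 + \<tau>1) \<noteq> 0" by (rule \<tau>1)
  next
    fix \<tau> assume "(a + \<tau>) * (s0 + \<tau>) \<noteq> 0"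
    then have "a + \<tau> \<noteq> 0" "s0 + \<tau> \<noteq> 0" by auto
    then show "peval F (scroll_coord m n (a + \<tau>) b (s0 + \<tau>) s1) = 0"
      unfolding coord scroll_point_eq_smult_scroll_param[OF \<open>a + \<tau> \<noteq> 0\<close> \<open>s0 + \<tau> \<noteq> 0\<close>]
      by (intro param) simp
  qed
  then show "vanishes_at F (proj_pt (scroll_point m n a b s0 s1))"
    unfolding vanishes_at_proj_pt_iff[OF F scroll_point_carrier] by (simp add: coord)
qed

text \<open>
  The scroll is cut out by the 2 x 2 minors of the matrix whose columns are the pairs of
  consecutive coordinates in one of the two blocks; these are the indices of its columns.
\<close>

definition column_indices :: "nat \<Rightarrow> nat \<Rightarrow> nat set" where
  "column_indices m n = {..<m} \<union> {m + 1..<m + 1 + n}"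

lemma column_index_bound: "i \<in> column_indices m n \<Longrightarrow> i + 1 < m + n + 2"
  by (auto simp: column_indices_def)

lemma scroll_coord_column:
  assumes "i \<in> column_indices m n"
  shows "s1 * scroll_coord m n a b s0 s1 i = s0 * scroll_coord m n a b s0 s1 (i + 1)"
proof (cases "i < m")
  case True
  then have "s0 ^ (m - i) = s0 * s0 ^ (m - Suc i)" by (simp flip: power_Suc add: Suc_diff_Suc)
  then show ?thesis using True by (simp add: scroll_coord_def mult_ac)
next
  case False
  define j where "j = i - (m + 1)"
  have "m + 1 \<le> i" "i < m + 1 + n" using False assms by (auto simp: column_indices_def)
  then have j: "i = j + (m + 1)" "j < n" by (auto simp: j_def)
  then have "s0 ^ (n - j) = s0 * s0 ^ (n - Suc j)" by (simp flip: power_Suc add: Suc_diff_Suc)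
  then show ?thesis using j by (simp add: scroll_coord_def mult_ac)
qed

lemma scroll_minors_vanish:
  fixes p :: "'a::field_char_0 vec"
  assumes P: "P \<in> scroll m n" "p \<in> P"
    and i: "i \<in> column_indices m n" and j: "j \<in> column_indices m n"
  shows "p $ i * p $ (j + 1) = p $ (i + 1) * p $ j"
proof -
  have ij: "i < m + n + 2" "i + 1 < m + n + 2" "j < m + n + 2" "j + 1 < m + n + 2"
    using column_index_bound[OF i] column_index_bound[OF j] by auto
  let ?\<phi> = "\<lambda>x::nat \<Rightarrow> 'a. (1 * x i) * (1 * x (j + 1)) - (1 * x (i + 1)) * (1 * x j)"
  have form: "form_fun {..<m + n + 2} (1 + 1) ?\<phi>"
    using ij by (intro form_fun_diff form_fun_mult form_fun_coord) auto
  have van: "?\<phi> (\<lambda>i. q $ i) = 0"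
    if Q: "Q \<in> {proj_pt (scroll_param m n s t) | s t :: 'a. True}" "q \<in> Q" for Q q
  proof -
    obtain c s t where q: "q = c \<cdot>\<^sub>v scroll_point m n 1 t 1 s"
      using Q by (auto simp: mem_proj_pt_iff scroll_param_eq_scroll_point)
    have cols: "q $ (i + 1) = s * q $ i" "q $ (j + 1) = s * q $ j"
      using scroll_coord_column[OF i, of s 1 t 1] scroll_coord_column[OF j, of s 1 t 1] ij
      by (simp_all add: q scroll_point_def mult.left_commute)
    show ?thesis unfolding cols by simp
  qed
  show ?thesis
    using zariski_closure_form_fun[OF P(1)[unfolded scroll_def] form van P(2)] by simp
qed

lemma geometric_of_proportional:
  fixes f :: "nat \<Rightarrow> 'a::field"
  assumes "(s0, s1) \<noteq> (0, 0)" and f: "\<And>i. i < m \<Longrightarrow> s1 * f i = s0 * f (i + 1)"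
  obtains a where "\<And>i. i \<le> m \<Longrightarrow> f i = a * (s0 ^ (m - i) * s1 ^ i)"
proof (cases "s0 = 0")
  case True
  then have s1: "s1 \<noteq> 0" using assms(1) by auto
  have "f i = f m / s1 ^ m * (s0 ^ (m - i) * s1 ^ i)" if "i \<le> m" for i
    using f[of i] True s1 that by (cases "i = m") auto
  then show ?thesis by (rule that)
next
  case False
  have "f i = f 0 / s0 ^ m * (s0 ^ (m - i) * s1 ^ i)" if "i \<le> m" for i
    using that
  proof (induction i)
    case 0
    then show ?case using False by simp
  next
    case (Suc i)
    then have IH: "f i = f 0 / s0 ^ m * (s0 ^ (m - i) * s1 ^ i)" and "i < m" by auto
    then have p: "s0 ^ (m - i) = s0 * s0 ^ (m - Suc i)" by (simp flip: power_Suc add: Suc_diff_Suc)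
    have "s0 * f (Suc i) = s1 * f i" using f[OF \<open>i < m\<close>] by simp
    also have "\<dots> = s0 * (f 0 / s0 ^ m * (s0 ^ (m - Suc i) * s1 ^ Suc i))"
      by (simp add: IH p)
    finally show ?case using False by (simp only: mult_left_cancel not_False_eq_True)
  qed
  then show ?thesis by (rule that)
qed

lemma scroll_point_of_columns:
  assumes s: "(s0, s1) \<noteq> (0, 0)" and p: "p \<in> carrier_vec (m + n + 2)"
    and cols: "\<And>i. i \<in> column_indices m n \<Longrightarrow> s1 * p $ i = s0 * p $ (i + 1)"
  obtains a b where "p = scroll_point m n a b s0 s1"
proof -
  obtain a where a: "\<And>i. i \<le> m \<Longrightarrow> p $ i = a * (s0 ^ (m - i) * s1 ^ i)"
    using geometric_of_proportional[of s0 s1 m "\<lambda>i. p $ i", OF s] cols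
    by (auto simp: column_indices_def)
  obtain b where b: "\<And>j. j \<le> n \<Longrightarrow> p $ (j + (m + 1)) = b * (s0 ^ (n - j) * s1 ^ j)"
    using geometric_of_proportional[of s0 s1 n "\<lambda>i. p $ (i + (m + 1))", OF s] cols
    by (auto simp: column_indices_def)
  have "p = scroll_point m n a b s0 s1"
  proof (rule eq_vecI)
    fix i assume "i < dim_vec (scroll_point m n a b s0 s1)"
    then have "i < m + n + 2" by (simp add: scroll_point_def)
    then show "p $ i = scroll_point m n a b s0 s1 $ i"
      using a[of i] b[of "i - (m + 1)"] by (cases "i \<le> m") (auto simp: scroll_point_def scroll_coord_def)
  qed (use p in \<open>simp add: scroll_point_def\<close>)
  then show ?thesis by (rule that)
qed

text \<open>
  The vanishing of the minors means that all columns are proportional to one vector (s0, s1).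
  If a column has a nonzero upper entry, that column is such a vector; otherwise (0, 1) is.
\<close>

lemma scroll_member_on_line:
  fixes p :: "'a::field_char_0 vec"
  assumes P: "P \<in> scroll m n" "p \<in> P"
  obtains a b s0 s1 where "p = scroll_point m n a b s0 s1" "(s0, s1) \<noteq> (0, 0)" "(a, b) \<noteq> (0, 0)"
proof -
  have "P \<in> proj_space (m + n + 2)"
    using P(1) zariski_closure_subset_proj_space by (auto simp: scroll_def)
  from proj_space_memD[OF this P(2)]
  have p: "p \<in> carrier_vec (m + n + 2)" "p \<noteq> 0\<^sub>v (m + n + 2)" by auto
  have "\<exists>s0 s1. (s0, s1) \<noteq> (0, 0) \<and> (\<forall>i\<in>column_indices m n. s1 * p $ i = s0 * p $ (i + 1))"
  proof (cases "\<exists>j\<in>column_indices m n. p $ j \<noteq> 0")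
    case True
    then obtain j where j: "j \<in> column_indices m n" "p $ j \<noteq> 0" by blast
    then show ?thesis
      using scroll_minors_vanish[OF P _ j(1)]
      by (intro exI[of _ "p $ j"] exI[of _ "p $ (j + 1)"]) (auto simp: mult.commute)
  next
    case False
    then show ?thesis by (intro exI[of _ 0] exI[of _ 1]) auto
  qed
  then obtain s0 s1 where s: "(s0, s1) \<noteq> (0, 0)"
    and cols: "\<And>i. i \<in> column_indices m n \<Longrightarrow> s1 * p $ i = s0 * p $ (i + 1)" by blast
  obtain a b where pab: "p = scroll_point m n a b s0 s1"
    using scroll_point_of_columns[OF s p(1) cols] by blast
  moreover have "(a, b) \<noteq> (0, 0)"
  proof
    assume "(a, b) = (0, 0)"
    then have "p = 0\<^sub>v (m + n + 2)"
      by (auto simp: pab scroll_point_def scroll_coord_def)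
    then show False using p(2) by simp
  qed
  ultimately show ?thesis using that s by blast
qed

lemma line_over_subset_scroll:
  fixes s0 s1 :: "'a::field_char_0"
  assumes "(s0, s1) \<noteq> (0, 0)"
  shows "line_over m n s0 s1 \<subseteq> scroll m n"
  unfolding line_over_def using scroll_point_in_scroll[OF assms] by blast

text \<open>
  The line over (s0 : s1) is closed, being cut out by linear forms, and it is the closure of
  any of its subsets that contain all points with a different from 0.  So points of the
  exceptional section, where a = 0, may be disregarded when closures are computed.
\<close>

lemma zariski_closure_eq_line:
  fixes g :: "'a::field_char_0 mat"
  assumes N: "N = m + n + 2" and g: "g \<in> GL N" and s: "(s0, s1) \<noteq> (0, 0)"
    and lower: "\<And>a b. a \<noteq> 0 \<Longrightarrow> proj_pt (g *\<^sub>v scroll_point m n a b s0 s1) \<in> T"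
    and upper: "T \<subseteq> proj_map g ` line_over m n s0 s1"
  shows "zariski_closure (N) T = proj_map g ` line_over m n s0 s1"
proof
  have sc: "scroll_point m n a b s0 s1 \<in> carrier_vec N" for a b unfolding N by (rule scroll_point_carrier)
  have sx: "scroll_point m n a b s0 s1 $ j = scroll_coord m n a b s0 s1 j" if "j < N" for a b j
    using that scroll_point_index[of j m n a b s0 s1] by (simp add: N)
  obtain g' where g': "g' \<in> carrier_mat N N" "g * g' = 1\<^sub>m N" "g' * g = 1\<^sub>m N"
    using GL_inverse[OF g] by metis
  have gc: "g \<in> carrier_mat N N" using g by (simp add: GL_def)
  show "zariski_closure N T \<subseteq> proj_map g ` line_over m n s0 s1"
  proof
    fix P assume P: "P \<in> zariski_closure N T"
    then have Pp: "P \<in> proj_space N" using zariski_closure_subset_proj_space by blast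
    then obtain p where p: "p \<in> P" by (auto simp: proj_space_def intro: proj_pt_self)
    note pc = proj_space_memD[OF Pp p]
    have cols: "s1 * (g' *\<^sub>v p) $ i = s0 * (g' *\<^sub>v p) $ (i + 1)" if i: "i \<in> column_indices m n" for i
    proof -
      let ?\<phi> = "\<lambda>x. \<Sum>j<N. (s1 * g' $$ (i, j) - s0 * g' $$ (i + 1, j)) * x j"
      have "form_fun {..<N} 1 ?\<phi>" by (intro form_fun_sum form_fun_coord) simp
      moreover have \<phi>: "?\<phi> (\<lambda>i. q $ i) = s1 * (g' *\<^sub>v q) $ i - s0 * (g' *\<^sub>v q) $ (i + 1)"
        if "q \<in> carrier_vec N" for q
        using column_index_bound[OF i] that unfolding N[symmetric]
        by (simp add: mat_vec_eq_sum[OF g'(1)] sum_distrib_left sum_subtractf algebra_simps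
            del: index_mult_mat_vec)
      moreover have "?\<phi> (\<lambda>i. q $ i) = 0" if Q: "Q \<in> T" "q \<in> Q" for Q q
      proof -
        obtain a b where "Q = proj_map g (proj_pt (scroll_point m n a b s0 s1))"
          using Q(1) upper by (auto simp: line_over_def)
        then obtain c where q: "q = c \<cdot>\<^sub>v (g *\<^sub>v scroll_point m n a b s0 s1)"
          using Q(2) unfolding proj_map_proj_pt[OF gc sc] by (auto simp: mem_proj_pt_iff)
        have "g' *\<^sub>v q = c \<cdot>\<^sub>v scroll_point m n a b s0 s1"
          unfolding q mult_mat_vec[OF g'(1) mult_mat_vec_carrier[OF gc sc]]
            mat_vec_cancel[OF g'(1) gc g'(3) sc] ..
        moreover have "q \<in> carrier_vec N" using mult_mat_vec_carrier[OF gc sc] by (simp add: q)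
        ultimately have "?\<phi> (\<lambda>i. q $ i) = s1 * (c * scroll_coord m n a b s0 s1 i)
             - s0 * (c * scroll_coord m n a b s0 s1 (i + 1))"
          using column_index_bound[OF i] \<phi>[of q] by (simp add: scroll_point_def)
        then show ?thesis
          using scroll_coord_column[OF i, of s1 a b s0] by (simp add: mult.left_commute)
      qed
      ultimately have "?\<phi> (\<lambda>i. p $ i) = 0"
        using zariski_closure_form_fun[OF P, of 1 ?\<phi> p] p by blast
      then show ?thesis using \<phi>[OF pc(1)] by simp
    qed
    obtain a b where ab: "g' *\<^sub>v p = scroll_point m n a b s0 s1"
      using scroll_point_of_columns[OF s mult_mat_vec_carrier[OF g'(1) pc(1), unfolded N] cols] by blast
    have pab: "p = g *\<^sub>v scroll_point m n a b s0 s1"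
      using mat_vec_cancel[OF gc g'(1,2) pc(1)] ab by simp
    have "(a, b) \<noteq> (0, 0)"
    proof
      assume "(a, b) = (0, 0)"
      then have "scroll_point m n a b s0 s1 = 0\<^sub>v N"
        by (auto simp: scroll_point_def scroll_coord_def N)
      then show False using pc(2) pab mat_vec_eq_0_iff[OF g, of "0\<^sub>v N"] by simp
    qed
    then have "proj_pt (scroll_point m n a b s0 s1) \<in> line_over m n s0 s1"
      by (rule scroll_point_on_line)
    moreover have "P = proj_map g (proj_pt (scroll_point m n a b s0 s1))"
      unfolding proj_map_proj_pt[OF gc sc] using pc(3) pab by simp
    ultimately show "P \<in> proj_map g ` line_over m n s0 s1" by simp
  qed
  show "proj_map g ` line_over m n s0 s1 \<subseteq> zariski_closure N T"
  proof
    fix P assume "P \<in> proj_map g ` line_over m n s0 s1"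
    then obtain a b where ab: "(a, b) \<noteq> (0, 0)" and "P = proj_map g (proj_pt (scroll_point m n a b s0 s1))"
      unfolding line_over_def by blast
    then have P: "P = proj_pt (g *\<^sub>v scroll_point m n a b s0 s1)"
      by (simp only: proj_map_proj_pt[OF gc sc])
    show "P \<in> zariski_closure N T"
      unfolding zariski_closure_def
    proof (intro CollectI conjI allI impI)
      show "P \<in> proj_space N" unfolding P
        using mat_vec_eq_0_iff[OF g sc] scroll_point_nonzero[OF s ab, of m n]
        by (intro proj_pt_in_proj_space mult_mat_vec_carrier[OF gc] sc) (simp add: N)
      fix d F assume F: "homogeneous {..<N} d F" and van: "\<forall>Q\<in>T. vanishes_at F Q"
      let ?x = "\<lambda>\<tau> i. \<Sum>j<N. g $$ (i, j) * scroll_coord m n (a + \<tau>) b s0 s1 j"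
      have x: "peval F (\<lambda>i. (g *\<^sub>v scroll_point m n (a + \<tau>) b s0 s1) $ i) = peval F (?x \<tau>)" for \<tau>
        by (rule peval_cong[OF F])
          (simp add: mat_vec_eq_sum[OF gc sc] sx del: index_mult_mat_vec)
      have "peval F (?x 0) = 0"
      proof (rule poly_fun_zero_by_density[where \<tau> = 0 and D = "\<lambda>\<tau>. peval F (?x \<tau>)" and E = "\<lambda>\<tau>. a + \<tau>"])
        show "poly_fun (\<lambda>\<tau>. peval F (?x \<tau>))"
          by (intro poly_fun_peval poly_fun_intros poly_fun_scroll_coord)
        show "poly_fun (\<lambda>\<tau>. a + \<tau>)" by (intro poly_fun_intros)
        show "a + (1 - a) \<noteq> 0" by simp
        fix \<tau> assume "a + \<tau> \<noteq> 0"
        from lower[OF this] van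
        have "vanishes_at F (proj_pt (g *\<^sub>v scroll_point m n (a + \<tau>) b s0 s1))" by blast
        then show "peval F (?x \<tau>) = 0"
          unfolding vanishes_at_proj_pt_iff[OF F mult_mat_vec_carrier[OF gc sc]] x .
      qed
      then show "vanishes_at F P"
        unfolding P vanishes_at_proj_pt_iff[OF F mult_mat_vec_carrier[OF gc sc]]
        using x[of 0] by simp
    qed
  qed
qed

lemma scroll_line_eq: "scroll_line m n s = line_over m n 1 (s :: 'a::field_char_0)"
proof -
  let ?T = "{proj_pt (scroll_param m n s t) | t. True}"
  have one: "proj_map (1\<^sub>m (m + n + 2)) P = P" if P: "P \<in> line_over m n 1 s" for P
  proof -
    obtain a b where "P = proj_pt (scroll_point m n a b 1 s)"
      using P unfolding line_over_def by blast
    then show ?thesis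
      by (simp only: proj_map_proj_pt[OF one_carrier_mat scroll_point_carrier]
          one_mult_mat_vec[OF scroll_point_carrier])
  qed
  have id: "proj_map (1\<^sub>m (m + n + 2)) ` line_over m n 1 s = line_over m n 1 s"
    using one by simp
  have "zariski_closure (m + n + 2) ?T = proj_map (1\<^sub>m (m + n + 2)) ` line_over m n 1 s"
  proof (rule zariski_closure_eq_line[OF refl one_in_GL])
    show "(1 :: 'a, s) \<noteq> (0, 0)" by simp
    fix a b :: 'a assume a: "a \<noteq> 0"
    have "scroll_point m n a b 1 s = a \<cdot>\<^sub>v scroll_param m n s (b / a)"
      using scroll_point_eq_smult_scroll_param[of a 1 m n b s] a by simp
    then have "proj_pt (scroll_point m n a b 1 s) = proj_pt (scroll_param m n s (b / a))"
      by (simp only: proj_pt_smult[OF a])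
    then show "proj_pt (1\<^sub>m (m + n + 2) *\<^sub>v scroll_point m n a b 1 s) \<in> ?T"
      unfolding one_mult_mat_vec[OF scroll_point_carrier] by blast
  next
    have "proj_pt (scroll_point m n 1 t 1 s) \<in> line_over m n 1 s" for t
      by (rule scroll_point_on_line) simp
    then show "?T \<subseteq> proj_map (1\<^sub>m (m + n + 2)) ` line_over m n 1 s"
      unfolding id scroll_param_eq_scroll_point by blast
  qed
  moreover have "line_over m n 1 s \<subseteq> scroll m n"
    by (rule line_over_subset_scroll) simp
  ultimately show ?thesis unfolding scroll_line_def closure_in_def id by blast
qed

lemma scroll_line_at_infinity_eq:
  "scroll_line_at_infinity m n = (line_over m n 0 1 :: 'a::field vec set set)"
proof
  show "scroll_line_at_infinity m n \<subseteq> (line_over m n 0 1 :: 'a vec set set)"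
  proof
    fix P :: "'a vec set" assume "P \<in> scroll_line_at_infinity m n"
    then obtain p where p: "p \<in> carrier_vec (m + n + 2)" "p \<noteq> 0\<^sub>v (m + n + 2)" "P = proj_pt p"
      "\<And>i. i < m + n + 2 \<Longrightarrow> i \<noteq> m \<Longrightarrow> i \<noteq> m + n + 1 \<Longrightarrow> p $ i = 0"
      by (auto simp: scroll_line_at_infinity_def)
    have eq: "p = scroll_point m n (p $ m) (p $ (m + n + 1)) 0 1"
    proof (rule eq_vecI)
      fix i assume "i < dim_vec (scroll_point m n (p $ m) (p $ (m + n + 1)) 0 1)"
      then show "p $ i = scroll_point m n (p $ m) (p $ (m + n + 1)) 0 1 $ i"
        using p(4)[of i] by (cases "i = m + n + 1")
          (auto simp: scroll_point_def scroll_coord_def power_0_left)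
    qed (use p(1) in \<open>simp add: scroll_point_def\<close>)
    have "(p $ m, p $ (m + n + 1)) \<noteq> (0, 0)"
    proof
      assume "(p $ m, p $ (m + n + 1)) = (0, 0)"
      then have "p = 0\<^sub>v (m + n + 2)" by (subst eq) (auto simp: scroll_point_def scroll_coord_def)
      then show False using p(2) by simp
    qed
    then show "P \<in> line_over m n 0 1" using eq p(3) by (metis scroll_point_on_line)
  qed
  show "(line_over m n 0 1 :: 'a vec set set) \<subseteq> scroll_line_at_infinity m n"
  proof
    fix P :: "'a vec set" assume "P \<in> line_over m n 0 1"
    then obtain a b :: 'a where ab: "(a, b) \<noteq> (0, 0)" "P = proj_pt (scroll_point m n a b 0 1)"
      by (auto simp: line_over_def)
    then show "P \<in> scroll_line_at_infinity m n"
      unfolding scroll_line_at_infinity_def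
      using scroll_point_nonzero[of "0 :: 'a" 1 a b m n] scroll_point_carrier[of m n a b 0 1]
      by (intro CollectI exI[of _ "scroll_point m n a b 0 1"])
        (auto simp: scroll_point_index scroll_coord_def power_0_left)
  qed
qed

lemma scroll_ruling_eq:
  "scroll_ruling m n = {line_over m n s0 s1 | s0 s1 :: 'a::field_char_0. (s0, s1) \<noteq> (0, 0)}"
    (is "_ = ?lines")
proof (intro equalityI subsetI)
  fix L :: "'a vec set set" assume "L \<in> scroll_ruling m n"
  then consider "L = line_over m n 0 1" | s where "L = line_over m n 1 s"
    unfolding scroll_ruling_def scroll_line_at_infinity_eq image_def scroll_line_eq by blast
  then show "L \<in> ?lines"
  proof cases
    case 1
    then show ?thesis by (intro CollectI exI[of _ 0] exI[of _ 1]) simp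
  next
    case 2
    then show ?thesis by (intro CollectI exI[of _ 1] exI[of _ s]) simp
  qed
next
  fix L :: "'a vec set set" assume "L \<in> ?lines"
  then obtain s0 s1 where s: "(s0, s1) \<noteq> (0, 0)" and L: "L = line_over m n s0 s1" by blast
  show "L \<in> scroll_ruling m n"
  proof (cases "s0 = 0")
    case True
    then have "L = scroll_line_at_infinity m n"
      using s line_over_scale_params[of s1 m n 0 1] by (simp add: L scroll_line_at_infinity_eq)
    then show ?thesis by (simp add: scroll_ruling_def)
  next
    case False
    then have "L = scroll_line m n (s1 / s0)"
      using line_over_scale_params[of s0 m n 1 "s1 / s0"] by (simp add: L scroll_line_eq)
    then show ?thesis by (simp add: scroll_ruling_def)
  qed
qed

section \<open>Infinitesimal projective transformations of the scroll\<close>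

definition tangent_to_scroll :: "nat \<Rightarrow> nat \<Rightarrow> 'a::field mat \<Rightarrow> bool" where
  "tangent_to_scroll m n B \<longleftrightarrow>
    (\<forall>s t. \<forall>i\<in>column_indices m n. \<forall>j\<in>column_indices m n.
      let p = scroll_param m n s t; z = B *\<^sub>v p
      in z $ i * p $ (j + 1) + p $ i * z $ (j + 1) = z $ (i + 1) * p $ j + p $ (i + 1) * z $ j)"

text \<open>
  For a minor Q and a point p of the scroll, the function M \<mapsto> Q (g' M g p) is a
  quadratic form in the matrix entries and vanishes on the stabilizer of X = g S.  So its
  differential at the identity vanishes on the Lie algebra: this is the linearised minor.
\<close>

lemma tangent_of_lie_algebra:
  fixes g g' A :: "'a::field_char_0 mat"
  assumes N: "N = m + n + 2" and gc: "g \<in> carrier_mat N N" and g': "g' \<in> carrier_mat N N"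
    and inv: "g' * g = 1\<^sub>m N"
    and X: "X = proj_map g ` scroll m n" and A: "A \<in> lie_algebra_of N X"
  shows "tangent_to_scroll m n (g' * (A * g))"
  unfolding tangent_to_scroll_def Let_def
proof (intro allI ballI)
  fix s t :: 'a and i j
  assume i: "i \<in> column_indices m n" and j: "j \<in> column_indices m n"
  define p where "p = scroll_param m n s t"
  define B where "B = g' * (A * g)"
  have Ac: "A \<in> carrier_mat N N" using A by (simp add: lie_algebra_of_def sl_def)
  have pc: "p \<in> carrier_vec N" unfolding p_def scroll_param_eq_scroll_point N by (rule scroll_point_carrier)
  define q where "q = g *\<^sub>v p"
  have qc: "q \<in> carrier_vec N" unfolding q_def by (rule mult_mat_vec_carrier[OF gc pc])
  have ij: "i < N" "i + 1 < N" "j < N" "j + 1 < N"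
    using column_index_bound[OF i] column_index_bound[OF j] by (auto simp: N)
  let ?V = "{..<N} \<times> {..<N}"
  define c where "c k x = (\<Sum>a<N. \<Sum>b<N. g' $$ (k, a) * q $ b * x (a, b))"
    for k and x :: "nat \<times> nat \<Rightarrow> 'a"
  have c_form: "form_fun ?V 1 (c k)" for k
    unfolding c_def by (intro form_fun_sum form_fun_coord) simp
  have c_mat: "c k (\<lambda>ab. M $$ ab) = (g' *\<^sub>v (M *\<^sub>v q)) $ k" if "M \<in> carrier_mat N N" "k < N" for k M
    using that
    by (simp add: c_def mat_vec_eq_sum[OF g' mult_mat_vec_carrier[OF _ qc]] mat_vec_eq_sum[OF _ qc]
        sum_distrib_left mult_ac del: index_mult_mat_vec)
  have c_add: "c k (\<lambda>ab. x ab + \<tau> * y ab) = c k x + \<tau> * c k y" for k x y \<tau>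
    by (simp add: c_def sum.distrib sum_distrib_left algebra_simps)
  define \<phi> where "\<phi> x = c i x * c (j + 1) x - c (i + 1) x * c j x" for x
  have "form_fun ?V (1 + 1) \<phi>"
    unfolding \<phi>_def by (intro form_fun_diff form_fun_mult c_form)
  then obtain F where F: "homogeneous ?V (1 + 1) F" "\<And>x. peval F x = \<phi> x"
    using form_funE by blast
  have p_scroll: "proj_pt p \<in> scroll m n"
    unfolding p_def scroll_param_eq_scroll_point by (rule scroll_point_in_scroll) auto
  have "peval F (\<lambda>ab. M $$ ab) = 0" if M: "M \<in> PGL_stabilizer N X" for M
  proof -
    have Mc: "M \<in> carrier_mat N N" and MX: "proj_map M ` X = X"
      using M by (auto simp: PGL_stabilizer_def GL_def)
    have "proj_pt q \<in> X"
      unfolding X q_def proj_map_proj_pt[OF gc pc, symmetric] using p_scroll by (rule imageI)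
    then have "proj_map M (proj_pt q) \<in> X" using MX by blast
    then have "proj_pt (M *\<^sub>v q) \<in> proj_map g ` scroll m n"
      unfolding proj_map_proj_pt[OF Mc qc] X .
    then obtain P where P: "P \<in> scroll m n" "proj_pt (M *\<^sub>v q) = proj_map g P" by blast
    then have "M *\<^sub>v q \<in> proj_map g P" using proj_pt_self[of "M *\<^sub>v q"] by simp
    then obtain r where r: "r \<in> P" "M *\<^sub>v q = g *\<^sub>v r" by (auto simp: proj_map_def)
    have "P \<in> proj_space N"
      using P(1) zariski_closure_subset_proj_space unfolding scroll_def N by blast
    then have rc: "r \<in> carrier_vec N" using r(1) by (rule proj_space_memD)
    have "g' *\<^sub>v (M *\<^sub>v q) = r" unfolding r(2) by (rule mat_vec_cancel[OF g' gc inv rc])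
    then show ?thesis
      using scroll_minors_vanish[OF P(1) r(1) i j] ij by (simp add: F(2) \<phi>_def c_mat[OF Mc])
  qed
  then have "pdifferential F (\<lambda>ab. 1\<^sub>m N $$ ab) (\<lambda>ab. A $$ ab) = 0"
    using A F(1) unfolding lie_algebra_of_def by blast
  moreover have "peval F (\<lambda>ab. 1\<^sub>m N $$ ab + \<tau> * A $$ ab)
      = poly ([:p $ i, (B *\<^sub>v p) $ i:] * [:p $ (j + 1), (B *\<^sub>v p) $ (j + 1):]
          - [:p $ (i + 1), (B *\<^sub>v p) $ (i + 1):] * [:p $ j, (B *\<^sub>v p) $ j:]) \<tau>" for \<tau>
  proof -
    have 1: "c k (\<lambda>ab. 1\<^sub>m N $$ ab) = p $ k" if "k < N" for k
      unfolding c_mat[OF one_carrier_mat that] one_mult_mat_vec[OF qc]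
      unfolding q_def mat_vec_cancel[OF g' gc inv pc] ..
    have "g' *\<^sub>v (A *\<^sub>v q) = B *\<^sub>v p"
      unfolding q_def B_def assoc_mult_mat_vec[OF g' mult_carrier_mat[OF Ac gc] pc]
        assoc_mult_mat_vec[OF Ac gc pc] ..
    then have 2: "c k (\<lambda>ab. A $$ ab) = (B *\<^sub>v p) $ k" if "k < N" for k
      unfolding c_mat[OF Ac that] by simp
    show ?thesis
      unfolding F(2) \<phi>_def c_add using ij by (simp only: 1 2) (simp add: algebra_simps)
  qed
  note pdifferential_eq_derivative_of_restriction[OF this]
  ultimately have "poly (pderiv ([:p $ i, (B *\<^sub>v p) $ i:] * [:p $ (j + 1), (B *\<^sub>v p) $ (j + 1):]
          - [:p $ (i + 1), (B *\<^sub>v p) $ (i + 1):] * [:p $ j, (B *\<^sub>v p) $ j:])) 0 = 0"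
    by simp
  then have "(B *\<^sub>v p) $ i * p $ (j + 1) + p $ i * (B *\<^sub>v p) $ (j + 1)
      = (B *\<^sub>v p) $ (i + 1) * p $ j + p $ (i + 1) * (B *\<^sub>v p) $ j"
    by (simp add: pderiv_mult pderiv_diff pderiv_pCons algebra_simps del: index_mult_mat_vec)
  then show "((g' * (A * g)) *\<^sub>v scroll_param m n s t) $ i * scroll_param m n s t $ (j + 1) +
      scroll_param m n s t $ i * ((g' * (A * g)) *\<^sub>v scroll_param m n s t) $ (j + 1) =
      ((g' * (A * g)) *\<^sub>v scroll_param m n s t) $ (i + 1) * scroll_param m n s t $ j +
      scroll_param m n s t $ (i + 1) * ((g' * (A * g)) *\<^sub>v scroll_param m n s t) $ j"
    unfolding p_def B_def .
qed

text \<open>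
  A linear form restricted to the parametrised part of the scroll is f(s) + t g(s) with
  polynomials f, g of degrees at most m and n, read off from the two blocks of coefficients.
\<close>

definition first_block :: "nat \<Rightarrow> 'a::comm_ring_1 vec \<Rightarrow> 'a poly" where
  "first_block m l = (\<Sum>i\<le>m. monom (l $ i) i)"

definition second_block :: "nat \<Rightarrow> nat \<Rightarrow> 'a::comm_ring_1 vec \<Rightarrow> 'a poly" where
  "second_block m n l = (\<Sum>j\<le>n. monom (l $ (m + 1 + j)) j)"

definition linear_form :: "nat \<Rightarrow> nat \<Rightarrow> 'a::comm_ring_1 poly \<Rightarrow> 'a poly \<Rightarrow> 'a vec" where
  "linear_form m n f g = vec (m + n + 2) (\<lambda>i. if i \<le> m then coeff f i else coeff g (i - (m + 1)))"

lemma coeff_first_block: "coeff (first_block m l) i = (if i \<le> m then l $ i else 0)"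
  by (simp add: first_block_def coeff_sum coeff_monom)

lemma coeff_second_block: "coeff (second_block m n l) j = (if j \<le> n then l $ (m + 1 + j) else 0)"
  by (simp add: second_block_def coeff_sum coeff_monom)

lemma linear_form_carrier: "linear_form m n f g \<in> carrier_vec (m + n + 2)"
  by (simp add: linear_form_def)

lemma first_block_linear_form: "degree f \<le> m \<Longrightarrow> first_block m (linear_form m n f g) = f"
  by (rule poly_eqI) (auto simp: coeff_first_block linear_form_def coeff_eq_0)

lemma second_block_linear_form: "degree g \<le> n \<Longrightarrow> second_block m n (linear_form m n f g) = g"
  by (rule poly_eqI) (auto simp: coeff_second_block linear_form_def coeff_eq_0)

lemma linear_form_of_blocks:
  assumes "l \<in> carrier_vec (m + n + 2)"
  shows "linear_form m n (first_block m l) (second_block m n l) = l"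
proof (rule eq_vecI)
  fix i assume "i < dim_vec l"
  then have "i < m + n + 2" using assms by simp
  then show "linear_form m n (first_block m l) (second_block m n l) $ i = l $ i"
    by (auto simp: linear_form_def coeff_first_block coeff_second_block)
qed (use assms in \<open>simp add: linear_form_def\<close>)

lemma degree_first_block: "degree (first_block m l) \<le> m"
  by (rule degree_le) (simp add: coeff_first_block)

lemma degree_second_block: "degree (second_block m n l) \<le> n"
  by (rule degree_le) (simp add: coeff_second_block)

lemma sum_blocks:
  fixes m n :: nat
  shows "(\<Sum>r<m + n + 2. F r) = (\<Sum>r\<le>m. F r) + (\<Sum>j\<le>n. F (m + 1 + j))"
proof -
  have "{..<m + n + 2} = {..m} \<union> {m + 1..m + 1 + n}" by auto
  then have "(\<Sum>r<m + n + 2. F r) = (\<Sum>r\<le>m. F r) + (\<Sum>r=m + 1..m + 1 + n. F r)"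
    by (simp add: sum.union_disjoint)
  also have "(\<Sum>r=m + 1..m + 1 + n. F r) = (\<Sum>j\<le>n. F (m + 1 + j))"
    using sum.shift_bounds_cl_nat_ivl[of F 0 "m + 1" n] by (simp add: add.commute atMost_atLeast0)
  finally show ?thesis .
qed

lemma scalar_prod_scroll_param:
  assumes "l \<in> carrier_vec (m + n + 2)"
  shows "l \<bullet> scroll_param m n s t = poly (first_block m l) s + t * poly (second_block m n l) s"
proof -
  have "l \<bullet> scroll_param m n s t = (\<Sum>r<m + n + 2. l $ r * scroll_param m n s t $ r)"
    by (rule scalar_prod_eq_sum) (simp add: scroll_param_def)
  also have "\<dots> = (\<Sum>r\<le>m. l $ r * s ^ r) + (\<Sum>j\<le>n. l $ (m + 1 + j) * (t * s ^ j))"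
    unfolding sum_blocks by (intro arg_cong2[of _ _ _ _ "(+)"] sum.cong) (auto simp: scroll_param_def)
  finally show ?thesis
    by (simp add: first_block_def second_block_def poly_sum poly_monom sum_distrib_left mult_ac)
qed

lemma poly_eq_of_quadratic_in_parameter:
  fixes a b c a' b' c' :: "'a::field_char_0 poly"
  assumes "\<And>s t. poly a s + t * poly b s + t ^ 2 * poly c s = poly a' s + t * poly b' s + t ^ 2 * poly c' s"
  shows "a = a'" "b = b'" "c = c'"
proof -
  have *: "poly a s = poly a' s \<and> poly b s = poly b' s \<and> poly c s = poly c' s" for s
  proof -
    have "poly [:poly a s, poly b s, poly c s:] = poly [:poly a' s, poly b' s, poly c' s:]"
      using assms[of s] by (auto simp: fun_eq_iff algebra_simps power2_eq_square)
    then show ?thesis by (simp add: poly_eq_poly_eq_iff)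
  qed
  show "a = a'" "b = b'" "c = c'"
    using * by (auto simp: fun_eq_iff simp flip: poly_eq_poly_eq_iff)
qed

text \<open>
  The recursion says that A k is the derivative of X^k along the vector field P - X Q plus the
  multiple A 0 of X^k.  The equation is multiplied by X to avoid the exponent k - 1.
\<close>

lemma derivation_recursion:
  fixes A :: "nat \<Rightarrow> 'a::comm_ring_1 poly"
  assumes "\<And>k. k < d \<Longrightarrow> A k * X + X ^ k * P = A (Suc k) + X ^ Suc k * Q" and "k \<le> d"
  shows "A k * X = X ^ k * (X * A 0 + of_nat k * (P - X * Q))"
  using assms(2)
proof (induction k)
  case 0
  then show ?case by (simp add: mult.commute)
next
  case (Suc k)
  then have "A (Suc k) = A k * X + X ^ k * P - X ^ Suc k * Q"
    using assms(1)[of k] by (simp add: algebra_simps)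
  then have "A (Suc k) * X = (A k * X) * X + X ^ k * P * X - X ^ Suc k * Q * X"
    by (simp only: left_diff_distrib distrib_right)
  moreover have "A k * X = X ^ k * (X * A 0 + of_nat k * (P - X * Q))"
    using Suc by simp
  ultimately have "A (Suc k) * X = X ^ k * (X * A 0 + of_nat k * (P - X * Q)) * X
      + X ^ k * P * X - X ^ Suc k * Q * X" by simp
  then show ?case by (simp add: algebra_simps)
qed

text \<open>
  Cancelling X, the factor X^(k-1) of A takes k - 1 of its D degrees and leaves D + 1 - k to Q.
\<close>

lemma coeff_bound_of_factor:
  fixes A Q :: "'a::comm_ring_1 poly"
  assumes "A * [:0, 1:] = [:0, 1:] ^ k * Q" and "degree A \<le> D" and "e + k > D + 1"
  shows "coeff Q e = 0"
proof -
  have X: "[:0, 1:] = (monom 1 1 :: 'a poly)" by (simp add: monom_altdef)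
  obtain i where i: "e + k = Suc i" "i > D" using assms(3) by (cases "e + k") auto
  then have e: "Suc i - k = e" by simp
  have "coeff (monom 1 k * Q) (e + k) = coeff (monom 1 1 * A) (Suc i)"
    using arg_cong[OF assms(1), of "\<lambda>p. coeff p (e + k)"] i
    by (simp add: X monom_power mult.commute)
  then show ?thesis using i e assms(2) by (simp add: coeff_monom_mult coeff_eq_0)
qed

text \<open>
  The operator T on linear forms covers the vector field K on the projective line: it is
  compatible with the subspace of forms without second block and acts on this subspace and on
  the quotient as a first order differential operator.  The leading coefficients of the
  multipliers M and M' are those of the standard actions on forms of degree m and n.
\<close>

definition covers_vector_field ::
  "nat \<Rightarrow> nat \<Rightarrow> 'a::field mat \<Rightarrow> 'a poly \<Rightarrow> 'a poly \<Rightarrow> 'a poly \<Rightarrow> bool" where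
  "covers_vector_field m n T K M M' \<longleftrightarrow>
    T \<in> carrier_mat (m + n + 2) (m + n + 2) \<and> degree K \<le> 2 \<and>
    degree M \<le> 1 \<and> coeff M 1 = of_nat m * coeff K 2 \<and>
    degree M' \<le> 1 \<and> coeff M' 1 = of_nat n * coeff K 2 \<and>
    (\<forall>l\<in>carrier_vec (m + n + 2). second_block m n l = 0 \<longrightarrow>
      first_block m (T *\<^sub>v l) = M * first_block m l - K * pderiv (first_block m l)) \<and>
    (\<forall>l\<in>carrier_vec (m + n + 2).
      second_block m n (T *\<^sub>v l) = M' * second_block m n l - K * pderiv (second_block m n l))"

lemma sum_first_order_operator:
  fixes P :: "'i \<Rightarrow> 'a::idom poly"
  shows "(\<Sum>r\<in>R. Polynomial.smult (c r) (P r * M * X + pderiv (P r) * K * X))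
    = ((\<Sum>r\<in>R. Polynomial.smult (c r) (P r)) * M
        + pderiv (\<Sum>r\<in>R. Polynomial.smult (c r) (P r)) * K) * X"
  unfolding pderiv_sum pderiv_smult
  by (simp add: sum_distrib_right distrib_right sum.distrib smult_add_right)

lemma neg_transpose_mat_vec_index:
  fixes B :: "'a::field mat"
  assumes "B \<in> carrier_mat N N" "l \<in> carrier_vec N" "i < N"
  shows "(- transpose_mat B *\<^sub>v l) $ i = - (\<Sum>r<N. l $ r * B $$ (r, i))"
  using assms by (simp add: scalar_prod_def lessThan_atLeast0 sum_negf mult.commute)

lemma first_block_neg_transpose:
  fixes B :: "'a::field mat"
  assumes N: "N = m + n + 2" and B: "B \<in> carrier_mat N N" and l: "l \<in> carrier_vec N"
  shows "first_block m (- transpose_mat B *\<^sub>v l)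
    = - (\<Sum>r<N. Polynomial.smult (l $ r) (first_block m (row B r)))"
proof (rule poly_eqI)
  fix i
  have "i < N" if "i \<le> m" using that by (simp add: N)
  then show "coeff (first_block m (- transpose_mat B *\<^sub>v l)) i
      = coeff (- (\<Sum>r<N. Polynomial.smult (l $ r) (first_block m (row B r)))) i"
    using B by (cases "i \<le> m")
      (simp_all add: coeff_first_block coeff_sum neg_transpose_mat_vec_index[OF B l]
        del: index_mult_mat_vec)
qed

lemma second_block_neg_transpose:
  fixes B :: "'a::field mat"
  assumes N: "N = m + n + 2" and B: "B \<in> carrier_mat N N" and l: "l \<in> carrier_vec N"
  shows "second_block m n (- transpose_mat B *\<^sub>v l)
    = - (\<Sum>r<N. Polynomial.smult (l $ r) (second_block m n (row B r)))"
proof (rule poly_eqI)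
  fix i
  have "m + 1 + i < N" if "i \<le> n" using that by (simp add: N)
  then show "coeff (second_block m n (- transpose_mat B *\<^sub>v l)) i
      = coeff (- (\<Sum>r<N. Polynomial.smult (l $ r) (second_block m n (row B r)))) i"
    using B by (cases "i \<le> n")
      (simp_all add: coeff_second_block coeff_sum neg_transpose_mat_vec_index[OF B l]
        del: index_mult_mat_vec)
qed

text \<open>
  Restricted to the parametrised part, the linearised minors are polynomial identities in s and
  t.  They make every row of B a derivation; the bounds m and n < m on the degrees of its two
  blocks then leave only vector fields of degree 2 and kill the contribution of the second block
  to the first m + 1 rows.
\<close>

lemma covers_vector_field_of_tangent:
  fixes B :: "'a::field_char_0 mat"
  assumes nm: "n < m" and m2: "m + n \<ge> 2"
    and B: "B \<in> carrier_mat (m + n + 2) (m + n + 2)" and tan: "tangent_to_scroll m n B"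
  obtains K M M' where "covers_vector_field m n (- transpose_mat B) K M M'"
proof -
  let ?N = "m + n + 2" and ?X = "[:0, 1:] :: 'a poly"
  define A where "A r = first_block m (row B r)" for r
  define C where "C r = second_block m n (row B r)" for r
  have z: "(B *\<^sub>v scroll_param m n s t) $ r = poly (A r) s + t * poly (C r) s" if "r < ?N" for r s t
  proof -
    have "row B r \<in> carrier_vec ?N" using B that by auto
    from scalar_prod_scroll_param[OF this, of s t] show ?thesis
      using that B by (simp add: A_def C_def)
  qed
  have p1: "scroll_param m n s t $ k = s ^ k" if "k \<le> m" for k and s t :: 'a
    using that by (simp add: scroll_param_def)
  have p2: "scroll_param m n s t $ (m + 1 + k) = t * s ^ k" if "k \<le> n" for k and s t :: 'a
    using that by (simp add: scroll_param_def)
  have zero: "0 \<in> column_indices m n" using nm by (simp add: column_indices_def)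
  have polyX: "poly ?X s = s" for s by simp

  have first: "A k * ?X + ?X ^ k * A 1 = A (Suc k) + ?X ^ Suc k * A 0"
    "C k * ?X + ?X ^ k * C 1 = C (Suc k) + ?X ^ Suc k * C 0" if k: "k < m" for k
  proof -
    have "k \<in> column_indices m n" using k by (simp add: column_indices_def)
    then have "(B *\<^sub>v scroll_param m n s t) $ k * scroll_param m n s t $ (0 + 1) +
        scroll_param m n s t $ k * (B *\<^sub>v scroll_param m n s t) $ (0 + 1) =
        (B *\<^sub>v scroll_param m n s t) $ (k + 1) * scroll_param m n s t $ 0 +
        scroll_param m n s t $ (k + 1) * (B *\<^sub>v scroll_param m n s t) $ 0" for s t
      using tan zero unfolding tangent_to_scroll_def Let_def by blast
    then have "poly (A k * ?X + ?X ^ k * A 1) s + t * poly (C k * ?X + ?X ^ k * C 1) s + t ^ 2 * poly 0 s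
        = poly (A (Suc k) + ?X ^ Suc k * A 0) s + t * poly (C (Suc k) + ?X ^ Suc k * C 0) s
          + t ^ 2 * poly 0 s" for s t
      using k by (simp add: z p1 algebra_simps del: index_mult_mat_vec)
    from poly_eq_of_quadratic_in_parameter[OF this]
    show "A k * ?X + ?X ^ k * A 1 = A (Suc k) + ?X ^ Suc k * A 0"
      "C k * ?X + ?X ^ k * C 1 = C (Suc k) + ?X ^ Suc k * C 0" by auto
  qed
  \<comment> \<open>The minors with one column from each block also give an equation for t^2.\<close>
  have second: "C (m + 1 + k) * ?X + ?X ^ k * A 1 = C (m + 1 + Suc k) + ?X ^ Suc k * A 0"
    "?X ^ k * C 1 = ?X ^ Suc k * C 0" if k: "k < n" for k
  proof -
    have "m + 1 + k \<in> column_indices m n" using k by (simp add: column_indices_def)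
    then have "(B *\<^sub>v scroll_param m n s t) $ (m + 1 + k) * scroll_param m n s t $ (0 + 1) +
        scroll_param m n s t $ (m + 1 + k) * (B *\<^sub>v scroll_param m n s t) $ (0 + 1) =
        (B *\<^sub>v scroll_param m n s t) $ (m + 1 + k + 1) * scroll_param m n s t $ 0 +
        scroll_param m n s t $ (m + 1 + k + 1) * (B *\<^sub>v scroll_param m n s t) $ 0" for s t
      using tan zero unfolding tangent_to_scroll_def Let_def by blast
    moreover have "m + 1 + k + 1 = m + 1 + Suc k" by simp
    ultimately have eq: "(B *\<^sub>v scroll_param m n s t) $ (m + 1 + k) * scroll_param m n s t $ (0 + 1) +
        scroll_param m n s t $ (m + 1 + k) * (B *\<^sub>v scroll_param m n s t) $ (0 + 1) =
        (B *\<^sub>v scroll_param m n s t) $ (m + 1 + Suc k) * scroll_param m n s t $ 0 +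
        scroll_param m n s t $ (m + 1 + Suc k) * (B *\<^sub>v scroll_param m n s t) $ 0" for s t
      by (simp only:)
    have "poly (A (m + 1 + k) * ?X) s + t * poly (C (m + 1 + k) * ?X + ?X ^ k * A 1) s
          + t ^ 2 * poly (?X ^ k * C 1) s
        = poly (A (m + 1 + Suc k)) s + t * poly (C (m + 1 + Suc k) + ?X ^ Suc k * A 0) s
          + t ^ 2 * poly (?X ^ Suc k * C 0) s" for s t
    proof -
      have b: "m + 1 + k < ?N" "0 + 1 < ?N" "m + 1 + Suc k < ?N" "0 < ?N" using k by auto
      have c: "0 + 1 \<le> m" "0 \<le> m" "k \<le> n" "Suc k \<le> n" using k nm by auto
      from eq[of s t] show ?thesis
        unfolding z[OF b(1)] z[OF b(2)] z[OF b(3)] z[OF b(4)] p1[OF c(1)] p1[OF c(2)]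
          p2[OF c(3)] p2[OF c(4)]
        by (simp add: algebra_simps power2_eq_square)
    qed
    from poly_eq_of_quadratic_in_parameter[OF this]
    show "C (m + 1 + k) * ?X + ?X ^ k * A 1 = C (m + 1 + Suc k) + ?X ^ Suc k * A 0"
      "?X ^ k * C 1 = ?X ^ Suc k * C 0" by auto
  qed

  define K where "K = A 1 - ?X * A 0"
  define L where "L = C 1 - ?X * C 0"
  have A: "A k * ?X = ?X ^ k * (?X * A 0 + of_nat k * K)" if "k \<le> m" for k
    using derivation_recursion[of m A ?X "A 1" "A 0" k] first(1) that by (simp only: K_def)
  have C: "C k * ?X = ?X ^ k * (?X * C 0 + of_nat k * L)" if "k \<le> m" for k
    using derivation_recursion[of m C ?X "C 1" "C 0" k] first(2) that by (simp only: L_def)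
  have D: "C (m + 1 + k) * ?X = ?X ^ k * (?X * C (m + 1) + of_nat k * K)" if "k \<le> n" for k
    using derivation_recursion[of n "\<lambda>k. C (m + 1 + k)" ?X "A 1" "A 0" k] second(1) that
    by (simp only: K_def add_0_right)
  have cX: "coeff (?X * P) e = (if e = 0 then 0 else coeff P (e - 1))" for P and e
    by (cases e) (simp_all add: coeff_pCons)
  have cQ: "coeff (?X * P + of_nat k * Q) e = (if e = 0 then 0 else coeff P (e - 1)) + of_nat k * coeff Q e"
    for P Q :: "'a poly" and k e
    unfolding coeff_add cX by (simp add: of_nat_poly)
  have bound: "(if e = 0 then 0 else coeff P (e - 1)) + of_nat k * coeff Q e = 0"
    if "R * ?X = ?X ^ k * (?X * P + of_nat k * Q)" "degree R \<le> d" "e + k > d + 1"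
    for P Q R :: "'a poly" and k d e
    unfolding cQ[symmetric] by (rule coeff_bound_of_factor[OF that])
  have degA: "degree (A r) \<le> m" and degC: "degree (C r) \<le> n" for r
    by (simp_all only: A_def C_def degree_first_block degree_second_block)

  \<comment> \<open>The last two rows of the first block give two equations for each high coefficient.\<close>
  have A_last: "coeff (A 0) (e - 1) + of_nat m * coeff K e = 0" if "e \<ge> 2" for e
    using bound[OF A[OF order_refl] degA, of e] that by simp
  have A_prev: "coeff (A 0) (e - 1) + of_nat (m - 1) * coeff K e = 0" if "e \<ge> 3" for e
    using bound[OF A[of "m - 1"] degA, of e] that nm by simp
  have K3: "coeff K e = 0" if "e \<ge> 3" for e
    using A_last[of e] A_prev[of e] that nm by (simp add: of_nat_diff algebra_simps)
  have A0: "coeff (A 0) e = 0" if "e \<ge> 2" for e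
    using A_last[of "Suc e"] K3[of "Suc e"] that by simp
  have A1: "coeff (A 0) 1 = - (of_nat m * coeff K 2)"
    using A_last[of 2] by (simp add: eq_neg_iff_add_eq_0)

  \<comment> \<open>Since n < m, the same count for the coefficient of t leaves nothing.  For n = 0 there is no
    equation for t^2; then m is at least 2, and the row m - 1 replaces it.\<close>
  have C_last: "coeff (C 0) (e - 1) + of_nat m * coeff L e = 0" if "e \<ge> 1" for e
    using bound[OF C[OF order_refl] degC, of e] that nm by simp
  have L0: "L = 0"
  proof (cases "n = 0")
    case False
    then show ?thesis using second(2)[of 0] by (simp add: L_def)
  next
    case True
    have C_prev: "coeff (C 0) (e - 1) + of_nat (m - 1) * coeff L e = 0" if "e \<ge> 1" for e
      using bound[OF C[of "m - 1"] degC, of e] that nm m2 True by simp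
    have "coeff L e = 0" if "e \<ge> 1" for e
      using C_last[of e] C_prev[of e] that nm by (simp add: of_nat_diff algebra_simps)
    moreover have "coeff L 0 = 0"
      using bound[OF C[OF order_refl] degC, of 0] True nm m2 by simp
    ultimately have "coeff L e = 0" for e by (cases e) auto
    then show ?thesis by (simp add: poly_eq_iff)
  qed
  have C0: "C 0 = 0"
    using C_last[of "Suc e" for e] by (simp add: L0 poly_eq_iff)
  have C_zero: "C k = 0" if "k \<le> m" for k
    using C[OF that] by (simp add: L0 C0)
  have D_last: "coeff (C (m + 1)) (e - 1) + of_nat n * coeff K e = 0" if "e \<ge> 2" for e
    using bound[OF D[OF order_refl] degC, of e] that by simp
  have D0: "coeff (C (m + 1)) e = 0" if "e \<ge> 2" for e
    using D_last[of "Suc e"] K3[of "Suc e"] that by simp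
  have D1: "coeff (C (m + 1)) 1 = - (of_nat n * coeff K 2)"
    using D_last[of 2] by (simp add: eq_neg_iff_add_eq_0)

  note f_T = first_block_neg_transpose[OF refl B, folded A_def]
    and g_T = second_block_neg_transpose[OF refl B, folded C_def]
  have X_deriv: "?X ^ k * (?X * P + of_nat k * K) = monom 1 k * P * ?X + pderiv (monom 1 k) * K * ?X"
    for k and P :: "'a poly"
    by (subst pderiv_monom, unfold monom_altdef, cases k) (simp_all add: algebra_simps of_nat_poly)
  have X0: "?X \<noteq> 0" by simp
  have neg: "- ((f * M + f' * K) * x) = (- M * f - K * f') * x" for f f' M x :: "'a poly"
    by (simp add: algebra_simps)
  show ?thesis
  proof (rule that[of K "- A 0" "- C (m + 1)"], unfold covers_vector_field_def, intro conjI ballI impI)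
    show "- transpose_mat B \<in> carrier_mat ?N ?N" using B by simp
    show "degree K \<le> 2" by (rule degree_le) (simp add: K3)
    show "degree (- A 0) \<le> 1" by (rule degree_le) (simp add: A0)
    show "degree (- C (m + 1)) \<le> 1" by (rule degree_le) (use D0 in simp)
    show "coeff (- A 0) 1 = of_nat m * coeff K 2" using A1 by simp
    show "coeff (- C (m + 1)) 1 = of_nat n * coeff K 2" using D1 by simp
  next
    fix l :: "'a vec" assume l: "l \<in> carrier_vec ?N" and g0: "second_block m n l = 0"
    have "l $ (m + 1 + j) = 0" if "j \<le> n" for j
      using arg_cong[OF g0, of "\<lambda>p. coeff p j"] that by (simp add: coeff_second_block)
    then have "first_block m (- transpose_mat B *\<^sub>v l) = - (\<Sum>r\<le>m. Polynomial.smult (l $ r) (A r))"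
      unfolding f_T[OF l] sum_blocks by simp
    then have "first_block m (- transpose_mat B *\<^sub>v l) * ?X
        = - (\<Sum>r\<le>m. Polynomial.smult (l $ r) (A r * ?X))"
      by (simp only: mult_minus_left sum_distrib_right mult_smult_left)
    also have "\<dots> = - (\<Sum>r\<le>m. Polynomial.smult (l $ r)
        (monom 1 r * A 0 * ?X + pderiv (monom 1 r) * K * ?X))"
      by (intro arg_cong[of _ _ uminus] sum.cong refl) (simp only: A X_deriv atMost_iff)
    also have "\<dots> = (- A 0 * first_block m l - K * pderiv (first_block m l)) * ?X"
    proof -
      have f: "first_block m l = (\<Sum>r\<le>m. Polynomial.smult (l $ r) (monom 1 r))"
        by (simp add: first_block_def smult_monom)
      show ?thesis unfolding sum_first_order_operator f[symmetric] by (rule neg)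
    qed
    finally show "first_block m (- transpose_mat B *\<^sub>v l)
        = - A 0 * first_block m l - K * pderiv (first_block m l)"
      by (rule iffD1[OF mult_right_cancel[OF X0]])
  next
    fix l :: "'a vec" assume l: "l \<in> carrier_vec ?N"
    have "second_block m n (- transpose_mat B *\<^sub>v l)
        = - (\<Sum>j\<le>n. Polynomial.smult (l $ (m + 1 + j)) (C (m + 1 + j)))"
      unfolding g_T[OF l] sum_blocks by (simp add: C_zero)
    then have "second_block m n (- transpose_mat B *\<^sub>v l) * ?X
        = - (\<Sum>j\<le>n. Polynomial.smult (l $ (m + 1 + j)) (C (m + 1 + j) * ?X))"
      by (simp only: mult_minus_left sum_distrib_right mult_smult_left)
    also have "\<dots> = - (\<Sum>j\<le>n. Polynomial.smult (l $ (m + 1 + j))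
        (monom 1 j * C (m + 1) * ?X + pderiv (monom 1 j) * K * ?X))"
      by (intro arg_cong[of _ _ uminus] sum.cong refl) (simp only: D X_deriv atMost_iff)
    also have "\<dots> = (- C (m + 1) * second_block m n l - K * pderiv (second_block m n l)) * ?X"
    proof -
      have g: "second_block m n l = (\<Sum>j\<le>n. Polynomial.smult (l $ (m + 1 + j)) (monom 1 j))"
        by (simp add: second_block_def smult_monom)
      show ?thesis unfolding sum_first_order_operator g[symmetric] by (rule neg)
    qed
    finally show "second_block m n (- transpose_mat B *\<^sub>v l)
        = - C (m + 1) * second_block m n l - K * pderiv (second_block m n l)"
      by (rule iffD1[OF mult_right_cancel[OF X0]])
  qed
qed

lemma first_block_smult: "v \<in> carrier_vec (m + n + 2) \<Longrightarrow>
    first_block m (c \<cdot>\<^sub>v v) = Polynomial.smult c (first_block m v)"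
  by (rule poly_eqI) (simp add: coeff_first_block)

lemma second_block_smult: "v \<in> carrier_vec (m + n + 2) \<Longrightarrow>
    second_block m n (c \<cdot>\<^sub>v v) = Polynomial.smult c (second_block m n v)"
  by (rule poly_eqI) (simp add: coeff_second_block)

lemma first_block_diff: "u \<in> carrier_vec (m + n + 2) \<Longrightarrow> v \<in> carrier_vec (m + n + 2) \<Longrightarrow>
    first_block m (u - v) = first_block m u - first_block m v"
  by (rule poly_eqI) (simp add: coeff_first_block)

lemma second_block_diff: "u \<in> carrier_vec (m + n + 2) \<Longrightarrow> v \<in> carrier_vec (m + n + 2) \<Longrightarrow>
    second_block m n (u - v) = second_block m n u - second_block m n v"
  by (rule poly_eqI) (simp add: coeff_second_block)

lemma vec_eq_of_blocks:
  assumes "u \<in> carrier_vec (m + n + 2)" "v \<in> carrier_vec (m + n + 2)"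
    "first_block m u = first_block m v" "second_block m n u = second_block m n v"
  shows "u = v"
proof -
  have "linear_form m n (first_block m u) (second_block m n u) = v"
    unfolding assms(3,4) by (rule linear_form_of_blocks[OF assms(2)])
  then show ?thesis unfolding linear_form_of_blocks[OF assms(1)] .
qed

lemma covers_vector_fieldD:
  assumes "covers_vector_field m n T K M M'"
  shows "T \<in> carrier_mat (m + n + 2) (m + n + 2)" "degree K \<le> 2"
    "\<And>l. l \<in> carrier_vec (m + n + 2) \<Longrightarrow> T *\<^sub>v l \<in> carrier_vec (m + n + 2)"
    "\<And>l. l \<in> carrier_vec (m + n + 2) \<Longrightarrow> second_block m n l = 0 \<Longrightarrow>
      first_block m (T *\<^sub>v l) = M * first_block m l - K * pderiv (first_block m l)"
    "\<And>l. l \<in> carrier_vec (m + n + 2) \<Longrightarrow>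
      second_block m n (T *\<^sub>v l) = M' * second_block m n l - K * pderiv (second_block m n l)"
proof -
  note d = assms[unfolded covers_vector_field_def]
  show T: "T \<in> carrier_mat (m + n + 2) (m + n + 2)" and "degree K \<le> 2" using d by blast+
  show "T *\<^sub>v l \<in> carrier_vec (m + n + 2)" if "l \<in> carrier_vec (m + n + 2)" for l
    by (rule mult_mat_vec_carrier[OF T that])
  show "first_block m (T *\<^sub>v l) = M * first_block m l - K * pderiv (first_block m l)"
    if "l \<in> carrier_vec (m + n + 2)" "second_block m n l = 0" for l
    using d that by blast
  show "second_block m n (T *\<^sub>v l) = M' * second_block m n l - K * pderiv (second_block m n l)"
    if "l \<in> carrier_vec (m + n + 2)" for l
    using d that by blast
qed

lemma covers_vector_field_pderiv_multiplier:
  fixes K :: "'a::field_char_0 poly"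
  assumes "covers_vector_field m n T K M M'"
  shows "2 * pderiv M = of_nat m * pderiv (pderiv K)" "2 * pderiv M' = of_nat n * pderiv (pderiv K)"
proof -
  have *: "2 * pderiv P = of_nat d * pderiv (pderiv K)"
    if "degree P \<le> 1" "coeff P 1 = of_nat d * coeff K 2" for P d
  proof (rule poly_eqI)
    fix i
    have two: "(2 :: 'a poly) = [:2:]" by (rule numeral_poly)
    have K: "coeff K (Suc (Suc (Suc j))) = 0" for j
      using assms by (intro coeff_eq_0) (auto simp: covers_vector_field_def)
    have P: "coeff P (Suc (Suc j)) = 0" for j
      using that(1) by (intro coeff_eq_0) auto
    show "coeff (2 * pderiv P) i = coeff (of_nat d * pderiv (pderiv K)) i"
      using that(2) by (cases i) (simp_all add: two coeff_pderiv of_nat_poly K P numeral_2_eq_2)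
  qed
  note d = assms[unfolded covers_vector_field_def]
  show "2 * pderiv M = of_nat m * pderiv (pderiv K)" by (rule *) (use d in blast)+
  show "2 * pderiv M' = of_nat n * pderiv (pderiv K)" by (rule *) (use d in blast)+
qed

lemma commutator_of_first_order_operators:
  fixes f :: "'a::idom poly"
  shows "(M1 * (M2 * f - K2 * pderiv f) - K1 * pderiv (M2 * f - K2 * pderiv f))
    - (M2 * (M1 * f - K1 * pderiv f) - K2 * pderiv (M1 * f - K1 * pderiv f))
    = (K2 * pderiv M1 - K1 * pderiv M2) * f - (K2 * pderiv K1 - K1 * pderiv K2) * pderiv f"
  by (simp add: pderiv_mult pderiv_diff algebra_simps)

text \<open>
  Brackets of operators cover brackets of vector fields.  Testing on the forms 1 and s of the
  first block and on the form 1 of the second block identifies the operators.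
\<close>

lemma covers_vector_field_bracket:
  fixes T1 T2 T3 :: "'a::field_char_0 mat"
  assumes m: "m \<ge> 1"
    and T1: "covers_vector_field m n T1 K1 M1 M1'"
    and T2: "covers_vector_field m n T2 K2 M2 M2'"
    and T3: "covers_vector_field m n T3 K3 M3 M3'"
    and br: "\<And>l. l \<in> carrier_vec (m + n + 2) \<Longrightarrow> T1 *\<^sub>v (T2 *\<^sub>v l) - T2 *\<^sub>v (T1 *\<^sub>v l) = c \<cdot>\<^sub>v (T3 *\<^sub>v l)"
  shows "[:c:] * K3 = K2 * pderiv K1 - K1 * pderiv K2"
    and "[:c:] * M3 = K2 * pderiv M1 - K1 * pderiv M2"
    and "[:c:] * M3' = K2 * pderiv M1' - K1 * pderiv M2'"
proof -
  note d1 = covers_vector_fieldD[OF T1] and d2 = covers_vector_fieldD[OF T2]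
    and d3 = covers_vector_fieldD[OF T3]
  have first: "[:c:] * (M3 * f - K3 * pderiv f)
      = (K2 * pderiv M1 - K1 * pderiv M2) * f - (K2 * pderiv K1 - K1 * pderiv K2) * pderiv f"
    if f: "degree f \<le> m" for f
  proof -
    let ?l = "linear_form m n f 0"
    note lc = linear_form_carrier[of m n f 0]
    have g0: "second_block m n ?l = 0" by (rule second_block_linear_form) simp
    have g1: "second_block m n (T1 *\<^sub>v ?l) = 0" and g2: "second_block m n (T2 *\<^sub>v ?l) = 0"
      using d1(5)[OF lc] d2(5)[OF lc] g0 by simp_all
    have "first_block m (T1 *\<^sub>v (T2 *\<^sub>v ?l) - T2 *\<^sub>v (T1 *\<^sub>v ?l)) = [:c:] * first_block m (T3 *\<^sub>v ?l)"
      unfolding br[OF lc] first_block_smult[OF d3(3)[OF lc]] by simp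
    then show ?thesis
      unfolding first_block_diff[OF d1(3)[OF d2(3)[OF lc]] d2(3)[OF d1(3)[OF lc]]]
        d1(4)[OF d2(3)[OF lc] g2] d2(4)[OF d1(3)[OF lc] g1]
        d1(4)[OF lc g0] d2(4)[OF lc g0] d3(4)[OF lc g0] first_block_linear_form[OF f]
        commutator_of_first_order_operators by (rule sym)
  qed
  have second: "[:c:] * (M3' * g - K3 * pderiv g)
      = (K2 * pderiv M1' - K1 * pderiv M2') * g - (K2 * pderiv K1 - K1 * pderiv K2) * pderiv g"
    if g: "degree g \<le> n" for g
  proof -
    let ?l = "linear_form m n 0 g"
    note lc = linear_form_carrier[of m n 0 g]
    have "second_block m n (T1 *\<^sub>v (T2 *\<^sub>v ?l) - T2 *\<^sub>v (T1 *\<^sub>v ?l)) = [:c:] * second_block m n (T3 *\<^sub>v ?l)"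
      unfolding br[OF lc] second_block_smult[OF d3(3)[OF lc]] by simp
    then show ?thesis
      unfolding second_block_diff[OF d1(3)[OF d2(3)[OF lc]] d2(3)[OF d1(3)[OF lc]]]
        d1(5)[OF d2(3)[OF lc]] d2(5)[OF d1(3)[OF lc]]
        d1(5)[OF lc] d2(5)[OF lc] d3(5)[OF lc] second_block_linear_form[OF g]
        commutator_of_first_order_operators by (rule sym)
  qed
  show M: "[:c:] * M3 = K2 * pderiv M1 - K1 * pderiv M2"
    using first[of 1] by simp
  show "[:c:] * M3' = K2 * pderiv M1' - K1 * pderiv M2'"
    using second[of 1] by simp
  have "[:c:] * (M3 * P - K3) = (K2 * pderiv M1 - K1 * pderiv M2) * P - (K2 * pderiv K1 - K1 * pderiv K2)"
    if "P = [:0, 1:]" for P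
    using first[of P] m that by (simp add: pderiv_pCons)
  note eq = this[OF refl, unfolded right_diff_distrib mult.assoc[symmetric] M]
  have cancel: "x - a = x - b \<Longrightarrow> a = b" for x a b :: "'a poly"
    by (drule arg_cong[where f = "\<lambda>y. x - y"]) simp
  show "[:c:] * K3 = K2 * pderiv K1 - K1 * pderiv K2" by (rule cancel[OF eq])
qed

text \<open>
  On brackets the multiplier is determined by the vector field, and no scalar can be added,
  because (K2 K1' - K1 K2')' = K2 K1'' - K1 K2''.
\<close>

lemma multiplier_of_bracket:
  fixes K :: "'a::field_char_0 poly"
  assumes "[:c:] * K = K2 * pderiv K1 - K1 * pderiv K2" and "[:c:] * M = K2 * pderiv M1 - K1 * pderiv M2"
    and "2 * pderiv M1 = of_nat d * pderiv (pderiv K1)" "2 * pderiv M2 = of_nat d * pderiv (pderiv K2)"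
    and "c \<noteq> 0"
  shows "2 * M = of_nat d * pderiv K"
proof -
  have "[:c:] * (2 * M) = K2 * (2 * pderiv M1) - K1 * (2 * pderiv M2)"
    using arg_cong[OF assms(2), of "\<lambda>p. 2 * p"] by (simp only: algebra_simps)
  also have "\<dots> = of_nat d * (K2 * pderiv (pderiv K1) - K1 * pderiv (pderiv K2))"
    unfolding assms(3,4) by (simp add: algebra_simps)
  also have "K2 * pderiv (pderiv K1) - K1 * pderiv (pderiv K2) = pderiv ([:c:] * K)"
    unfolding assms(1) by (simp add: pderiv_diff pderiv_mult algebra_simps)
  also have "of_nat d * pderiv ([:c:] * K) = [:c:] * (of_nat d * pderiv K)"
    by (simp add: pderiv_smult)
  finally have eq: "[:c:] * (2 * M) = [:c:] * (of_nat d * pderiv K)" .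
  have "[:c:] \<noteq> 0" using assms(5) by simp
  from mult_left_cancel[OF this] eq show ?thesis by blast
qed

section \<open>Highest weight forms\<close>

text \<open>
  The discriminant of an eigenvector of a nonzero eigenvalue vanishes: it is nilpotent, so it
  has a double zero on the projective line.
\<close>

lemma eigenfield_is_square:
  fixes K H :: "'a::field_char_0 poly"
  assumes "degree K \<le> 2" "degree H \<le> 2" and rel: "2 * K = K * pderiv H - H * pderiv K" and "K \<noteq> 0"
  obtains e p q where "e \<noteq> 0" "(p, q) \<noteq> (0, 0)" "K = [:e:] * [:p, q:] ^ 2"
proof -
  have deg2: "\<exists>a b c. P = [:a, b, c:]" if "degree P \<le> 2" for P :: "'a poly"
  proof (intro exI poly_eqI)
    fix i
    show "coeff P i = coeff [:coeff P 0, coeff P 1, coeff P 2:] i"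
      using coeff_eq_0[of P i] that
      by (cases "i = 0 \<or> i = 1 \<or> i = 2") (auto simp: coeff_pCons numeral_2_eq_2 split: nat.split)
  qed
  obtain x0 x1 x2 where K: "K = [:x0, x1, x2:]" using deg2[OF assms(1)] by blast
  obtain h0 h1 h2 where H: "H = [:h0, h1, h2:]" using deg2[OF assms(2)] by blast
  have "coeff (2 * K) i = coeff (K * pderiv H - H * pderiv K) i" for i using rel by simp
  from this[of 0] this[of 1] this[of 2]
  have r': "2 * x0 = x0 * h1 - h0 * x1" "2 * x1 = 2 * (x0 * h2 - h0 * x2)" "2 * x2 = x1 * h2 - h1 * x2"
    unfolding K H numeral_poly
    by (simp_all add: pderiv_pCons numeral_2_eq_2 algebra_simps)
  have "x1 = x0 * h2 - h0 * x2" using r'(2) by (simp only: mult_cancel_left) simp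
  note r = r'(1) this r'(3)
  have "x1 * x1 = 4 * (x0 * x2)"
  proof -
    have "x1 * x1 = x0 * (x1 * h2) - (h0 * x1) * x2" 
      using arg_cong[OF r(2), of "\<lambda>y. x1 * y"] by (simp add: algebra_simps)
    also have "x1 * h2 = 2 * x2 + h1 * x2" using r(3) by simp
    also have "h0 * x1 = x0 * h1 - 2 * x0" using r(1) by simp
    finally show ?thesis by (simp add: algebra_simps)
  qed
  show ?thesis
  proof (cases "x2 = 0")
    case True
    then have "x1 = 0" using \<open>x1 * x1 = 4 * (x0 * x2)\<close> by simp
    then show ?thesis using that[of x0 1 0] True \<open>K \<noteq> 0\<close> K by (simp add: power2_eq_square)
  next
    case False
    have "x2 * (x1 / (2 * x2)) ^ 2 = x1 * x1 / (4 * x2)"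
      using False by (simp add: power2_eq_square field_simps)
    also have "\<dots> = x0"
      unfolding \<open>x1 * x1 = 4 * (x0 * x2)\<close> using False by simp
    finally have "x2 * (x1 / (2 * x2)) ^ 2 = x0" .
    then have "K = [:x2:] * [:x1 / (2 * x2), 1:] ^ 2"
      unfolding K using False by (simp add: power2_eq_square)
    with that[of x2 "x1 / (2 * x2)" 1] False show ?thesis by simp
  qed
qed

text \<open>
  If q is nonzero, f vanishes at the zero of the linear polynomial, and dividing by the linear
  polynomial lowers d by 1 in the differential equation.
\<close>

lemma power_of_linear_from_ode:
  fixes f :: "'a::field_char_0 poly"
  assumes "(p, q) \<noteq> (0, 0)" and "[:p, q:] * pderiv f = of_nat d * ([:q:] * f)"
  obtains c where "f = [:c:] * [:p, q:] ^ d"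
proof (cases "q = 0")
  case True
  then have p: "p \<noteq> 0" using assms(1) by simp
  then have "pderiv f = 0" using assms(2) True by simp
  then have "degree f = 0" by (simp add: pderiv_eq_0_iff)
  then obtain c where c: "f = [:c:]" by (rule degree_eq_zeroE)
  show ?thesis using that[of "c / p ^ d"] p c True by (simp add: poly_const_pow)
next
  case False
  have "\<exists>c. f = [:c:] * [:p, q:] ^ d" using assms(2)
  proof (induction d arbitrary: f)
    case 0
    then have "[:p, q:] * pderiv f = 0" by (simp only: of_nat_0 mult_zero_left)
    moreover have "[:p, q:] \<noteq> 0" using False by simp
    ultimately have "pderiv f = 0" by (simp only: mult_eq_0_iff) blast
    then have "degree f = 0" by (simp add: pderiv_eq_0_iff)
    then obtain c where "f = [:c:]" by (rule degree_eq_zeroE)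
    then have "f = [:c:] * [:p, q:] ^ 0" by simp
    then show ?case by (rule exI)
  next
    case (Suc d)
    let ?r = "- p / q"
    have l0: "[:p, q:] \<noteq> 0" using False by simp
    have "poly (of_nat (Suc d) * ([:q:] * f)) ?r = poly ([:p, q:] * pderiv f) ?r"
      using Suc.prems by simp
    then have "poly f ?r = 0" using False by (simp add: of_nat_poly del: of_nat_Suc)
    then obtain h where h: "f = [:- ?r, 1:] * h" using poly_eq_0_iff_dvd by blast
    define k where "k = Polynomial.smult (1 / q) h"
    have l: "[:- ?r, 1:] = Polynomial.smult (1 / q) [:p, q:]" using False by simp
    have f: "f = [:p, q:] * k" unfolding h k_def l by (simp del: smult_pCons)
    have dl: "pderiv [:p, q:] = [:q:]" by (simp add: pderiv_pCons)
    have product: "L * (L * k' + k * Q) = of_nat (Suc d) * (Q * (L * k)) \<Longrightarrow>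
        L * (L * k') = L * (of_nat d * (Q * k))" for L Q k k' :: "'a poly"
      by (simp add: algebra_simps)
    have "[:p, q:] * ([:p, q:] * pderiv k) = [:p, q:] * (of_nat d * ([:q:] * k))"
      by (rule product[OF Suc.prems[unfolded f pderiv_mult dl]])
    then have "[:p, q:] * pderiv k = of_nat d * ([:q:] * k)"
      by (rule iffD1[OF mult_left_cancel[OF l0]])
    then obtain c where "k = [:c:] * [:p, q:] ^ d" using Suc.IH by blast
    then have "f = [:c:] * [:p, q:] ^ Suc d"
      unfolding f by (simp only: power_Suc mult.left_commute)
    then show ?case by (rule exI)
  qed
  then show ?thesis using that by blast
qed

lemma pderiv_const_times_square:
  "pderiv ([:e:] * [:p, q:] ^ 2) = [:e:] * (2 * ([:p, q:] * [:q :: 'a::idom:]))"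
  by (simp add: power2_eq_square pderiv_mult pderiv_pCons numeral_poly algebra_simps)

text \<open>
  Only the action on linear forms matters, so the relations of sl 2 are stated on vectors.  The
  last assumption excludes the zero representation.
\<close>

locale sl2_on_forms =
  fixes m n :: nat and Th Tx Ty :: "'a::field_char_0 mat"
    and Kh Mh Mh' Kx Mx Mx' Ky My My' :: "'a poly"
  assumes nm: "n < m"
    and covers_h: "covers_vector_field m n Th Kh Mh Mh'"
    and covers_x: "covers_vector_field m n Tx Kx Mx Mx'"
    and covers_y: "covers_vector_field m n Ty Ky My My'"
    and hx: "l \<in> carrier_vec (m + n + 2) \<Longrightarrow> Th *\<^sub>v (Tx *\<^sub>v l) - Tx *\<^sub>v (Th *\<^sub>v l) = 2 \<cdot>\<^sub>v (Tx *\<^sub>v l)"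
    and hy: "l \<in> carrier_vec (m + n + 2) \<Longrightarrow> Th *\<^sub>v (Ty *\<^sub>v l) - Ty *\<^sub>v (Th *\<^sub>v l) = (- 2) \<cdot>\<^sub>v (Ty *\<^sub>v l)"
    and xy: "l \<in> carrier_vec (m + n + 2) \<Longrightarrow> Tx *\<^sub>v (Ty *\<^sub>v l) - Ty *\<^sub>v (Tx *\<^sub>v l) = 1 \<cdot>\<^sub>v (Th *\<^sub>v l)"
    and h_nonzero: "\<exists>l\<in>carrier_vec (m + n + 2). Th *\<^sub>v l \<noteq> 0\<^sub>v (m + n + 2)"
begin

lemma m_pos: "m \<ge> 1"
  using nm by simp

lemma field_brackets:
  "2 * Kx = Kx * pderiv Kh - Kh * pderiv Kx"
  "- 2 * Ky = Ky * pderiv Kh - Kh * pderiv Ky"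
  "Kh = Ky * pderiv Kx - Kx * pderiv Ky"
  using covers_vector_field_bracket(1)[OF m_pos covers_h covers_x covers_x hx]
    covers_vector_field_bracket(1)[OF m_pos covers_h covers_y covers_y hy]
    covers_vector_field_bracket(1)[OF m_pos covers_x covers_y covers_h xy]
  by (simp_all add: numeral_poly)

lemma multipliers:
  "2 * Mh = of_nat m * pderiv Kh" "2 * Mh' = of_nat n * pderiv Kh"
  "2 * Mx = of_nat m * pderiv Kx" "2 * Mx' = of_nat n * pderiv Kx"
  "2 * My = of_nat m * pderiv Ky" "2 * My' = of_nat n * pderiv Ky"
proof -
  note b_x = covers_vector_field_bracket[OF m_pos covers_h covers_x covers_x hx]
    and b_y = covers_vector_field_bracket[OF m_pos covers_h covers_y covers_y hy]
    and b_h = covers_vector_field_bracket[OF m_pos covers_x covers_y covers_h xy]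
    and p_h = covers_vector_field_pderiv_multiplier[OF covers_h]
    and p_x = covers_vector_field_pderiv_multiplier[OF covers_x]
    and p_y = covers_vector_field_pderiv_multiplier[OF covers_y]
  have c: "(2 :: 'a) \<noteq> 0" "- 2 \<noteq> (0 :: 'a)" "(1 :: 'a) \<noteq> 0" by simp_all
  show "2 * Mh = of_nat m * pderiv Kh" by (rule multiplier_of_bracket[OF b_h(1,2) p_x(1) p_y(1) c(3)])
  show "2 * Mh' = of_nat n * pderiv Kh" by (rule multiplier_of_bracket[OF b_h(1,3) p_x(2) p_y(2) c(3)])
  show "2 * Mx = of_nat m * pderiv Kx" by (rule multiplier_of_bracket[OF b_x(1,2) p_h(1) p_x(1) c(1)])
  show "2 * Mx' = of_nat n * pderiv Kx" by (rule multiplier_of_bracket[OF b_x(1,3) p_h(2) p_x(2) c(1)])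
  show "2 * My = of_nat m * pderiv Ky" by (rule multiplier_of_bracket[OF b_y(1,2) p_h(1) p_y(1) c(2)])
  show "2 * My' = of_nat n * pderiv Ky" by (rule multiplier_of_bracket[OF b_y(1,3) p_h(2) p_y(2) c(2)])
qed

text \<open>
  If the vector field of x vanished, all three would, and with them the multipliers.  The
  operators would map all forms to forms without second block and kill the latter, so that all
  products of two of them, and hence h = [x, y], would vanish.
\<close>

lemma Kx_nonzero: "Kx \<noteq> 0"
proof
  assume Kx: "Kx = 0"
  have two: "P = 0" if "2 * P = 0" for P :: "'a poly" using that by simp
  have Kh: "Kh = 0" using field_brackets(3) by (simp add: Kx)
  then have Ky: "Ky = 0" using field_brackets(2) by simp
  have M: "Mx = 0" "Mx' = 0" "My = 0" "My' = 0"
    using multipliers(3-6) by (auto intro!: two simp: Kx Ky)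
  note dx = covers_vector_fieldD[OF covers_x] and dy = covers_vector_fieldD[OF covers_y]
    and dh = covers_vector_fieldD[OF covers_h]
  have g: "second_block m n (Tx *\<^sub>v l) = 0" "second_block m n (Ty *\<^sub>v l) = 0"
    if "l \<in> carrier_vec (m + n + 2)" for l
    using dx(5)[OF that] dy(5)[OF that] by (simp_all add: M Kx Ky)
  have f: "first_block m (Tx *\<^sub>v l) = 0" "first_block m (Ty *\<^sub>v l) = 0"
    if "l \<in> carrier_vec (m + n + 2)" "second_block m n l = 0" for l
    using dx(4)[OF that] dy(4)[OF that] by (simp_all add: M Kx Ky)
  have "Th *\<^sub>v l = 0\<^sub>v (m + n + 2)" if l: "l \<in> carrier_vec (m + n + 2)" for l
  proof -
    have "Tx *\<^sub>v (Ty *\<^sub>v l) = Ty *\<^sub>v (Tx *\<^sub>v l)"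
      by (rule vec_eq_of_blocks[OF dx(3)[OF dy(3)[OF l]] dy(3)[OF dx(3)[OF l]]])
        (simp_all only: f[OF dx(3)[OF l] g(1)[OF l]] f[OF dy(3)[OF l] g(2)[OF l]]
          g[OF dx(3)[OF l]] g[OF dy(3)[OF l]])
    then have "1 \<cdot>\<^sub>v (Th *\<^sub>v l) = Ty *\<^sub>v (Tx *\<^sub>v l) - Ty *\<^sub>v (Tx *\<^sub>v l)"
      using xy[OF l] by simp
    also have "\<dots> = 0\<^sub>v (m + n + 2)"
      using dy(3)[OF dx(3)[OF l]] by (rule minus_cancel_vec)
    finally show ?thesis by simp
  qed
  then show False using h_nonzero by blast
qed

text \<open>
  Weights on each block: with the vector field of x equal to e \<ell>^2, a polynomial killed
  by x is a multiple of a power of \<ell> and has weight m, respectively n.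
\<close>

lemma linear_factor_ode:
  assumes K: "Kx = [:e:] * [:p, q:] ^ 2" and e: "e \<noteq> 0" "(p, q) \<noteq> (0, 0)"
    and M: "2 * M = of_nat d * pderiv Kx" and g: "M * g - Kx * pderiv g = 0"
  shows "[:p, q:] * pderiv g = of_nat d * ([:q:] * g)"
proof -
  have dK: "pderiv Kx = [:e:] * (2 * ([:p, q:] * [:q:]))"
    unfolding K by (rule pderiv_const_times_square)
  have ring: "2 * M = D * (E * (2 * (L * Q))) \<Longrightarrow> M * g - E * L ^ 2 * g' = 0 \<Longrightarrow>
      (2 * (E * L)) * (L * g') = (2 * (E * L)) * (D * (Q * g))" for D E L Q g' :: "'a poly"
  proof -
    assume 1: "2 * M = D * (E * (2 * (L * Q)))" and "M * g - E * L ^ 2 * g' = 0"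
    then have "M * g = E * L ^ 2 * g'" by (simp only: right_minus_eq)
    then have "2 * (E * L ^ 2 * g') = (2 * M) * g" by (simp only: mult.assoc)
    also have "\<dots> = (2 * (E * L)) * (D * (Q * g))" unfolding 1 by (simp add: algebra_simps)
    finally show ?thesis by (simp add: power2_eq_square mult_ac)
  qed
  have "[:e:] \<noteq> 0" "[:p, q:] \<noteq> 0" using e by auto
  then have "2 * ([:e:] * [:p, q:]) \<noteq> 0" by (simp only: mult_eq_0_iff) simp
  from mult_left_cancel[OF this] ring[OF M[unfolded dK] g[unfolded K]] show ?thesis by blast
qed

lemma weight_of_linear_power:
  assumes K: "Kx = [:e:] * [:p, q:] ^ 2" and e: "e \<noteq> 0" "(p, q) \<noteq> (0, 0)"
    and M: "2 * M = of_nat d * pderiv Kh" and g: "[:p, q:] * pderiv g = of_nat d * ([:q:] * g)"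
  shows "M * g - Kh * pderiv g = of_nat d * g"
proof -
  have dK: "pderiv Kx = [:e:] * (2 * ([:p, q:] * [:q:]))"
    unfolding K by (rule pderiv_const_times_square)
  have ring1: "2 * (E * L ^ 2) = E * L ^ 2 * H' - H * (E * (2 * (L * Q))) \<Longrightarrow>
      (E * L) * (2 * L) = (E * L) * (L * H' - 2 * (Q * H))" for E L H H' Q :: "'a poly"
    by (simp add: algebra_simps power2_eq_square)
  have "[:e:] * [:p, q:] \<noteq> 0" using e by simp
  from mult_left_cancel[OF this] ring1[OF field_brackets(1)[unfolded dK, unfolded K]]
  have rel: "2 * [:p, q:] = [:p, q:] * pderiv Kh - 2 * ([:q:] * Kh)" by blast
  have ring2: "2 * M = D * H' \<Longrightarrow> L * g' = D * (Q * g) \<Longrightarrow> 2 * L = L * H' - 2 * (Q * H) \<Longrightarrow>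
      (2 * L) * (M * g - H * g') = (2 * L) * (D * g)" for D L H H' Q g' :: "'a poly"
  proof -
    assume 1: "2 * M = D * H'" and 2: "L * g' = D * (Q * g)" and 3: "2 * L = L * H' - 2 * (Q * H)"
    have "(2 * L) * (M * g - H * g') = L * ((2 * M) * g) - 2 * (H * (L * g'))"
      by (simp add: algebra_simps)
    also have "\<dots> = (L * H' - 2 * (Q * H)) * (D * g)"
      unfolding 1 2 by (simp add: algebra_simps)
    finally show ?thesis unfolding 3 .
  qed
  have "[:p, q:] \<noteq> 0" using e by auto
  then have "2 * [:p, q:] \<noteq> 0" by (simp only: mult_eq_0_iff) simp
  from mult_left_cancel[OF this] ring2[OF M g rel] show ?thesis by blast
qed

text \<open>
  A form of maximal weight is killed by x.  Since there is a form of weight m > n, its second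
  block, which has weight n, vanishes; its first block is a power of \<ell>.  Applying y
  replaces one factor \<ell> by a linear polynomial \<ell>', and \<ell> \<ell>' is a multiple
  of the vector field of h.  If \<ell>' were a multiple of \<ell>, the vector fields of h and
  x would be proportional and commute.
\<close>

lemma highest_weight_form:
  assumes v: "v \<in> carrier_vec (m + n + 2)" "v \<noteq> 0\<^sub>v (m + n + 2)" "Th *\<^sub>v v = of_int k \<cdot>\<^sub>v v"
    and max: "\<And>k'. eigenvalue Th (of_int k') \<Longrightarrow> k' \<le> k"
  obtains c d p q p' q' where "c \<noteq> 0" "d \<noteq> 0" "p * q' - q * p' \<noteq> 0"
    "v = linear_form m n ([:c:] * [:p, q:] ^ m) 0"
    "Ty *\<^sub>v v = linear_form m n ([:d:] * ([:p, q:] ^ (m - 1) * [:p', q':])) 0"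
proof -
  note dx = covers_vector_fieldD[OF covers_x] and dy = covers_vector_fieldD[OF covers_y]
    and dh = covers_vector_fieldD[OF covers_h]
  obtain e p q where e: "e \<noteq> 0" "(p, q) \<noteq> (0, 0)" and K: "Kx = [:e:] * [:p, q:] ^ 2"
    using eigenfield_is_square[OF dx(2) dh(2) field_brackets(1) Kx_nonzero] by blast
  have dim: "dim_row Th = m + n + 2" using dh(1) by blast
  have dl: "pderiv [:p, q:] = [:q:]" by (simp add: pderiv_pCons)
  have l0: "[:p, q:] \<noteq> 0" using e(2) by auto

  \<comment> \<open>x raises the weight by 2.\<close>
  have xv: "Tx *\<^sub>v v = 0\<^sub>v (m + n + 2)"
  proof (rule ccontr)
    assume nz: "Tx *\<^sub>v v \<noteq> 0\<^sub>v (m + n + 2)"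
    have c: "Tx *\<^sub>v v \<in> carrier_vec (m + n + 2)" by (rule dx(3)[OF v(1)])
    have "Tx *\<^sub>v (Th *\<^sub>v v) = of_int k \<cdot>\<^sub>v (Tx *\<^sub>v v)"
      unfolding v(3) by (rule mult_mat_vec[OF dx(1) v(1)])
    then have "Th *\<^sub>v (Tx *\<^sub>v v) - of_int k \<cdot>\<^sub>v (Tx *\<^sub>v v) = 2 \<cdot>\<^sub>v (Tx *\<^sub>v v)"
      using hx[OF v(1)] by simp
    then have eq: "(Th *\<^sub>v (Tx *\<^sub>v v) - of_int k \<cdot>\<^sub>v (Tx *\<^sub>v v)) $ i = (2 \<cdot>\<^sub>v (Tx *\<^sub>v v)) $ i" for i
      by (rule arg_cong)
    have "Th *\<^sub>v (Tx *\<^sub>v v) = of_int (k + 2) \<cdot>\<^sub>v (Tx *\<^sub>v v)"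
    proof (rule eq_vecI)
      fix i assume "i < dim_vec (of_int (k + 2) \<cdot>\<^sub>v (Tx *\<^sub>v v))"
      then have i: "i < dim_vec (Tx *\<^sub>v v)" "i < dim_vec (of_int k \<cdot>\<^sub>v (Tx *\<^sub>v v))" by simp_all
      show "(Th *\<^sub>v (Tx *\<^sub>v v)) $ i = (of_int (k + 2) \<cdot>\<^sub>v (Tx *\<^sub>v v)) $ i"
        using eq[of i] unfolding index_minus_vec(1)[OF i(2)] index_smult_vec(1)[OF i(1)]
        by (simp add: algebra_simps del: index_mult_mat_vec)
    qed (use dh(3)[OF c] c in \<open>simp del: dim_mult_mat_vec\<close>)
    then have "eigenvector Th (Tx *\<^sub>v v) (of_int (k + 2))"
      unfolding eigenvector_def dim using c nz by blast
    then have "k + 2 \<le> k" by (intro max) (auto simp: eigenvalue_def)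
    then show False by simp
  qed

  have "int m \<le> k"
  proof (rule max)
    define f where "f = [:p, q:] ^ m"
    have deg: "degree f \<le> m"
      unfolding f_def using degree_power_le[of "[:p, q:]" m] by (simp add: order_trans split: if_splits)
    let ?u = "linear_form m n f 0"
    note uc = linear_form_carrier[of m n f 0]
    have g0: "second_block m n ?u = 0" by (rule second_block_linear_form) simp
    have f0: "first_block m ?u = f" by (rule first_block_linear_form[OF deg])
    have "[:p, q:] * pderiv f = of_nat m * ([:q:] * f)"
    proof -
      have "f = [:p, q:] * [:p, q:] ^ (m - 1)" unfolding f_def using nm by (cases m) auto
      moreover have "pderiv f = of_nat m * ([:p, q:] ^ (m - 1) * [:q:])"
        unfolding f_def pderiv_power dl by (simp add: of_nat_poly mult.commute)
      ultimately show ?thesis by (simp only: mult_ac)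
    qed
    then have w: "Mh * f - Kh * pderiv f = of_nat m * f"
      by (rule weight_of_linear_power[OF K e multipliers(1)])
    have mf: "of_nat m * f = Polynomial.smult (of_int (int m)) f" by (simp add: of_nat_poly)
    have "Th *\<^sub>v ?u = of_int (int m) \<cdot>\<^sub>v ?u"
    proof (rule vec_eq_of_blocks[OF dh(3)[OF uc] smult_carrier_vec[THEN iffD2, OF uc]])
      show "first_block m (Th *\<^sub>v ?u) = first_block m (of_int (int m) \<cdot>\<^sub>v ?u)"
        unfolding dh(4)[OF uc g0] first_block_smult[OF uc] f0 w mf ..
      show "second_block m n (Th *\<^sub>v ?u) = second_block m n (of_int (int m) \<cdot>\<^sub>v ?u)"
        unfolding dh(5)[OF uc] second_block_smult[OF uc] g0 by simp
    qed
    moreover have "?u \<noteq> 0\<^sub>v (m + n + 2)"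
    proof
      assume "?u = 0\<^sub>v (m + n + 2)"
      then have "f = first_block m (0\<^sub>v (m + n + 2))" using f0 by simp
      also have "\<dots> = 0" by (rule poly_eqI) (simp add: coeff_first_block)
      finally show False using l0 by (simp add: f_def)
    qed
    ultimately show "eigenvalue Th (of_int (int m))"
      unfolding eigenvalue_def eigenvector_def dim using uc by blast
  qed

  define f where "f = first_block m v"
  define g where "g = second_block m n v"
  have zero: "first_block m (0\<^sub>v (m + n + 2)) = 0" "second_block m n (0\<^sub>v (m + n + 2)) = 0"
    by (auto intro!: poly_eqI simp: coeff_first_block coeff_second_block)
  have g0: "g = 0"
  proof (rule ccontr)
    assume "g \<noteq> 0"
    have "Mx' * g - Kx * pderiv g = 0"
      using dx(5)[OF v(1)] unfolding xv zero g_def by (rule sym)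
    from linear_factor_ode[OF K e multipliers(4) this]
    have "Mh' * g - Kh * pderiv g = of_nat n * g"
      by (rule weight_of_linear_power[OF K e multipliers(2)])
    moreover have "Mh' * g - Kh * pderiv g = Polynomial.smult (of_int k) g"
      using dh(5)[OF v(1)] unfolding v(3) second_block_smult[OF v(1)] g_def by (rule sym)
    ultimately have "Polynomial.smult (of_int (int n)) g = Polynomial.smult (of_int k) g"
      by (simp add: of_nat_poly)
    then have "Polynomial.smult (of_int (int n) - of_int k) g = 0" by (simp add: smult_diff_left)
    then have "(of_int (int n) :: 'a) = of_int k" using \<open>g \<noteq> 0\<close> by simp
    then have "int n = k" by (simp only: of_int_eq_iff)
    then show False using \<open>int m \<le> k\<close> nm by simp
  qed
  note gv = g0[unfolded g_def]
  have "Mx * f - Kx * pderiv f = 0"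
    using dx(4)[OF v(1) gv] unfolding xv zero f_def by (rule sym)
  from linear_factor_ode[OF K e multipliers(3) this]
  have ode: "[:p, q:] * pderiv f = of_nat m * ([:q:] * f)" .
  then obtain c where f: "f = [:c:] * [:p, q:] ^ m"
    using power_of_linear_from_ode[OF e(2)] by blast
  have vf: "v = linear_form m n f 0"
    using linear_form_of_blocks[OF v(1)] unfolding gv f_def by (rule sym)
  have c0: "c \<noteq> 0"
  proof
    assume "c = 0"
    then have "v = linear_form m n 0 0" using vf f by simp
    then have "v = 0\<^sub>v (m + n + 2)" by (auto simp: linear_form_def)
    then show False using v(2) by simp
  qed

  define L where "L = [:p, q:] * pderiv Ky - 2 * ([:q:] * Ky)"
  have "degree L \<le> 1"
  proof (rule degree_le, intro allI impI)
    fix i :: nat assume i: "1 < i"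
    have K3: "coeff Ky (Suc (Suc (Suc j))) = 0" for j using dy(2) by (intro coeff_eq_0) simp
    define j where "j = i - 2"
    have j: "i = Suc (Suc j)" using i by (simp add: j_def)
    show "coeff L i = 0"
      unfolding L_def j by (cases j) (simp_all add: coeff_pderiv coeff_pCons numeral_poly K3 numeral_2_eq_2)
  qed
  then obtain p' q' where L: "L = [:p', q':]"
  proof -
    assume *: "\<And>p' q'. L = [:p', q':] \<Longrightarrow> thesis"
    have "L = [:coeff L 0, coeff L 1:]"
    proof (rule poly_eqI)
      fix i
      show "coeff L i = coeff [:coeff L 0, coeff L 1:] i"
        using coeff_eq_0[of L i] \<open>degree L \<le> 1\<close>
        by (cases "i = 0 \<or> i = 1") (auto simp: coeff_pCons split: nat.split)
    qed
    then show thesis by (rule *)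
  qed
  have Kh: "Kh = - ([:e:] * ([:p, q:] * L))"
  proof -
    have dK: "pderiv Kx = [:e:] * (2 * ([:p, q:] * [:q:]))"
      unfolding K by (rule pderiv_const_times_square)
    have ring: "Y * (E * (2 * (A * Q))) - E * A ^ 2 * Y' = - (E * (A * (A * Y' - 2 * (Q * Y))))"
      for Y E A Q Y' :: "'a poly" by (simp add: algebra_simps power2_eq_square)
    show ?thesis using field_brackets(3) unfolding dK unfolding K L_def ring .
  qed
  have det: "p * q' - q * p' \<noteq> 0"
  proof
    assume det: "p * q' - q * p' = 0"
    obtain r where r: "L = [:r:] * [:p, q:]"
    proof (cases "p = 0")
      case True
      then show ?thesis using e(2) det that[of "q' / q"] by (auto simp: L)
    next
      case False
      then show ?thesis using det that[of "p' / p"] by (auto simp: L field_simps)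
    qed
    have ring: "E * A ^ 2 * (- (E * (R * (2 * (A * Q))))) - (- (E * (A * (R * A)))) * (E * (2 * (A * Q))) = 0"
      for E A R Q :: "'a poly" by (simp add: algebra_simps power2_eq_square)
    have dK: "pderiv Kx = [:e:] * (2 * ([:p, q:] * [:q:]))"
      unfolding K by (rule pderiv_const_times_square)
    have dH: "pderiv Kh = - ([:e:] * ([:r:] * (2 * ([:p, q:] * [:q:]))))"
      
    proof -
      have "Kh = [:- e * r:] * [:p, q:] ^ 2" unfolding Kh r by (simp add: power2_eq_square)
      from this[THEN arg_cong[where f = pderiv], unfolded pderiv_const_times_square]
      show ?thesis by (simp add: mult.commute)
    qed
    have "2 * Kx = 0"
      using field_brackets(1) unfolding dK dH unfolding K Kh r ring .
    then show False using Kx_nonzero by simp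
  qed
  have w: "Ty *\<^sub>v v = linear_form m n ([:c * of_nat m / 2:] * ([:p, q:] ^ (m - 1) * L)) 0"
  proof -
    let ?P = "[:p, q:] ^ (m - 1)"
    have fP: "f = [:c:] * ([:p, q:] * ?P)" unfolding f using nm by (cases m) auto
    have ring: "2 * M = D * Y' \<Longrightarrow> A * F' = D * (Q * (C * (A * P))) \<Longrightarrow>
      (2 * A) * (M * (C * (A * P)) - Y * F') = (2 * A) * (H * (C * D) * (P * (A * Y' - 2 * (Q * Y))))"
      if "2 * H = 1" for M D Y' A F' Q C P Y H :: "'a poly"
    proof -
      assume 1: "2 * M = D * Y'" and 2: "A * F' = D * (Q * (C * (A * P)))"
      have "(2 * A) * (M * (C * (A * P)) - Y * F') = (2 * M) * (A * (C * (A * P))) - 2 * (Y * (A * F'))"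
        by (simp add: algebra_simps)
      also have "\<dots> = 1 * (A * (C * D) * (P * (A * Y' - 2 * (Q * Y))))"
        unfolding 1 2 by (simp add: algebra_simps)
      also have "\<dots> = (2 * A) * (H * (C * D) * (P * (A * Y' - 2 * (Q * Y))))"
        unfolding that[symmetric] by (simp add: mult_ac)
      finally show ?thesis .
    qed
    have "2 * [:1 / 2 :: 'a:] = 1" by (simp add: numeral_poly one_pCons)
    from ring[OF this multipliers(5) ode[unfolded fP]]
    have "(2 * [:p, q:]) * (My * f - Ky * pderiv f)
        = (2 * [:p, q:]) * ([:1 / 2:] * ([:c:] * of_nat m) * (?P * L))"
      unfolding L_def fP .
    moreover have "2 * [:p, q:] \<noteq> 0" using l0 by (simp only: mult_eq_0_iff) simp
    ultimately have "My * f - Ky * pderiv f = [:1 / 2:] * ([:c:] * of_nat m) * (?P * L)"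
      by (metis mult_left_cancel)
    also have "[:1 / 2:] * ([:c:] * of_nat m) = [:c * of_nat m / 2:]"
      by (simp add: of_nat_poly)
    finally have fw: "first_block m (Ty *\<^sub>v v) = [:c * of_nat m / 2:] * (?P * L)"
      using dy(4)[OF v(1) gv] unfolding f_def by (rule trans[rotated])
    have gw: "second_block m n (Ty *\<^sub>v v) = 0"
      using dy(5)[OF v(1)] unfolding gv by simp
    from linear_form_of_blocks[OF dy(3)[OF v(1)]] show ?thesis unfolding fw gw by (rule sym)
  qed
  have d0: "c * of_nat m / 2 \<noteq> 0" using c0 nm by simp
  show ?thesis by (rule that[OF c0 d0 det vf[unfolded f] w[unfolded L]])
qed

end

section \<open>The fibres of the quotient map\<close>

definition homogenize :: "nat \<Rightarrow> 'a::field poly \<Rightarrow> 'a \<Rightarrow> 'a \<Rightarrow> 'a" where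
  "homogenize d f s0 s1 = (\<Sum>i\<le>d. coeff f i * (s0 ^ (d - i) * s1 ^ i))"

lemma homogenize_affine:
  assumes "s0 \<noteq> 0" "degree f \<le> d"
  shows "homogenize d f s0 s1 = s0 ^ d * poly f (s1 / s0)"
proof -
  have val: "poly f (s1 / s0) = (\<Sum>i\<le>d. coeff f i * (s1 / s0) ^ i)"
    unfolding poly_altdef using assms(2)
    by (intro sum.mono_neutral_left) (auto simp: coeff_eq_0)
  have summand: "s0 ^ d * (coeff f i * (s1 / s0) ^ i) = coeff f i * (s0 ^ (d - i) * s1 ^ i)" if "i \<le> d" for i
  proof -
    have "s0 ^ d = s0 ^ (d - i) * s0 ^ i" using that by (simp flip: power_add)
    then show ?thesis using assms(1) by (simp add: power_divide)
  qed
  show ?thesis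
    unfolding homogenize_def val sum_distrib_left
    by (rule sum.cong[OF refl]) (simp only: atMost_iff summand)
qed

lemma homogenize_infinity: "homogenize d f 0 s1 = coeff f d * s1 ^ d"
proof -
  have "homogenize d f 0 s1 = (\<Sum>i\<le>d. if i = d then coeff f d * s1 ^ d else 0)"
    unfolding homogenize_def by (intro sum.cong) (auto simp: power_0_left)
  then show ?thesis by simp
qed

lemma homogenize_mult:
  assumes f: "degree f \<le> d" and g: "degree g \<le> e"
  shows "homogenize (d + e) (f * g) s0 s1 = homogenize d f s0 s1 * homogenize e g s0 s1"
proof (cases "s0 = 0")
  case False
  have "degree (f * g) \<le> d + e" using degree_mult_le[of f g] f g by linarith
  then show ?thesis
    using False f g by (simp add: homogenize_affine power_add)
next
  case True
  have "coeff (f * g) (d + e) = coeff f d * coeff g e"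
  proof (cases "degree f = d \<and> degree g = e")
    case True
    then show ?thesis using coeff_mult_degree_sum[of f g] by simp
  next
    case False
    then have "degree f < d \<or> degree g < e" using f g by linarith
    moreover have "degree (f * g) < d + e" using False degree_mult_le[of f g] f g by linarith
    ultimately show ?thesis by (auto simp: coeff_eq_0)
  qed
  then show ?thesis using True by (simp add: homogenize_infinity power_add)
qed

lemma homogenize_linear: "homogenize 1 [:p, q:] s0 s1 = p * s0 + q * s1"
  by (simp add: homogenize_def)

lemma homogenize_const: "homogenize 0 [:c:] s0 s1 = c"
  by (simp add: homogenize_def)

lemma degree_linear_power_le: "degree ([:p, q:] ^ k) \<le> k"
proof -
  have "degree ([:p, q:] ^ k) \<le> degree [:p, q:] * k" by (rule degree_power_le)
  also have "\<dots> \<le> 1 * k" by (intro mult_right_mono) auto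
  finally show ?thesis by simp
qed

lemma homogenize_linear_power: "homogenize k ([:p, q:] ^ k) s0 s1 = (p * s0 + q * s1) ^ k"
proof (induction k)
  case 0
  show ?case by (simp add: homogenize_def)
next
  case (Suc k)
  have "degree [:p, q:] \<le> 1" by simp
  from homogenize_mult[OF this degree_linear_power_le[of p q k], of s0 s1] show ?case
    using Suc by (simp only: homogenize_linear power_Suc plus_1_eq_Suc)
qed

lemma homogenize_linear_times_power:
  assumes "m \<ge> 1"
  shows "homogenize m ([:c:] * ([:r0, r1:] ^ (m - 1) * [:p, q:])) s0 s1
      = c * ((r0 * s0 + r1 * s1) ^ (m - 1) * (p * s0 + q * s1))"
    and "degree ([:c:] * ([:r0, r1:] ^ (m - 1) * [:p, q:])) \<le> m"
proof -
  have m: "m = 0 + ((m - 1) + 1)" using assms by simp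
  have l: "degree [:p, q:] \<le> 1" by simp
  have "degree ([:r0, r1:] ^ (m - 1) * [:p, q:]) \<le> (m - 1) + 1"
    using degree_mult_le[of "[:r0, r1:] ^ (m - 1)" "[:p, q:]"] degree_linear_power_le[of r0 r1 "m - 1"] l
    by linarith
  moreover from this show "degree ([:c:] * ([:r0, r1:] ^ (m - 1) * [:p, q:])) \<le> m"
    using assms degree_smult_le[of c "[:r0, r1:] ^ (m - 1) * [:p, q:]"]
    by (simp only: mult_pCons_left mult_zero_left pCons_0_0 add_0_right)
  moreover have "degree [:c:] \<le> 0" by simp
  ultimately have "homogenize (0 + ((m - 1) + 1)) ([:c:] * ([:r0, r1:] ^ (m - 1) * [:p, q:])) s0 s1
      = c * ((r0 * s0 + r1 * s1) ^ (m - 1) * (p * s0 + q * s1))"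
    using homogenize_mult[OF degree_linear_power_le[of r0 r1 "m - 1"] l]
    by (simp only: homogenize_mult homogenize_const homogenize_linear_power homogenize_linear)
  then show "homogenize m ([:c:] * ([:r0, r1:] ^ (m - 1) * [:p, q:])) s0 s1
      = c * ((r0 * s0 + r1 * s1) ^ (m - 1) * (p * s0 + q * s1))"
    using assms by simp
qed

lemma linear_form_scroll_point:
  "linear_form m n f 0 \<bullet> scroll_point m n a b s0 s1 = a * homogenize m f s0 s1"
proof -
  have "linear_form m n f 0 \<bullet> scroll_point m n a b s0 s1
      = (\<Sum>i<m + n + 2. linear_form m n f 0 $ i * scroll_point m n a b s0 s1 $ i)"
    by (rule scalar_prod_eq_sum[OF scroll_point_carrier])
  also have "\<dots> = (\<Sum>i\<le>m. coeff f i * (a * (s0 ^ (m - i) * s1 ^ i)))"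
    unfolding sum_blocks by (simp add: linear_form_def scroll_point_def scroll_coord_def)
  finally show ?thesis by (simp add: homogenize_def sum_distrib_left mult_ac)
qed

lemma pair_proj_pt_smult:
  fixes k :: "'a::field"
  assumes "k \<noteq> 0"
  shows "proj_pt (vec_of_list [k * u, k * u']) = proj_pt (vec_of_list [u, u'])"
proof -
  have "vec_of_list [k * u, k * u'] = k \<cdot>\<^sub>v vec_of_list [u, u']"
    by (rule eq_vecI) (auto simp: vec_of_list_index less_Suc_eq simp del: vec_of_list_Cons)
  then show ?thesis by (simp only: proj_pt_smult[OF assms])
qed

lemma pair_proj_pt_eqD:
  fixes u :: "'a::field"
  assumes "proj_pt (vec_of_list [u, u']) = proj_pt (vec_of_list [t, t'])"
  shows "u * t' = t * u'"
proof -
  have "vec_of_list [u, u'] \<in> proj_pt (vec_of_list [t, t'])"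
    using proj_pt_self[of "vec_of_list [u, u']"] assms by simp
  then obtain k where eq: "vec_of_list [u, u'] = k \<cdot>\<^sub>v vec_of_list [t, t']"
    unfolding mem_proj_pt_iff by blast
  have "vec_of_list [u, u'] $ i = k * vec_of_list [t, t'] $ i" if "i < 2" for i
    using arg_cong[OF eq, of "\<lambda>v. v $ i"] that by (simp del: vec_of_list_Cons)
  from this[of 0] this[of 1] show ?thesis
    by (simp add: vec_of_list_index del: vec_of_list_Cons)
qed

text \<open>
  On the point with parameters a, b over s the two forms take the values
  c a \<ell>(s)^m and d a \<ell>(s)^(m-1) \<ell>'(s), so their quotient is a coordinate on
  the projective line.  Where a \<noteq> 0 it is also the quotient of two linear forms
  without common zero: replace the common factor \<ell>^(m-1) by \<mu>^(m-1) with a linear form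
  \<mu> nonvanishing at s.  Conversely, an identity F c \<ell> = d \<ell>' G that holds where v is
  nonzero holds on the whole scroll, by density.
\<close>

lemma quotient_map_fiber_eq_line:
  fixes g :: "'a::field_char_0 mat"
  assumes N: "N = m + n + 2" and m: "m \<ge> 1" and g: "g \<in> GL N" and X: "X = proj_map g ` scroll m n"
    and v: "\<And>q. q \<in> carrier_vec N \<Longrightarrow>
      v \<bullet> (g *\<^sub>v q) = linear_form m n ([:c:] * ([:p, q0:] ^ (m - 1) * [:p, q0:])) 0 \<bullet> q"
    and w: "\<And>q. q \<in> carrier_vec N \<Longrightarrow>
      w \<bullet> (g *\<^sub>v q) = linear_form m n ([:d:] * ([:p, q0:] ^ (m - 1) * [:p', q':])) 0 \<bullet> q"
    and c: "c \<noteq> 0" and d: "d \<noteq> 0" and det: "p * q' - q0 * p' \<noteq> 0" and s: "(s0, s1) \<noteq> (0, 0)"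
  shows "quotient_map_fiber X N w v
      (proj_pt (vec_of_list [d * (p' * s0 + q' * s1), c * (p * s0 + q0 * s1)]))
    = proj_map g ` line_over m n s0 s1"
proof -
  define L where "L t0 t1 = p * t0 + q0 * t1" for t0 t1
  define L' where "L' t0 t1 = p' * t0 + q' * t1" for t0 t1
  obtain g' where g': "g' \<in> carrier_mat N N" "g * g' = 1\<^sub>m N" "g' * g = 1\<^sub>m N"
    using GL_inverse[OF g] by metis
  have gc: "g \<in> carrier_mat N N" using g by (simp add: GL_def)
  have sc: "scroll_point m n a b t0 t1 \<in> carrier_vec N" for a b t0 t1
    unfolding N by (rule scroll_point_carrier)
  have sx: "scroll_point m n a b t0 t1 $ j = scroll_coord m n a b t0 t1 j" if "j < N" for a b t0 t1 j
    using that scroll_point_index[of j m n a b t0 t1] by (simp add: N)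
  have gp: "proj_map g (proj_pt (scroll_point m n a b t0 t1)) = proj_pt (g *\<^sub>v scroll_point m n a b t0 t1)"
    for a b t0 t1 by (rule proj_map_proj_pt[OF gc sc])
  have v_at: "v \<bullet> (g *\<^sub>v scroll_point m n a b t0 t1) = a * (c * (L t0 t1 ^ (m - 1) * L t0 t1))" for a b t0 t1
    unfolding v[OF sc] linear_form_scroll_point homogenize_linear_times_power(1)[OF m] L_def ..
  have w_at: "w \<bullet> (g *\<^sub>v scroll_point m n a b t0 t1) = a * (d * (L t0 t1 ^ (m - 1) * L' t0 t1))" for a b t0 t1
    unfolding w[OF sc] linear_form_scroll_point homogenize_linear_times_power(1)[OF m] L_def L'_def ..
  have on_X: "\<exists>a b t0 t1. q = g *\<^sub>v scroll_point m n a b t0 t1 \<and> (t0, t1) \<noteq> (0, 0) \<and> (a, b) \<noteq> (0, 0)"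
    if "Q \<in> X" "q \<in> Q" for Q q
  proof -
    obtain P where P: "P \<in> scroll m n" "Q = proj_map g P" using \<open>Q \<in> X\<close> unfolding X by blast
    then obtain r where r: "r \<in> P" "q = g *\<^sub>v r" using \<open>q \<in> Q\<close> unfolding proj_map_def by blast
    show ?thesis using scroll_member_on_line[OF P(1) r(1)] unfolding r(2) by metis
  qed
  have in_X: "proj_pt (g *\<^sub>v scroll_point m n a b t0 t1) \<in> X" if "(t0, t1) \<noteq> (0, 0)" "(a, b) \<noteq> (0, 0)"
    for a b t0 t1
    unfolding X gp[symmetric] by (rule imageI) (rule scroll_point_in_scroll[OF that])
  have nz: "(d * L' t0 t1, c * L t0 t1) \<noteq> (0, 0)" if "(t0, t1) \<noteq> (0, 0)" for t0 t1
  proof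
    assume "(d * L' t0 t1, c * L t0 t1) = (0, 0)"
    then have L0: "L t0 t1 = 0" "L' t0 t1 = 0" using c d by auto
    have "(p * q' - q0 * p') * t0 = q' * L t0 t1 - q0 * L' t0 t1"
      "(p * q' - q0 * p') * t1 = p * L' t0 t1 - p' * L t0 t1"
      unfolding L_def L'_def by (simp_all add: algebra_simps)
    then show False using L0 det that by simp
  qed
  let ?c = "proj_pt (vec_of_list [d * L' s0 s1, c * L s0 s1])"
  let ?T = "{P. quotient_map_value X N w v P ?c}"
  have "zariski_closure N ?T = proj_map g ` line_over m n s0 s1"
  proof (rule zariski_closure_eq_line[OF N g s])
    fix a b :: 'a assume a: "a \<noteq> 0"
    have "\<exists>r0 r1. r0 * s0 + r1 * s1 \<noteq> 0"
    proof (cases "s0 = 0")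
      case True
      then have "0 * s0 + 1 * s1 \<noteq> 0" using s by simp
      then show ?thesis by blast
    next
      case False
      then have "1 * s0 + 0 * s1 \<noteq> 0" by simp
      then show ?thesis by blast
    qed
    then obtain r0 r1 where r: "r0 * s0 + r1 * s1 \<noteq> 0" by blast
    define \<phi> where "\<phi> = linear_form m n ([:d:] * ([:r0, r1:] ^ (m - 1) * [:p', q':])) 0"
    define \<psi> where "\<psi> = linear_form m n ([:c:] * ([:r0, r1:] ^ (m - 1) * [:p, q0:])) 0"
    \<comment> \<open>The linear form l on the scroll, transported to X.\<close>
    define pull where "pull l x = (\<Sum>i<N. l $ i * (\<Sum>j<N. g' $$ (i, j) * x j))"
      for l :: "'a vec" and x :: "nat \<Rightarrow> 'a"
    have pull_form: "form_fun {..<N} 1 (pull l)" for l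
    proof -
      have "pull l = (\<lambda>x. \<Sum>i<N. \<Sum>j<N. (l $ i * g' $$ (i, j)) * x j)"
        by (auto simp: pull_def sum_distrib_left mult_ac)
      then show ?thesis by (simp only:) (intro form_fun_sum form_fun_coord, simp)
    qed
    have pull_at: "pull l (\<lambda>i. (g *\<^sub>v scroll_point m n a b t0 t1) $ i) = l \<bullet> scroll_point m n a b t0 t1"
      for l a b t0 t1
    proof -
      have "(\<Sum>j<N. g' $$ (i, j) * (g *\<^sub>v scroll_point m n a b t0 t1) $ j) = scroll_point m n a b t0 t1 $ i"
        if "i < N" for i
        using mat_vec_eq_sum[OF g'(1) mult_mat_vec_carrier[OF gc sc] that]
        unfolding mat_vec_cancel[OF g'(1) gc g'(3) sc] by (rule sym)
      then show ?thesis unfolding pull_def scalar_prod_eq_sum[OF sc] by (intro sum.cong) auto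
    qed
    obtain F where F: "homogeneous {..<N} 1 F" "\<And>x. peval F x = pull \<phi> x"
      using form_funE[OF pull_form] by blast
    obtain G where G: "homogeneous {..<N} 1 G" "\<And>x. peval G x = pull \<psi> x"
      using form_funE[OF pull_form] by blast
    have F_at: "peval F (\<lambda>i. (g *\<^sub>v scroll_point m n a b t0 t1) $ i)
        = a * (d * ((r0 * t0 + r1 * t1) ^ (m - 1) * L' t0 t1))" for a b t0 t1
      unfolding F(2) pull_at \<phi>_def linear_form_scroll_point homogenize_linear_times_power(1)[OF m] L'_def ..
    have G_at: "peval G (\<lambda>i. (g *\<^sub>v scroll_point m n a b t0 t1) $ i)
        = a * (c * ((r0 * t0 + r1 * t1) ^ (m - 1) * L t0 t1))" for a b t0 t1
      unfolding G(2) pull_at \<psi>_def linear_form_scroll_point homogenize_linear_times_power(1)[OF m] L_def ..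
    let ?q = "g *\<^sub>v scroll_point m n a b s0 s1"
    have FG: "peval F (\<lambda>i. q $ i) * (v \<bullet> q) = (w \<bullet> q) * peval G (\<lambda>i. q $ i)"
      if Q: "Q \<in> X" "q \<in> Q" for Q q
    proof -
      obtain a b t0 t1 where q: "q = g *\<^sub>v scroll_point m n a b t0 t1" using on_X[OF Q] by blast
      show ?thesis unfolding q F_at G_at v_at w_at by (simp add: mult_ac)
    qed
    define k where "k = a * (r0 * s0 + r1 * s1) ^ (m - 1)"
    have k: "k \<noteq> 0" using a r by (simp add: k_def)
    have Fk: "peval F (\<lambda>i. ?q $ i) = k * (d * L' s0 s1)" and Gk: "peval G (\<lambda>i. ?q $ i) = k * (c * L s0 s1)"
      unfolding F_at G_at k_def by (simp_all add: mult_ac)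
    have ne: "(peval F (\<lambda>i. ?q $ i), peval G (\<lambda>i. ?q $ i)) \<noteq> (0, 0)"
      unfolding Fk Gk using nz[OF s] k by simp
    have val: "?c = proj_pt (vec_of_list [peval F (\<lambda>i. ?q $ i), peval G (\<lambda>i. ?q $ i)])"
      unfolding Fk Gk pair_proj_pt_smult[OF k] ..
    have "proj_pt ?q \<in> X" by (rule in_X[OF s]) (use a in simp)
    then show "proj_pt ?q \<in> ?T"
      unfolding quotient_map_value_def mem_Collect_eq
      using F(1) G(1) FG ne val proj_pt_self[of ?q] by blast
  next
    show "?T \<subseteq> proj_map g ` line_over m n s0 s1"
    proof
      fix P assume "P \<in> ?T"
      then obtain e F G q where PX: "P \<in> X" and F: "homogeneous {..<N} e F" and G: "homogeneous {..<N} e G"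
        and FG: "\<And>Q q. Q \<in> X \<Longrightarrow> q \<in> Q \<Longrightarrow> v \<bullet> q \<noteq> 0 \<Longrightarrow>
          peval F (\<lambda>i. q $ i) * (v \<bullet> q) = (w \<bullet> q) * peval G (\<lambda>i. q $ i)"
        and q: "q \<in> P" and ne: "(peval F (\<lambda>i. q $ i), peval G (\<lambda>i. q $ i)) \<noteq> (0, 0)"
        and val: "?c = proj_pt (vec_of_list [peval F (\<lambda>i. q $ i), peval G (\<lambda>i. q $ i)])"
        unfolding quotient_map_value_def mem_Collect_eq by metis
      obtain a b t0 t1 where qt: "q = g *\<^sub>v scroll_point m n a b t0 t1"
        and t: "(t0, t1) \<noteq> (0, 0)" and ab: "(a, b) \<noteq> (0, 0)" using on_X[OF PX q] by blast
      \<comment> \<open>A direction of motion in the parameters along which \<ell> is not constantly zero.\<close>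
      obtain r0 r1 where r: "L r0 r1 \<noteq> 0"
      proof (cases "p = 0")
        case True
        then show ?thesis using det that[of 0 1] by (auto simp: L_def)
      next
        case False
        then show ?thesis using that[of 1 0] by (simp add: L_def)
      qed
      define y where "y \<tau> i = (\<Sum>j<N. g $$ (i, j) *
          scroll_coord m n (a + \<tau>) b (t0 + \<tau> * r0) (t1 + \<tau> * r1) j)" for \<tau> i
      have y: "peval H (\<lambda>i. (g *\<^sub>v scroll_point m n (a + \<tau>) b (t0 + \<tau> * r0) (t1 + \<tau> * r1)) $ i)
          = peval H (y \<tau>)" if "homogeneous {..<N} e H" for H \<tau>
        unfolding y_def by (rule peval_cong[OF that])
          (simp add: mat_vec_eq_sum[OF gc sc] sx del: index_mult_mat_vec)
      have L_add: "L (t0 + \<tau> * r0) (t1 + \<tau> * r1) = L t0 t1 + \<tau> * L r0 r1" for \<tau>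
        by (simp add: L_def algebra_simps)
      have L'_add: "L' (t0 + \<tau> * r0) (t1 + \<tau> * r1) = L' t0 t1 + \<tau> * L' r0 r1" for \<tau>
        by (simp add: L'_def algebra_simps)
      have "\<exists>\<tau>1. \<tau>1 \<notin> {- a, - L t0 t1 / L r0 r1}"
        by (rule ex_new_if_finite[OF infinite_UNIV_char_0]) simp
      then obtain \<tau>1 where "\<tau>1 \<notin> {- a, - L t0 t1 / L r0 r1}" by blast
      then have "\<tau>1 \<noteq> - a" and ne1: "\<tau>1 \<noteq> - L t0 t1 / L r0 r1" by auto
      have "L t0 t1 + \<tau>1 * L r0 r1 \<noteq> 0"
      proof
        assume "L t0 t1 + \<tau>1 * L r0 r1 = 0"
        then have "\<tau>1 * L r0 r1 = - L t0 t1" by (simp add: add_eq_0_iff)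
        then have "\<tau>1 = - L t0 t1 / L r0 r1" using r by (simp only: nonzero_eq_divide_eq[OF r])
        then show False using ne1 by simp
      qed
      moreover have "a + \<tau>1 \<noteq> 0" using \<open>\<tau>1 \<noteq> - a\<close> by (auto simp: add_eq_0_iff)
      ultimately have \<tau>1: "(a + \<tau>1) * (L t0 t1 + \<tau>1 * L r0 r1) \<noteq> 0" by simp
      have "peval F (y 0) * (c * (L t0 t1 + 0 * L r0 r1)) - d * (L' t0 t1 + 0 * L' r0 r1) * peval G (y 0) = 0"
      proof (rule poly_fun_zero_by_density[where \<tau> = 0 and E = "\<lambda>\<tau>. (a + \<tau>) * (L t0 t1 + \<tau> * L r0 r1)"
            and D = "\<lambda>\<tau>. peval F (y \<tau>) * (c * (L t0 t1 + \<tau> * L r0 r1))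
              - d * (L' t0 t1 + \<tau> * L' r0 r1) * peval G (y \<tau>)"])
        show "poly_fun (\<lambda>\<tau>. peval F (y \<tau>) * (c * (L t0 t1 + \<tau> * L r0 r1))
              - d * (L' t0 t1 + \<tau> * L' r0 r1) * peval G (y \<tau>))"
          unfolding y_def by (intro poly_fun_intros poly_fun_peval poly_fun_scroll_coord)
        show "poly_fun (\<lambda>\<tau>. (a + \<tau>) * (L t0 t1 + \<tau> * L r0 r1))" by (intro poly_fun_intros)
        show "(a + \<tau>1) * (L t0 t1 + \<tau>1 * L r0 r1) \<noteq> 0" by (rule \<tau>1)
      next
        fix \<tau> assume E: "(a + \<tau>) * (L t0 t1 + \<tau> * L r0 r1) \<noteq> 0"
        let ?u0 = "t0 + \<tau> * r0" and ?u1 = "t1 + \<tau> * r1"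
        let ?z = "g *\<^sub>v scroll_point m n (a + \<tau>) b ?u0 ?u1"
        have a\<tau>: "a + \<tau> \<noteq> 0" and Lu: "L ?u0 ?u1 \<noteq> 0" using E by (auto simp: L_add)
        have u: "(?u0, ?u1) \<noteq> (0, 0)" using Lu by (auto simp: L_def)
        have "v \<bullet> ?z \<noteq> 0" unfolding v_at using a\<tau> Lu c by simp
        from FG[OF in_X[OF u] proj_pt_self this]
        have "peval F (y \<tau>) * ((a + \<tau>) * (c * (L ?u0 ?u1 ^ (m - 1) * L ?u0 ?u1)))
            = (a + \<tau>) * (d * (L ?u0 ?u1 ^ (m - 1) * L' ?u0 ?u1)) * peval G (y \<tau>)"
          using a\<tau> unfolding v_at w_at y[OF F] y[OF G] by simp
        then have "((a + \<tau>) * L ?u0 ?u1 ^ (m - 1)) * (peval F (y \<tau>) * (c * L ?u0 ?u1))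
            = ((a + \<tau>) * L ?u0 ?u1 ^ (m - 1)) * (d * L' ?u0 ?u1 * peval G (y \<tau>))"
          by (simp only: mult_ac)
        moreover have "(a + \<tau>) * L ?u0 ?u1 ^ (m - 1) \<noteq> 0" using a\<tau> Lu by simp
        ultimately have "peval F (y \<tau>) * (c * L ?u0 ?u1) = d * L' ?u0 ?u1 * peval G (y \<tau>)"
          by (metis mult_left_cancel)
        then show "peval F (y \<tau>) * (c * (L t0 t1 + \<tau> * L r0 r1))
            - d * (L' t0 t1 + \<tau> * L' r0 r1) * peval G (y \<tau>) = 0"
          unfolding L_add L'_add by simp
      qed
      moreover have "peval H (y 0) = peval H (\<lambda>i. q $ i)" if "homogeneous {..<N} e H" for H
        using y[OF that, of 0] by (simp add: qt)
      ultimately have cross: "peval F (\<lambda>i. q $ i) * (c * L t0 t1) = d * L' t0 t1 * peval G (\<lambda>i. q $ i)"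
        using F G by simp
      have "d * L' s0 s1 * peval G (\<lambda>i. q $ i) = peval F (\<lambda>i. q $ i) * (c * L s0 s1)"
        by (rule pair_proj_pt_eqD[OF val])
      \<comment> \<open>Both pairs are proportional to (F : G) at q, hence to each other.\<close>
      with cross have "(d * L' s0 s1) * (c * L t0 t1) = (d * L' t0 t1) * (c * L s0 s1)"
      proof (cases "peval G (\<lambda>i. q $ i) = 0")
        case True
        then have F0: "peval F (\<lambda>i. q $ i) \<noteq> 0" using ne by simp
        then have "L t0 t1 = 0" "L s0 s1 = 0"
          using cross \<open>d * L' s0 s1 * peval G (\<lambda>i. q $ i) = _\<close> True c by simp_all
        then show ?thesis by simp
      next
        case False
        have "peval G (\<lambda>i. q $ i) * ((d * L' s0 s1) * (c * L t0 t1))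
            = (d * L' s0 s1 * peval G (\<lambda>i. q $ i)) * (c * L t0 t1)" by (simp only: mult_ac)
        also have "\<dots> = (peval F (\<lambda>i. q $ i) * (c * L t0 t1)) * (c * L s0 s1)"
          unfolding \<open>d * L' s0 s1 * peval G (\<lambda>i. q $ i) = _\<close> by (simp only: mult_ac)
        also have "\<dots> = peval G (\<lambda>i. q $ i) * ((d * L' t0 t1) * (c * L s0 s1))"
          unfolding cross by (simp only: mult_ac)
        finally show ?thesis using False by (metis mult_left_cancel)
      qed
      then have "(d * c) * (L' s0 s1 * L t0 t1 - L' t0 t1 * L s0 s1) = 0" by (simp add: algebra_simps)
      then have "L' s0 s1 * L t0 t1 - L' t0 t1 * L s0 s1 = 0" using c d by simp
      moreover have "L' s0 s1 * L t0 t1 - L' t0 t1 * L s0 s1 = (p * q' - q0 * p') * (s1 * t0 - s0 * t1)"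
        by (simp add: L_def L'_def algebra_simps)
      ultimately have st: "s1 * t0 = s0 * t1" using det by simp
      have "\<exists>k. k \<noteq> 0 \<and> t0 = k * s0 \<and> t1 = k * s1"
      proof (cases "s0 = 0")
        case True
        then have "t0 = 0" "s1 \<noteq> 0" using s st by auto
        then show ?thesis using True t by (intro exI[of _ "t1 / s1"]) auto
      next
        case False
        then have "t1 = t0 / s0 * s1" using st by (simp add: field_simps)
        moreover from this have "t0 \<noteq> 0" using t by auto
        ultimately show ?thesis using False by (intro exI[of _ "t0 / s0"]) auto
      qed
      then obtain k where k: "k \<noteq> 0" "t0 = k * s0" "t1 = k * s1" by blast
      obtain P0 where P0: "P0 \<in> scroll m n" "P = proj_map g P0" using PX unfolding X by blast
      then obtain z where z: "z \<in> P0" "q = g *\<^sub>v z" using q unfolding proj_map_def by blast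
      have "P0 \<in> proj_space N"
        using P0(1) zariski_closure_subset_proj_space unfolding scroll_def N by blast
      note zc = proj_space_memD[OF this z(1)]
      have "z = scroll_point m n a b t0 t1"
        using mat_vec_cancel[OF g'(1) gc g'(3) zc(1)] mat_vec_cancel[OF g'(1) gc g'(3) sc] z(2) qt
        by metis
      then have "P = proj_map g (proj_pt (scroll_point m n a b t0 t1))" using P0(2) zc(3) by simp
      moreover have "proj_pt (scroll_point m n a b t0 t1) \<in> line_over m n s0 s1"
        using scroll_point_on_line[OF ab] line_over_scale_params[OF k(1)] unfolding k(2,3) by blast
      ultimately show "P \<in> proj_map g ` line_over m n s0 s1" by blast
    qed
  qed
  moreover have "proj_map g ` line_over m n s0 s1 \<subseteq> X"
    unfolding X by (rule image_mono) (rule line_over_subset_scroll[OF s])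
  ultimately show ?thesis
    unfolding quotient_map_fiber_def closure_in_def L_def L'_def by blast
qed

section \<open>Lie algebra representations on linear forms\<close>

lemma dual_action_carrier: "A \<in> carrier_mat N N \<Longrightarrow> dual_action A \<in> carrier_mat N N"
  by (simp add: dual_action_def)

lemma dual_action_bracket:
  fixes A C :: "'a::field mat"
  assumes A: "A \<in> carrier_mat N N" and C: "C \<in> carrier_mat N N" and l: "l \<in> carrier_vec N"
  shows "dual_action A *\<^sub>v (dual_action C *\<^sub>v l) - dual_action C *\<^sub>v (dual_action A *\<^sub>v l)
    = dual_action (lie_bracket A C) *\<^sub>v l"
proof -
  let ?a = "transpose_mat A" and ?c = "transpose_mat C"
  have a: "?a \<in> carrier_mat N N" and c: "?c \<in> carrier_mat N N" using A C by simp_all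
  have "dual_action A * dual_action C = ?a * ?c" "dual_action C * dual_action A = ?c * ?a"
    using a c by (simp_all add: dual_action_def)
  moreover have "dual_action (lie_bracket A C) = ?a * ?c - ?c * ?a"
  proof -
    have "transpose_mat (lie_bracket A C) = ?c * ?a - ?a * ?c"
      unfolding lie_bracket_def
      using transpose_minus[OF mult_carrier_mat[OF A C] mult_carrier_mat[OF C A]]
        transpose_mult[OF A C] transpose_mult[OF C A] by simp
    then show ?thesis
      unfolding dual_action_def using a c by (intro eq_matI) auto
  qed
  ultimately have "dual_action (lie_bracket A C)
      = dual_action A * dual_action C - dual_action C * dual_action A" by simp
  then show ?thesis
    using minus_mult_distrib_mat_vec[OF mult_carrier_mat[OF dual_action_carrier[OF A] dual_action_carrier[OF C]]
        mult_carrier_mat[OF dual_action_carrier[OF C] dual_action_carrier[OF A]] l]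
      assoc_mult_mat_vec[OF dual_action_carrier[OF A] dual_action_carrier[OF C] l]
      assoc_mult_mat_vec[OF dual_action_carrier[OF C] dual_action_carrier[OF A] l] by simp
qed

lemma dual_action_smult_vec:
  fixes A :: "'a::field mat"
  assumes "A \<in> carrier_mat N N" "l \<in> carrier_vec N"
  shows "dual_action (c \<cdot>\<^sub>m A) *\<^sub>v l = c \<cdot>\<^sub>v (dual_action A *\<^sub>v l)"
  using assms by (intro eq_vecI)
    (auto simp: dual_action_def scalar_prod_def sum_distrib_left sum_negf mult.assoc)

lemma mat_eq_0_of_mult_vec:
  fixes A :: "'a::field mat"
  assumes A: "A \<in> carrier_mat N N" and z: "\<And>l. l \<in> carrier_vec N \<Longrightarrow> A *\<^sub>v l = 0\<^sub>v N"
  shows "A = 0\<^sub>m N N"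
proof (rule eq_matI)
  fix i j assume ij: "i < dim_row (0\<^sub>m N N)" "j < dim_col (0\<^sub>m N N)"
  have "A $$ (i, j) = (A *\<^sub>v unit_vec N j) $ i"
    using A ij by simp
  also have "\<dots> = 0" using z[OF unit_vec_carrier] ij by simp
  finally show "A $$ (i, j) = 0\<^sub>m N N $$ (i, j)" using ij by simp
qed (use A in auto)

lemma chevalley_carrier: "chev_h \<in> carrier_mat 2 2" "chev_x \<in> carrier_mat 2 2" "chev_y \<in> carrier_mat 2 2"
  by (simp_all add: chev_h_def chev_x_def chev_y_def mat_of_rows_list_def numeral_2_eq_2)

lemma chevalley_in_sl: "chev_h \<in> sl 2" "chev_x \<in> sl 2" "chev_y \<in> sl 2"
  by (simp_all add: sl_def mat_trace_def chev_h_def chev_x_def chev_y_def mat_of_rows_list_def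
      numeral_2_eq_2 lessThan_Suc)

lemma chevalley_brackets:
  "lie_bracket chev_h chev_x = (2 :: 'a::field) \<cdot>\<^sub>m chev_x"
  "lie_bracket chev_h chev_y = (- 2 :: 'a) \<cdot>\<^sub>m chev_y"
  "lie_bracket chev_x chev_y = (1 :: 'a) \<cdot>\<^sub>m chev_h"
  by (auto intro!: eq_matI simp: less_Suc_eq lie_bracket_def chev_h_def chev_x_def chev_y_def
        mat_of_rows_list_def scalar_prod_def numeral_2_eq_2)

lemma chev_h_nonzero: "chev_h \<noteq> (0\<^sub>m 2 2 :: 'a::field mat)"
proof
  assume "chev_h = (0\<^sub>m 2 2 :: 'a mat)"
  from arg_cong[OF this, of "\<lambda>A. A $$ (0, 0)"] show False
    by (simp add: chev_h_def mat_of_rows_list_def)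
qed

text \<open>
  The operators on linear forms on the scroll S obtained by pulling back along g: S \<rightarrow> X.
\<close>

lemma pullback_of_dual_action:
  fixes A g g' :: "'a::field mat"
  assumes A: "A \<in> carrier_mat N N" and g: "g \<in> carrier_mat N N" and g': "g' \<in> carrier_mat N N"
    and l: "l \<in> carrier_vec N"
  shows "- transpose_mat (g' * (A * g)) *\<^sub>v l
    = transpose_mat g *\<^sub>v (dual_action A *\<^sub>v (transpose_mat g' *\<^sub>v l))"
proof -
  let ?g = "transpose_mat g" and ?g' = "transpose_mat g'" and ?a = "transpose_mat A"
  have c: "?g \<in> carrier_mat N N" "?g' \<in> carrier_mat N N" "?a \<in> carrier_mat N N"
    using g g' A by simp_all
  have "transpose_mat (g' * (A * g)) = (?g * ?a) * ?g'"
    using transpose_mult[OF g' mult_carrier_mat[OF A g]] transpose_mult[OF A g] by simp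
  then have "- transpose_mat (g' * (A * g)) = (?g * dual_action A) * ?g'"
    using c by (simp add: dual_action_def)
  then show ?thesis
    using assoc_mult_mat_vec[OF mult_carrier_mat[OF c(1) dual_action_carrier[OF A]] c(2) l]
      assoc_mult_mat_vec[OF c(1) dual_action_carrier[OF A] mult_mat_vec_carrier[OF c(2) l]] by simp
qed

section \<open>The fibres are the lines of the ruling\<close>

theorem theorem4p6:
  fixes m n :: nat
    and X :: "'a::{alg_closed_field, field_char_0} vec set set"
    and R :: "'a vec set set set"
    and LSA :: "'a mat set"
    and \<sigma> :: "'a mat \<Rightarrow> 'a mat"
    and v w :: "'a vec"
    and l :: int
  assumes "n < m" and "m + n \<ge> 2"
    and "projectively_isomorphic (m + n + 2) X (scroll m n)"
    and "is_ruling m n X R"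
    and "levi_subalgebra (m + n + 2) LSA (lie_algebra_of (m + n + 2) X)"
    and "lie_isomorphism \<sigma> (sl 2) LSA"
    and "eigenvector (Rep \<sigma> chev_h) v (of_int l)"
    and "\<And>l' :: int. eigenvalue (Rep \<sigma> chev_h) (of_int l') \<Longrightarrow> l' \<le> l"
    and "w = Rep \<sigma> chev_y *\<^sub>v v"
  shows "{quotient_map_fiber X (m + n + 2) w v c | c. c \<in> proj_space 2} = R"
proof -
  define N where "N = m + n + 2"
  obtain g where g: "g \<in> GL N" and X: "X = proj_map g ` scroll m n"
    and R: "R = (\<lambda>l. proj_map g ` l) ` scroll_ruling m n"
    using assms(4) unfolding is_ruling_def N_def by blast
  obtain g' where g': "g' \<in> carrier_mat N N" "g * g' = 1\<^sub>m N" "g' * g = 1\<^sub>m N"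
    using GL_inverse[OF g] by metis
  have gc: "g \<in> carrier_mat N N" using g by (simp add: GL_def)
  let ?gt = "transpose_mat g" and ?gt' = "transpose_mat g'"
  have gt: "?gt \<in> carrier_mat N N" "?gt' \<in> carrier_mat N N" using gc g'(1) by simp_all
  have gt_inv: "?gt * ?gt' = 1\<^sub>m N" "?gt' * ?gt = 1\<^sub>m N"
    unfolding transpose_mult[OF g'(1) gc, symmetric] transpose_mult[OF gc g'(1), symmetric] g'(2,3)
    by (rule transpose_one)+
  have cancel: "?gt' *\<^sub>v (?gt *\<^sub>v u) = u" "?gt *\<^sub>v (?gt' *\<^sub>v u) = u" if "u \<in> carrier_vec N" for u
    by (rule mat_vec_cancel[OF gt(2,1) gt_inv(2) that], rule mat_vec_cancel[OF gt gt_inv(1) that])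

  have LSA: "LSA \<subseteq> lie_algebra_of N X"
    using assms(5) unfolding levi_subalgebra_def lie_subalgebra_def N_def by blast
  have bij: "bij_betw \<sigma> (sl 2) LSA"
    and scale: "\<And>c A. A \<in> sl 2 \<Longrightarrow> \<sigma> (c \<cdot>\<^sub>m A) = c \<cdot>\<^sub>m \<sigma> A"
    and bracket: "\<And>A B. A \<in> sl 2 \<Longrightarrow> B \<in> sl 2 \<Longrightarrow> \<sigma> (lie_bracket A B) = lie_bracket (\<sigma> A) (\<sigma> B)"
    using assms(6) unfolding lie_isomorphism_def by blast+
  have \<sigma>L: "\<sigma> A \<in> lie_algebra_of N X" if "A \<in> sl 2" for A
    using bij_betwE[OF bij] that LSA by blast
  have \<sigma>c: "\<sigma> A \<in> carrier_mat N N" if "A \<in> sl 2" for A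
    using \<sigma>L[OF that] by (simp add: lie_algebra_of_def sl_def)
  have \<rho>c: "Rep \<sigma> A \<in> carrier_mat N N" if "A \<in> sl 2" for A
    unfolding Rep_def by (rule dual_action_carrier[OF \<sigma>c[OF that]])

  define T where "T A = - transpose_mat (g' * (\<sigma> A * g))" for A
  have T: "T A *\<^sub>v u = ?gt *\<^sub>v (Rep \<sigma> A *\<^sub>v (?gt' *\<^sub>v u))" if "A \<in> sl 2" "u \<in> carrier_vec N" for A u
    unfolding T_def Rep_def by (rule pullback_of_dual_action[OF \<sigma>c[OF that(1)] gc g'(1) that(2)])
  have T': "T A *\<^sub>v (?gt *\<^sub>v u) = ?gt *\<^sub>v (Rep \<sigma> A *\<^sub>v u)" if "A \<in> sl 2" "u \<in> carrier_vec N" for A u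
    using T[OF that(1) mult_mat_vec_carrier[OF gt(1) that(2)]] cancel(1)[OF that(2)] by simp
  have covers: "\<exists>K M M'. covers_vector_field m n (T A) K M M'" if A: "A \<in> sl 2" for A
  proof -
    have "tangent_to_scroll m n (g' * (\<sigma> A * g))"
      by (rule tangent_of_lie_algebra[OF N_def gc g'(1) g'(3) X \<sigma>L[OF A]])
    moreover have "g' * (\<sigma> A * g) \<in> carrier_mat (m + n + 2) (m + n + 2)"
      using mult_carrier_mat[OF g'(1) mult_carrier_mat[OF \<sigma>c[OF A] gc]] unfolding N_def .
    ultimately show ?thesis
      using covers_vector_field_of_tangent[OF assms(1,2)] unfolding T_def by blast
  qed
  have T_bracket: "T A *\<^sub>v (T B *\<^sub>v u) - T B *\<^sub>v (T A *\<^sub>v u) = c \<cdot>\<^sub>v (T C *\<^sub>v u)"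
    if A: "A \<in> sl 2" and B: "B \<in> sl 2" and C: "C \<in> sl 2" and br: "lie_bracket A B = c \<cdot>\<^sub>m C"
      and u: "u \<in> carrier_vec N" for A B C c u
  proof -
    let ?u = "?gt' *\<^sub>v u"
    have uc: "?u \<in> carrier_vec N" by (rule mult_mat_vec_carrier[OF gt(2) u])
    have \<rho>u: "Rep \<sigma> D *\<^sub>v x \<in> carrier_vec N" if "D \<in> sl 2" "x \<in> carrier_vec N" for D x
      by (rule mult_mat_vec_carrier[OF \<rho>c[OF that(1)] that(2)])
    have "Rep \<sigma> A *\<^sub>v (Rep \<sigma> B *\<^sub>v ?u) - Rep \<sigma> B *\<^sub>v (Rep \<sigma> A *\<^sub>v ?u)
        = dual_action (lie_bracket (\<sigma> A) (\<sigma> B)) *\<^sub>v ?u"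
      unfolding Rep_def by (rule dual_action_bracket[OF \<sigma>c[OF A] \<sigma>c[OF B] uc])
    also have "lie_bracket (\<sigma> A) (\<sigma> B) = c \<cdot>\<^sub>m \<sigma> C"
      using bracket[OF A B] scale[OF C] br by simp
    also have "dual_action (c \<cdot>\<^sub>m \<sigma> C) *\<^sub>v ?u = c \<cdot>\<^sub>v (Rep \<sigma> C *\<^sub>v ?u)"
      unfolding Rep_def by (rule dual_action_smult_vec[OF \<sigma>c[OF C] uc])
    finally have "?gt *\<^sub>v (Rep \<sigma> A *\<^sub>v (Rep \<sigma> B *\<^sub>v ?u)) - ?gt *\<^sub>v (Rep \<sigma> B *\<^sub>v (Rep \<sigma> A *\<^sub>v ?u))
        = c \<cdot>\<^sub>v (?gt *\<^sub>v (Rep \<sigma> C *\<^sub>v ?u))"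
      using mult_minus_distrib_mat_vec[OF gt(1) \<rho>u[OF A \<rho>u[OF B uc]] \<rho>u[OF B \<rho>u[OF A uc]]]
        mult_mat_vec[OF gt(1) \<rho>u[OF C uc], of c] by simp
    then show ?thesis
      unfolding T[OF B u] T[OF A u] T[OF C u] T'[OF A \<rho>u[OF B uc]] T'[OF B \<rho>u[OF A uc]] .
  qed
  have T_nonzero: "\<exists>u\<in>carrier_vec N. T chev_h *\<^sub>v u \<noteq> 0\<^sub>v N"
  proof (rule ccontr)
    assume "\<not> ?thesis"
    then have zero: "T chev_h *\<^sub>v u = 0\<^sub>v N" if "u \<in> carrier_vec N" for u using that by blast
    have "Rep \<sigma> chev_h *\<^sub>v u = 0\<^sub>v N" if u: "u \<in> carrier_vec N" for u
    proof -
      have "?gt *\<^sub>v (Rep \<sigma> chev_h *\<^sub>v u) = 0\<^sub>v N"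
        using T'[OF chevalley_in_sl(1) u] zero[OF mult_mat_vec_carrier[OF gt(1) u]] by simp
      then have "Rep \<sigma> chev_h *\<^sub>v u = ?gt' *\<^sub>v 0\<^sub>v N"
        using cancel(1)[OF mult_mat_vec_carrier[OF \<rho>c[OF chevalley_in_sl(1)] u]] by simp
      then show ?thesis using gt(2) by auto
    qed
    then have "Rep \<sigma> chev_h = 0\<^sub>m N N"
      by (rule mat_eq_0_of_mult_vec[OF \<rho>c[OF chevalley_in_sl(1)]])
    then have "transpose_mat (- transpose_mat (\<sigma> chev_h)) = 0\<^sub>m N N"
      by (simp add: Rep_def dual_action_def)
    then have "- \<sigma> chev_h = 0\<^sub>m N N" by (simp add: transpose_uminus)
    then have "\<sigma> chev_h = - 0\<^sub>m N N" using uminus_uminus_mat[of "\<sigma> chev_h"] by simp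
    then have "\<sigma> chev_h = 0\<^sub>m N N" by auto
    moreover have "\<sigma> (0\<^sub>m 2 2) = 0\<^sub>m N N"
    proof -
      have "\<sigma> (0 \<cdot>\<^sub>m chev_h) = 0 \<cdot>\<^sub>m \<sigma> chev_h" by (rule scale[OF chevalley_in_sl(1)])
      moreover have "0 \<cdot>\<^sub>m chev_h = (0\<^sub>m 2 2 :: 'a mat)"
        using chevalley_carrier(1) by (intro eq_matI) auto
      moreover have "0 \<cdot>\<^sub>m \<sigma> chev_h = 0\<^sub>m N N"
        using \<sigma>c[OF chevalley_in_sl(1)] by (intro eq_matI) auto
      ultimately show ?thesis by simp
    qed
    moreover have "0\<^sub>m 2 2 \<in> sl 2" by (simp add: sl_def mat_trace_def)
    ultimately have "chev_h = (0\<^sub>m 2 2 :: 'a mat)"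
      using bij chevalley_in_sl(1) unfolding bij_betw_def inj_on_def by metis
    then show False using chev_h_nonzero by blast
  qed

  obtain Kh Mh Mh' where Th: "covers_vector_field m n (T chev_h) Kh Mh Mh'"
    using covers[OF chevalley_in_sl(1)] by blast
  obtain Kx Mx Mx' where Tx: "covers_vector_field m n (T chev_x) Kx Mx Mx'"
    using covers[OF chevalley_in_sl(2)] by blast
  obtain Ky My My' where Ty: "covers_vector_field m n (T chev_y) Ky My My'"
    using covers[OF chevalley_in_sl(3)] by blast
  interpret sl2_on_forms m n "T chev_h" "T chev_x" "T chev_y" Kh Mh Mh' Kx Mx Mx' Ky My My'
  proof (unfold_locales)
    show "n < m" by (rule assms(1))
  qed (use Th Tx Ty T_nonzero in \<open>auto simp only: N_def[symmetric]
      intro!: T_bracket chevalley_in_sl chevalley_brackets\<close>)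

  have dim: "dim_row (Rep \<sigma> chev_h) = N" using \<rho>c[OF chevalley_in_sl(1)] by simp
  have v: "v \<in> carrier_vec N" "v \<noteq> 0\<^sub>v N" "Rep \<sigma> chev_h *\<^sub>v v = of_int l \<cdot>\<^sub>v v"
    using assms(7) unfolding eigenvector_def dim by blast+
  have zero: "B *\<^sub>v 0\<^sub>v N = 0\<^sub>v N" if "B \<in> carrier_mat N N" for B :: "'a mat"
    using that by (intro eq_vecI) auto
  have v': "?gt *\<^sub>v v \<in> carrier_vec N" by (rule mult_mat_vec_carrier[OF gt(1) v(1)])
  have v'0: "?gt *\<^sub>v v \<noteq> 0\<^sub>v N" using cancel(1)[OF v(1)] zero[OF gt(2)] v(2) by auto
  have v'h: "T chev_h *\<^sub>v (?gt *\<^sub>v v) = of_int l \<cdot>\<^sub>v (?gt *\<^sub>v v)"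
    unfolding T'[OF chevalley_in_sl(1) v(1)] v(3) by (rule mult_mat_vec[OF gt(1) v(1)])
  have Tc: "T chev_h \<in> carrier_mat N N" using covers_vector_fieldD(1)[OF Th] unfolding N_def .
  have max: "k \<le> l" if ev: "eigenvalue (T chev_h) (of_int k)" for k
  proof (rule assms(8))
    obtain u where u: "u \<in> carrier_vec N" "u \<noteq> 0\<^sub>v N" "T chev_h *\<^sub>v u = of_int k \<cdot>\<^sub>v u"
      using ev Tc unfolding eigenvalue_def eigenvector_def by auto
    let ?u = "?gt' *\<^sub>v u"
    have uc: "?u \<in> carrier_vec N" by (rule mult_mat_vec_carrier[OF gt(2) u(1)])
    have "?u \<noteq> 0\<^sub>v N" using cancel(2)[OF u(1)] zero[OF gt(1)] u(2) by auto
    moreover have "Rep \<sigma> chev_h *\<^sub>v ?u = of_int k \<cdot>\<^sub>v ?u"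
    proof -
      have "Rep \<sigma> chev_h *\<^sub>v ?u = ?gt' *\<^sub>v (?gt *\<^sub>v (Rep \<sigma> chev_h *\<^sub>v ?u))"
        by (rule cancel(1)[symmetric, OF mult_mat_vec_carrier[OF \<rho>c[OF chevalley_in_sl(1)] uc]])
      also have "\<dots> = ?gt' *\<^sub>v (of_int k \<cdot>\<^sub>v u)"
        using T[OF chevalley_in_sl(1) u(1)] u(3) by simp
      also have "\<dots> = of_int k \<cdot>\<^sub>v ?u" by (rule mult_mat_vec[OF gt(2) u(1)])
      finally show ?thesis .
    qed
    ultimately show "eigenvalue (Rep \<sigma> chev_h) (of_int k)"
      unfolding eigenvalue_def eigenvector_def dim using uc by blast
  qed
  obtain c d p q p' q' where c: "c \<noteq> 0" and d: "d \<noteq> 0" and det: "p * q' - q * p' \<noteq> 0"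
    and vf: "?gt *\<^sub>v v = linear_form m n ([:c:] * [:p, q:] ^ m) 0"
    and wf: "T chev_y *\<^sub>v (?gt *\<^sub>v v) = linear_form m n ([:d:] * ([:p, q:] ^ (m - 1) * [:p', q':])) 0"
    by (rule highest_weight_form[OF v'[unfolded N_def] v'0[unfolded N_def] v'h max])
  have m: "m \<ge> 1" using assms(1) by simp
  have power: "[:p, q:] ^ m = [:p, q:] ^ (m - 1) * [:p, q:]"
    by (rule power_minus_mult[symmetric]) (use m in simp)
  have pair: "u \<bullet> (g *\<^sub>v x) = (?gt *\<^sub>v u) \<bullet> x" if "u \<in> carrier_vec N" "x \<in> carrier_vec N" for u x
    by (rule transpose_vec_mult_scalar[OF gc that(2,1), symmetric])
  have wc: "w \<in> carrier_vec N"
    unfolding assms(9) by (rule mult_mat_vec_carrier[OF \<rho>c[OF chevalley_in_sl(3)] v(1)])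
  have gw: "?gt *\<^sub>v w = T chev_y *\<^sub>v (?gt *\<^sub>v v)"
    unfolding assms(9) by (rule T'[OF chevalley_in_sl(3) v(1), symmetric])
  have fiber: "quotient_map_fiber X N w v
        (proj_pt (vec_of_list [d * (p' * s0 + q' * s1), c * (p * s0 + q * s1)]))
      = proj_map g ` line_over m n s0 s1" if s: "(s0, s1) \<noteq> (0, 0)" for s0 s1
  proof (rule quotient_map_fiber_eq_line[OF N_def m g X _ _ c d det s])
    fix x :: "'a vec" assume x: "x \<in> carrier_vec N"
    show "v \<bullet> (g *\<^sub>v x) = linear_form m n ([:c:] * ([:p, q:] ^ (m - 1) * [:p, q:])) 0 \<bullet> x"
      unfolding pair[OF v(1) x] vf power ..
    show "w \<bullet> (g *\<^sub>v x) = linear_form m n ([:d:] * ([:p, q:] ^ (m - 1) * [:p', q':])) 0 \<bullet> x"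
      unfolding pair[OF wc x] gw wf ..
  qed
  have ruling: "R = {proj_map g ` line_over m n s0 s1 | s0 s1. (s0, s1) \<noteq> (0, 0)}"
    unfolding R scroll_ruling_eq by blast
  have vec0: "vec_of_list [a, b] \<noteq> 0\<^sub>v 2" if "(a, b) \<noteq> (0, 0)" for a b :: 'a
  proof
    assume eq: "vec_of_list [a, b] = 0\<^sub>v 2"
    have "vec_of_list [a, b] $ i = 0" if "i < 2" for i unfolding eq using that by simp
    from this[of 0] this[of 1] that show False
      by (simp add: vec_of_list_index del: vec_of_list_Cons)
  qed
  show ?thesis
    unfolding ruling N_def[symmetric]
  proof (intro equalityI subsetI)
    fix Y assume "Y \<in> {quotient_map_fiber X N w v c | c. c \<in> proj_space 2}"
    then obtain y where y: "y \<in> carrier_vec 2" "y \<noteq> 0\<^sub>v 2"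
      and Y: "Y = quotient_map_fiber X N w v (proj_pt y)" unfolding proj_space_def by blast
    \<comment> \<open>The parameters are found by inverting the linear map with rows p', q' and p, q.\<close>
    define y0 y1 where "y0 = y $ 0 / d" and "y1 = y $ 1 / c"
    define \<Delta> where "\<Delta> = p * q' - q * p'"
    define s0 s1 where "s0 = (q' * y1 - q * y0) / \<Delta>" and "s1 = (p * y0 - p' * y1) / \<Delta>"
    have \<Delta>: "\<Delta> \<noteq> 0" using det by (simp add: \<Delta>_def)
    have "\<Delta> * (p' * s0 + q' * s1) = p' * (q' * y1 - q * y0) + q' * (p * y0 - p' * y1)"
      using \<Delta> by (simp add: s0_def s1_def distrib_left)
    also have "\<dots> = \<Delta> * y0" by (simp add: \<Delta>_def algebra_simps)
    finally have e0: "p' * s0 + q' * s1 = y0" using \<Delta> by simp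
    have "\<Delta> * (p * s0 + q * s1) = p * (q' * y1 - q * y0) + q * (p * y0 - p' * y1)"
      using \<Delta> by (simp add: s0_def s1_def distrib_left)
    also have "\<dots> = \<Delta> * y1" by (simp add: \<Delta>_def algebra_simps)
    finally have e1: "p * s0 + q * s1 = y1" using \<Delta> by simp
    have yv: "y = vec_of_list [d * (p' * s0 + q' * s1), c * (p * s0 + q * s1)]"
      unfolding e0 e1 using y(1) c d
      by (intro eq_vecI) (auto simp: vec_of_list_index y0_def y1_def less_Suc_eq numeral_2_eq_2
          simp del: vec_of_list_Cons)
    have s: "(s0, s1) \<noteq> (0, 0)"
    proof
      assume "(s0, s1) = (0, 0)"
      then have "y = 0\<^sub>v 2" unfolding yv
        by (intro eq_vecI) (auto simp: vec_of_list_index less_Suc_eq numeral_2_eq_2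
            simp del: vec_of_list_Cons)
      then show False using y(2) by blast
    qed
    show "Y \<in> {proj_map g ` line_over m n s0 s1 | s0 s1. (s0, s1) \<noteq> (0, 0)}"
      using fiber[OF s] s unfolding Y yv by blast
  next
    fix Y assume "Y \<in> {proj_map g ` line_over m n s0 s1 | s0 s1. (s0, s1) \<noteq> (0, 0)}"
    then obtain s0 s1 where s: "(s0, s1) \<noteq> (0, 0)" and Y: "Y = proj_map g ` line_over m n s0 s1" by blast
    have "(d * (p' * s0 + q' * s1), c * (p * s0 + q * s1)) \<noteq> (0, 0)"
    proof
      assume "(d * (p' * s0 + q' * s1), c * (p * s0 + q * s1)) = (0, 0)"
      then have z: "p' * s0 + q' * s1 = 0" "p * s0 + q * s1 = 0" using c d by auto
      have "(p * q' - q * p') * s0 = q' * (p * s0 + q * s1) - q * (p' * s0 + q' * s1)"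
        "(p * q' - q * p') * s1 = p * (p' * s0 + q' * s1) - p' * (p * s0 + q * s1)"
        by (simp_all add: algebra_simps)
      then show False using z det s by simp
    qed
    then have "proj_pt (vec_of_list [d * (p' * s0 + q' * s1), c * (p * s0 + q * s1)]) \<in> proj_space 2"
      by (intro proj_pt_in_proj_space vec0) (simp_all add: carrier_dim_vec numeral_2_eq_2 del: vec_of_list_Cons)
    then show "Y \<in> {quotient_map_fiber X N w v c | c. c \<in> proj_space 2}"
      using fiber[OF s] unfolding Y by blast
  qed
qed

end
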